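(* Let $N\ge 2$, let $\Omega\subset\mathbb{R}^N$ be a bounded domain with $C^{1,1}$-boundary, $p>1$, $s\in(0,1)$, and let $K:\mathbb{R}^N\times\mathbb{R}^N\to\mathbb{R}$ be measurable and such that, for some constants $0<C_1\le C_2$ and for a.e. $x,y\in\mathbb{R}^N$, $K(x,y)=K(y,x)$ and $C_1\le K(x,y)|x-y|^{N+ps}\le C_2$. Let $h:\Omega\times\mathbb{R}\to[0,\infty)$ be a Carathéodory function such that $h(x,\cdot)$ is nondecreasing in $\mathbb{R}$ for a.e. $x\in\Omega$, and $h(x,t)\le C_0(1+|t|^{q-1})$ for a.e. $x\in\Omega$ and all $t\in\mathbb{R}$, with some $C_0>0$ and $q\in(1,p)$. Let $g_0\in L^\infty(\Omega)$ with $g_0\ge 0$ a.e. and $g_0\neq 0$, let $\mathcal{G}$ be the rearrangement class of $g_0$, $\overline{\mathcal{G}}$ its weak* closure in $L^\infty(\Omega)$, and for $g\in\overline{\mathcal{G}}$ set $$\Phi(g)=\sup_{u\in W^{s,p}_0(\Omega)}E(g,u)=E(g,u_g),\qquad E(g,u)=\int_\Omega\big[gu-H(x,u)\big]\,dx-\frac{[u]_K^p}{p},\qquad H(x,t)=\int_0^t h(x,\tau)\,d\tau,$$ where $u_g$ is the unique maximizer of $E(g,\cdot)$ in $W^{s,p}_0(\Omega)$. Then: (i) there exists $\hat g\in\mathcal{G}$ such that $\Phi(\hat g)\ge\Phi(g)$ for all $g\in\mathcal{G}$; (ii) for every $\hat g\in\mathcal{G}$ with the property in (i) and every $g\in\overline{\mathcal{G}}\setminus\mathcal{G}$,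 one has $\Phi(\hat g)>\Phi(g)$; (iii) for every $\hat g\in\mathcal{G}$ with the property in (i) there exists a nondecreasing map $\eta:\mathbb{R}\to\mathbb{R}$ such that $\hat g=\eta\circ u_{\hat g}$ a.e. in $\Omega$.
   Context: Rearrangement class: $\mathcal{G}$ is the set of all $g\in L^\infty(\Omega)$, $g\ge 0$ a.e., such that $|\{x\in\Omega: g(x)>t\}|=|\{x\in\Omega: g_0(x)>t\}|$ for all $t\ge 0$, where $|\cdot|$ is Lebesgue measure. $\overline{\mathcal{G}}$ is the closure of $\mathcal{G}$ in $L^\infty(\Omega)=L^1(\Omega)^*$ for the weak* topology; it is known to be convex and sequentially weakly* compact. Function space: $W^{s,p}_0(\Omega)=\{u\in L^p(\mathbb{R}^N): \iint_{\mathbb{R}^N\times\mathbb{R}^N}\frac{|u(x)-u(y)|^p}{|x-y|^{N+ps}}\,dx\,dy<\infty,\ u=0 \text{ a.e. in } \mathbb{R}^N\setminus\Omega\}$, and $[u]_K=\big(\iint_{\mathbb{R}^N\times\mathbb{R}^N}|u(x)-u(y)|^pK(x,y)\,dx\,dy\big)^{1/p}$ (a norm on $W^{s,p}_0(\Omega)$ equivalent to the Gagliardo norm). For $u,\varphi\in W^{s,p}_0(\Omega)$ let $\langle\mathcal{L}_K u,\varphi\rangle=\iint_{\mathbb{R}^N\times\mathbb{R}^N}|u(x)-u(y)|^{p-2}(u(x)-u(y))(\varphi(x)-\varphi(y))K(x,y)\,dx\,dy$. It is known that for every $g\in\overline{\mathcal{G}}$ there is a unique $u_g\in W^{s,p}_0(\Omega)$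 with $\langle\mathcal{L}_K u_g,\varphi\rangle+\int_\Omega h(x,u_g)\varphi\,dx=\int_\Omega g\varphi\,dx$ for all $\varphi\in W^{s,p}_0(\Omega)$ (the weak solution of $\mathcal{L}_K u+h(x,u)=g$ in $\Omega$, $u=0$ in $\mathbb{R}^N\setminus\Omega$), and that $u_g$ is the unique maximizer of $E(g,\cdot)$ in $W^{s,p}_0(\Omega)$. *)

theory Defs
  imports "HOL-Analysis.Analysis"
begin

definition C11_on :: "'a::euclidean_space set \<Rightarrow> ('a \<Rightarrow> real) \<Rightarrow> bool" where
  "C11_on S f \<longleftrightarrow> (\<exists>G L. (\<forall>x\<in>S. (f has_derivative (\<lambda>v. G x \<bullet> v)) (at x within S)) \<and> L-lipschitz_on S G)"

text \<open>Near each boundary point the domain is, after a rigid motion, the part of the ball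
  lying above the graph of a C11 function of N-1 variables. The unit vector \<open>e\<close> is the vertical
  direction, and the hyperplane orthogonal to \<open>e\<close> plays the role of the first N-1 coordinates.\<close>

definition C11_boundary :: "'a::euclidean_space set \<Rightarrow> bool" where
  "C11_boundary \<Omega> \<longleftrightarrow>
     (\<forall>z\<in>frontier \<Omega>. \<exists>r>0. \<exists>e \<gamma>. norm e = 1 \<and> C11_on {y. y \<bullet> e = 0} \<gamma> \<and>
        \<Omega> \<inter> ball z r = {x \<in> ball z r. \<gamma> (x - (x \<bullet> e) *\<^sub>R e) < x \<bullet> e})"

text \<open>Elements of \<open>L\<^sup>\<infinity>\<close>, \<open>L\<^sup>1\<close> and the fractional Sobolev space are represented by functions, not by
  classes modulo null sets. All the sets below are invariant under changes on null sets;
  values outside \<open>\<Omega>\<close> are irrelevant for \<open>Linfty \<Omega>\<close> and \<open>L1 \<Omega>\<close>.\<close>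

definition Linfty :: "'a::euclidean_space set \<Rightarrow> ('a \<Rightarrow> real) set" where
  "Linfty \<Omega> = {g \<in> borel_measurable (lebesgue_on \<Omega>). \<exists>C. AE x in lebesgue_on \<Omega>. \<bar>g x\<bar> \<le> C}"

definition L1 :: "'a::euclidean_space set \<Rightarrow> ('a \<Rightarrow> real) set" where
  "L1 \<Omega> = {f. integrable (lebesgue_on \<Omega>) f}"

text \<open>The weak* topology is the coarsest topology on \<open>Linfty \<Omega>\<close> making all pairings with elements
  of \<open>L1 \<Omega>\<close> continuous. As functions are not identified modulo null sets it is not Hausdorff;
  its closed sets are the preimages of the closed sets of the quotient.\<close>

definition weak_star_topology :: "'a::euclidean_space set \<Rightarrow> ('a \<Rightarrow> real) topology" where
  "weak_star_topology \<Omega> =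
     pullback_topology (Linfty \<Omega>) (\<lambda>g. \<lambda>f\<in>L1 \<Omega>. LINT x|lebesgue_on \<Omega>. g x * f x)
       (product_topology (\<lambda>_. euclideanreal) (L1 \<Omega>))"

definition rearrangements :: "'a::euclidean_space set \<Rightarrow> ('a \<Rightarrow> real) \<Rightarrow> ('a \<Rightarrow> real) set" where
  "rearrangements \<Omega> g0 =
     {g \<in> Linfty \<Omega>. (AE x in lebesgue_on \<Omega>. 0 \<le> g x) \<and>
        (\<forall>t\<ge>0. emeasure lebesgue {x \<in> \<Omega>. t < g x} = emeasure lebesgue {x \<in> \<Omega>. t < g0 x})}"

definition rearrangements_closure :: "'a::euclidean_space set \<Rightarrow> ('a \<Rightarrow> real) \<Rightarrow> ('a \<Rightarrow> real) set" where
  "rearrangements_closure \<Omega> g0 = weak_star_topology \<Omega> closure_of rearrangements \<Omega> g0"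

definition Wsp0 :: "real \<Rightarrow> real \<Rightarrow> 'a::euclidean_space set \<Rightarrow> ('a \<Rightarrow> real) set" where
  "Wsp0 s p \<Omega> =
     {u \<in> borel_measurable lebesgue.
        integrable lebesgue (\<lambda>x. \<bar>u x\<bar> powr p) \<and>
        (\<integral>\<^sup>+(x, y). ennreal (\<bar>u x - u y\<bar> powr p / norm (x - y) powr (real DIM('a) + p * s)) \<partial>lebesgue) < \<infinity> \<and>
        (AE x in lebesgue. x \<notin> \<Omega> \<longrightarrow> u x = 0)}"

definition K_norm :: "('a::euclidean_space \<Rightarrow> 'a \<Rightarrow> real) \<Rightarrow> real \<Rightarrow> ('a \<Rightarrow> real) \<Rightarrow> real" where
  "K_norm K p u = (\<integral>(x, y). \<bar>u x - u y\<bar> powr p * K x y \<partial>lebesgue) powr (1 / p)"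

definition caratheodory :: "'a::euclidean_space set \<Rightarrow> ('a \<Rightarrow> real \<Rightarrow> real) \<Rightarrow> bool" where
  "caratheodory \<Omega> h \<longleftrightarrow>
     (\<forall>t. (\<lambda>x. h x t) \<in> borel_measurable (lebesgue_on \<Omega>)) \<and>
     (AE x in lebesgue_on \<Omega>. continuous_on UNIV (h x))"

text \<open>The interval integral is oriented, so for negative \<open>t\<close> this is minus the integral over \<open>{t..0}\<close>.\<close>

definition primitive :: "('a \<Rightarrow> real \<Rightarrow> real) \<Rightarrow> 'a \<Rightarrow> real \<Rightarrow> real" where
  "primitive h x t = (LBINT \<tau>=ereal 0..ereal t. h x \<tau>)"

definition energy ::
  "('a::euclidean_space \<Rightarrow> 'a \<Rightarrow> real) \<Rightarrow> ('a \<Rightarrow> real \<Rightarrow> real) \<Rightarrow> real \<Rightarrow> 'a set \<Rightarrow>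
   ('a \<Rightarrow> real) \<Rightarrow> ('a \<Rightarrow> real) \<Rightarrow> real" where
  "energy K h p \<Omega> g u =
     (LINT x|lebesgue_on \<Omega>. g x * u x - primitive h x (u x)) - K_norm K p u powr p / p"

text \<open>Under the standing hypotheses the energy is bounded above on \<open>Wsp0 s p \<Omega>\<close>,
  so the supremum, taken in the reals, is the true one.\<close>

definition max_energy ::
  "('a::euclidean_space \<Rightarrow> 'a \<Rightarrow> real) \<Rightarrow> ('a \<Rightarrow> real \<Rightarrow> real) \<Rightarrow> real \<Rightarrow> real \<Rightarrow> 'a set \<Rightarrow>
   ('a \<Rightarrow> real) \<Rightarrow> real" where
  "max_energy K h s p \<Omega> g = (SUP u\<in>Wsp0 s p \<Omega>. energy K h p \<Omega> g u)"

text \<open>The maximizer is unique up to null sets, so \<open>arg_max_on\<close> chooses a representative of it.\<close>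

definition maximizer ::
  "('a::euclidean_space \<Rightarrow> 'a \<Rightarrow> real) \<Rightarrow> ('a \<Rightarrow> real \<Rightarrow> real) \<Rightarrow> real \<Rightarrow> real \<Rightarrow> 'a set \<Rightarrow>
   ('a \<Rightarrow> real) \<Rightarrow> ('a \<Rightarrow> real)" where
  "maximizer K h s p \<Omega> g = arg_max_on (energy K h p \<Omega> g) (Wsp0 s p \<Omega>)"

end

theory Submission
  imports Defs "HOL-Complex_Analysis.Great_Picard"
begin

text \<open>Write \<open>J u = \<integral> H(x, u) + [u]\<^sub>K\<^sup>p / p\<close>, so that \<open>\<Phi>\<close> is the convex conjugate of \<open>J\<close>, and
  \<open>M u = sup {\<integral> g u | g \<in> \<G>}\<close>. Interchanging suprema, \<open>sup \<Phi> = sup (M - J)\<close> over \<open>\<G>\<close>, and also over its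
  weak* closure because \<open>\<integral> g u \<le> M u\<close> is a weak* closed condition on \<open>g\<close>. As \<open>M\<close> is Lipschitz in
  \<open>L\<^sup>1\<close> and the fractional Sobolev space embeds compactly into \<open>L\<^sup>1\<close>, \<open>M - J\<close> attains its maximum at
  some \<open>u\<close>; a rearrangement of \<open>g\<^sub>0\<close> comonotone with \<open>u\<close> attains \<open>M u\<close>, hence maximizes \<open>\<Phi>\<close>. No
  weak* compactness is needed.

  If \<open>g\<close> maximizes \<open>\<Phi>\<close> on the closure with associated \<open>u\<close>, then \<open>u\<close> is also a maximizer for every
  rearrangement \<open>f\<close> attaining \<open>M u\<close>, and differentiability of \<open>J\<close> forces \<open>f = g\<close> a.e. This gives (ii).
  For (iii), build \<open>f\<close> by sorting along \<open>u\<close> and breaking ties once by a coordinate and once by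
  its negative: both constructions give \<open>g\<close>, so \<open>g\<close> is constant on the level sets of \<open>u\<close>.\<close>

text \<open>The equality case of the interchange of suprema carries the proof: \<Phi> g =
  \<integral> g u - J u \<le> M u - J u \<le> S with S = max (M - J), and a maximizing g turns both
  inequalities into equalities. Replacing g by any rearrangement f that is optimal for the same u
  keeps the value S at u.

  The obstacle is that u may be constant on a set of positive measure. There u alone does not say
  how to arrange g0, and as far as the bathtub principle can tell the optimal f is not unique. The
  argument exploits this freedom: every optimal f has to coincide with g, so two opposite ways of
  filling a plateau must agree, which happens only if no plateau is split.

  Differentiability of J enters through symmetric second differences. Two right-hand sides with a
  common maximizer are two subgradients of the convex J at u, and a second difference of order
  o(1/n) at step 1/n leaves room for only one.

  Compactness rests on the kernel exponent N + p s exceeding N: a bounded seminorm then forces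
  functions to be L1-close to their averages over small balls centred at finitely many grid
  points.\<close>

subsection \<open>Comonotone rearrangements\<close>

text \<open>Up-closed sets of the order that sorts by \<open>u\<close> and breaks ties by \<open>w\<close>. They form a chain, and if
  \<open>w\<close> has null level sets they take every measure, even when \<open>u\<close> has level sets of positive measure.\<close>

definition lex_upper :: "'a set \<Rightarrow> ('a \<Rightarrow> real) \<Rightarrow> ('a \<Rightarrow> real) \<Rightarrow> 'a set \<Rightarrow> bool" where
  "lex_upper X u w S \<longleftrightarrow>
     S \<subseteq> X \<and> (\<forall>x\<in>S. \<forall>y\<in>X. u x < u y \<or> u x = u y \<and> w x \<le> w y \<longrightarrow> y \<in> S)"

lemma lex_upper_comparable:
  assumes "lex_upper X u w S" "lex_upper X u w T"
  shows "S \<subseteq> T \<or> T \<subseteq> S"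
proof (rule ccontr)
  assume "\<not> ?thesis"
  then obtain x y where "x \<in> S" "x \<notin> T" "y \<in> T" "y \<notin> S" by blast
  moreover have "u x < u y \<or> u x = u y \<and> w x \<le> w y \<or> u y < u x \<or> u y = u x \<and> w y \<le> w x"
    by linarith
  ultimately show False
    using assms unfolding lex_upper_def by blast
qed

text \<open>\<open>c\<close> is the infimum of the levels whose strict superlevel set has measure at
  most \<open>m\<close>. Continuity of the measure along \<open>c + d n\<close> and
  \<open>c - d n\<close> gives the two inequalities; the gap between them is the mass of the level
  set at \<open>c\<close>. The strict bounds on \<open>m\<close> keep the infimum finite.\<close>

lemma (in finite_measure) quantile_exists:
  fixes f :: "'a \<Rightarrow> real"
  assumes [measurable]: "A \<in> sets M" "f \<in> borel_measurable M" and m: "0 < m" "m < measure M A"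
  shows "\<exists>c. measure M {x\<in>A. c < f x} \<le> m \<and> m \<le> measure M {x\<in>A. c \<le> f x}"
proof -
  define F where "F c = measure M {x\<in>A. c < f x}" for c
  have sub: "A \<subseteq> space M" using assms(1) sets.sets_into_space by blast
  have eqs: "{x\<in>A. P x} = {x\<in>space M. x \<in> A \<and> P x}" for P using sub by blast
  have [measurable]: "{x\<in>A. c < f x} \<in> sets M" "{x\<in>A. c \<le> f x} \<in> sets M" for c
    unfolding eqs by measurable
  have anti: "F d \<le> F c" if "c \<le> d" for c d
    unfolding F_def using that by (intro finite_measure_mono) auto
  define C where "C = {c. F c \<le> m}"
  have "(\<lambda>n. F (real n)) \<longlonglongrightarrow> measure M (\<Inter>n. {x\<in>A. real n < f x})"
    unfolding F_def by (intro finite_Lim_measure_decseq) (auto simp: decseq_def)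
  moreover have "(\<Inter>n. {x\<in>A. real n < f x}) = {}"
  proof -
    have "\<exists>n. \<not> real n < f x" for x
      using reals_Archimedean2[of "f x"] by (meson less_asym)
    then show ?thesis by auto
  qed
  ultimately have "(\<lambda>n. F (real n)) \<longlonglongrightarrow> 0" by simp
  then have "eventually (\<lambda>n. F (real n) < m) sequentially"
    using m(1) by (rule order_tendstoD)
  then obtain n where "F (real n) < m" by (auto simp: eventually_sequentially)
  then have Cne: "C \<noteq> {}" unfolding C_def by (auto intro: less_imp_le)
  have "(\<lambda>n. F (- real n)) \<longlonglongrightarrow> measure M (\<Union>n. {x\<in>A. - real n < f x})"
    unfolding F_def by (intro finite_Lim_measure_incseq) (auto simp: incseq_def)
  moreover have "(\<Union>n. {x\<in>A. - real n < f x}) = A"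
  proof -
    have "\<exists>n. - real n < f x" for x
      using reals_Archimedean2[of "- f x"] by (metis minus_less_iff)
    then show ?thesis by auto
  qed
  ultimately have "(\<lambda>n. F (- real n)) \<longlonglongrightarrow> measure M A" by simp
  then have "eventually (\<lambda>n. m < F (- real n)) sequentially"
    using m(2) by (rule order_tendstoD)
  then obtain k where k: "m < F (- real k)" by (auto simp: eventually_sequentially)
  have Cb: "bdd_below C"
  proof (rule bdd_belowI)
    fix c assume "c \<in> C"
    then show "- real k \<le> c" unfolding C_def
      using anti[of c "- real k"] k by force
  qed
  define c where "c = Inf C"
  have up: "F d \<le> m" if cd: "c < d" for d
  proof -
    obtain c' where "c' \<in> C" "c' < d" using cInf_lessD[OF Cne, of d] cd unfolding c_def by blast
    then show ?thesis using anti[of c' d] unfolding C_def by auto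
  qed
  have lo: "m < F d" if "d < c" for d
  proof (rule ccontr)
    assume "\<not> ?thesis"
    then have "d \<in> C" unfolding C_def by auto
    then show False using that cInf_lower[OF _ Cb] unfolding c_def by force
  qed
  define d where "d n = inverse (real (Suc n))" for n
  have d: "0 < d n" for n unfolding d_def by simp
  have d_anti: "d n \<le> d k" if "k \<le> n" for k n unfolding d_def using that by (simp add: field_simps)
  have d_small: "\<exists>n. d n < r" if "0 < r" for r unfolding d_def using reals_Archimedean[OF that] .
  have "(\<lambda>n. F (c + d n)) \<longlonglongrightarrow> measure M (\<Union>n. {x\<in>A. c + d n < f x})"
    unfolding F_def by (intro finite_Lim_measure_incseq) (use d_anti in \<open>force simp: incseq_def\<close>)+
  moreover have "(\<Union>n. {x\<in>A. c + d n < f x}) = {x\<in>A. c < f x}"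
  proof -
    have "c < t \<longleftrightarrow> (\<exists>n. c + d n < t)" for t
      using d d_small[of "t - c"] by (metis add.commute diff_gt_0_iff_gt less_add_same_cancel1 less_diff_eq less_trans)
    then show ?thesis by blast
  qed
  ultimately have "(\<lambda>n. F (c + d n)) \<longlonglongrightarrow> F c" by (simp add: F_def)
  then have 1: "F c \<le> m"
    by (rule LIMSEQ_le_const2) (auto intro!: up d)
  have "(\<lambda>n. F (c - d n)) \<longlonglongrightarrow> measure M (\<Inter>n. {x\<in>A. c - d n < f x})"
    unfolding F_def by (intro finite_Lim_measure_decseq) (use d_anti in \<open>force simp: decseq_def\<close>)+
  moreover have "(\<Inter>n. {x\<in>A. c - d n < f x}) = {x\<in>A. c \<le> f x}"
  proof -
    have "c \<le> t \<longleftrightarrow> (\<forall>n. c - d n < t)" for t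
    proof
      show "\<forall>n. c - d n < t" if "c \<le> t" using that d by (smt (verit))
      show "c \<le> t" if "\<forall>n. c - d n < t"
      proof (rule ccontr)
        assume "\<not> c \<le> t"
        then obtain n where "d n < c - t" using d_small[of "c - t"] by auto
        then show False using that by (smt (verit))
      qed
    qed
    then show ?thesis by blast
  qed
  ultimately have "(\<lambda>n. F (c - d n)) \<longlonglongrightarrow> measure M {x\<in>A. c \<le> f x}" by simp
  then have 2: "m \<le> measure M {x\<in>A. c \<le> f x}"
    by (rule LIMSEQ_le_const) (auto intro!: less_imp_le lo d)
  show ?thesis using 1 2 unfolding F_def by blast
qed

text \<open>A quantile of \<open>u\<close> leaves only its level set \<open>A\<close> at
  \<open>c\<close> undecided. A quantile of \<open>w\<close> inside \<open>A\<close> supplies the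
  missing mass exactly, because the level sets of \<open>w\<close> are null. Extreme masses are
  split off twice since \<open>quantile_exists\<close> wants strict inequalities.\<close>

lemma (in finite_measure) lex_upper_of_measure:
  fixes u w :: "'a \<Rightarrow> real"
  assumes [measurable]: "u \<in> borel_measurable M" "w \<in> borel_measurable M"
    and null: "\<And>\<tau>. measure M {x\<in>space M. w x = \<tau>} = 0"
    and m: "0 \<le> m" "m \<le> measure M (space M)"
  shows "\<exists>S\<in>sets M. lex_upper (space M) u w S \<and> measure M S = m"
proof (cases "m = 0 \<or> m = measure M (space M)")
  case True
  then show ?thesis
  proof
    assume "m = 0" then show ?thesis by (intro bexI[of _ "{}"]) (auto simp: lex_upper_def)
  next
    assume "m = measure M (space M)" then show ?thesis
      by (intro bexI[of _ "space M"]) (auto simp: lex_upper_def)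
  qed
next
  case False
  then obtain c where c: "measure M {x\<in>space M. c < u x} \<le> m" "m \<le> measure M {x\<in>space M. c \<le> u x}"
    using quantile_exists[of "space M" u m] m by force
  define A where "A = {x\<in>space M. u x = c}"
  have [measurable]: "A \<in> sets M" unfolding A_def by measurable
  have split: "measure M ({x\<in>space M. c < u x} \<union> B) = measure M {x\<in>space M. c < u x} + measure M B"
    if "B \<in> sets M" "B \<subseteq> A" for B
    using that by (intro finite_measure_Union) (auto simp: A_def)
  have "{x\<in>space M. c \<le> u x} = {x\<in>space M. c < u x} \<union> A" unfolding A_def by auto
  then have cA: "measure M {x\<in>space M. c \<le> u x} = measure M {x\<in>space M. c < u x} + measure M A"
    using split[of A] by simp
  show ?thesis
  proof (cases "m = measure M {x\<in>space M. c < u x} \<or> m = measure M {x\<in>space M. c \<le> u x}")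
    case True
    then show ?thesis
    proof
      assume "m = measure M {x\<in>space M. c < u x}"
      then show ?thesis
        by (intro bexI[of _ "{x\<in>space M. c < u x}"]) (auto simp: lex_upper_def)
    next
      assume "m = measure M {x\<in>space M. c \<le> u x}"
      then show ?thesis
        by (intro bexI[of _ "{x\<in>space M. c \<le> u x}"]) (auto simp: lex_upper_def)
    qed
  next
    case False
    define m' where "m' = m - measure M {x\<in>space M. c < u x}"
    have "0 < m'" "m' < measure M A" using False c cA unfolding m'_def by auto
    then obtain \<tau> where \<tau>: "measure M {x\<in>A. \<tau> < w x} \<le> m'" "m' \<le> measure M {x\<in>A. \<tau> \<le> w x}"
      using quantile_exists[of A w m'] by auto
    have eqA: "{x\<in>A. P x} = {x\<in>space M. x \<in> A \<and> P x}" for P by (auto simp: A_def)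
    have meas[measurable]: "{x\<in>A. \<tau> < w x} \<in> sets M" "{x\<in>A. \<tau> \<le> w x} \<in> sets M" "{x\<in>A. w x = \<tau>} \<in> sets M"
      unfolding eqA by measurable
    have "measure M {x\<in>A. \<tau> \<le> w x} = measure M ({x\<in>A. \<tau> < w x} \<union> {x\<in>A. w x = \<tau>})"
      by (rule arg_cong[where f="measure M"]) auto
    also have "\<dots> \<le> measure M {x\<in>A. \<tau> < w x} + measure M {x\<in>A. w x = \<tau>}"
      by (rule measure_Un_le) measurable
    also have "measure M {x\<in>A. w x = \<tau>} \<le> measure M {x\<in>space M. w x = \<tau>}"
      by (intro finite_measure_mono) (auto simp: A_def)
    also have "\<dots> = 0" by (rule null)
    finally have eq: "measure M {x\<in>A. \<tau> < w x} = m'" using \<tau> by linarith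
    show ?thesis
    proof (intro bexI[of _ "{x\<in>space M. c < u x} \<union> {x\<in>A. \<tau> < w x}"] conjI)
      show "lex_upper (space M) u w ({x \<in> space M. c < u x} \<union> {x \<in> A. \<tau> < w x})"
        by (auto simp: lex_upper_def A_def)
      show "measure M ({x \<in> space M. c < u x} \<union> {x \<in> A. \<tau> < w x}) = m"
        by (subst split) (use eq in \<open>auto simp: m'_def\<close>)
    qed measurable
  qed
qed

text \<open>\<open>S - A\<close> and \<open>A - S\<close> have equal measure, and \<open>u\<close>
  is at least as large on the first as on the second: otherwise the upper set \<open>S\<close> would
  contain a point of \<open>A - S\<close>. A constant between the two ranges of values compares the
  integrals.\<close>

lemma (in finite_measure) bathtub:
  fixes u :: "'a \<Rightarrow> real"
  assumes u: "integrable M u" and [measurable]: "A \<in> sets M" "S \<in> sets M"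
    and eq: "measure M A = measure M S" and S: "lex_upper (space M) u w S"
  shows "(LINT x|M. indicator A x * u x) \<le> (LINT x|M. indicator S x * u x)"
proof -
  have [measurable]: "u \<in> borel_measurable M" using u by auto
  have A: "A \<subseteq> space M" using sets.sets_into_space[of A M] by simp
  have int: "integrable M (\<lambda>x. indicator B x * u x)" if "B \<in> sets M" for B
    using integrable_mult_indicator[OF that u] by simp
  have intc: "integrable M (\<lambda>x. indicator B x * (c::real))" if "B \<in> sets M" for B c
    by (intro integrable_mult_left integrable_real_indicator that) (simp add: less_top[symmetric])
  have dS: "measure M (S - A) = measure M S - measure M (S \<inter> A)"
    using finite_measure_Diff'[of S A] by simp
  have dA: "measure M (A - S) = measure M A - measure M (S \<inter> A)"
    using finite_measure_Diff'[of A S] by (simp add: Int_commute)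
  have deq: "measure M (S - A) = measure M (A - S)" using dS dA eq by simp
  have le: "u y \<le> u x" if "x \<in> S - A" "y \<in> A - S" for x y
    using that S A unfolding lex_upper_def by (meson DiffD1 DiffD2 not_less subset_iff)
  have key: "(LINT x|M. indicator (A - S) x * u x) \<le> (LINT x|M. indicator (S - A) x * u x)"
  \<comment> \<open>If one difference is empty there is no separating constant to take, but then
    both differences are null.\<close>
  proof (cases "S - A = {} \<or> A - S = {}")
    case True
    then have 0: "measure M (S - A) = 0" "measure M (A - S) = 0"
      using deq by (metis measure_empty)+
    have z: "(LINT x|M. indicator B x * u x) = 0" if [measurable]: "B \<in> sets M" and "measure M B = 0" for B
    proof -
      have "B \<in> null_sets M" using that by (auto simp: null_sets_def emeasure_eq_measure)
      then have "AE x in M. x \<notin> B" by (rule AE_not_in)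
      then have "AE x in M. indicator B x * u x = 0" by eventually_elim auto
      then show ?thesis by (subst integral_cong_AE[where g="\<lambda>_. 0"]) auto
    qed
    show ?thesis using 0 by (simp add: z)
  next
    case False
    then obtain x0 y0 where xy: "x0 \<in> S - A" "y0 \<in> A - S" by blast
    define c where "c = Sup (u ` (A - S))"
    have bdd: "bdd_above (u ` (A - S))" using le xy by (intro bdd_aboveI2[where M="u x0"]) blast
    have c1: "u y \<le> c" if "y \<in> A - S" for y unfolding c_def using bdd that by (intro cSup_upper) auto
    have c2: "c \<le> u x" if "x \<in> S - A" for x unfolding c_def using le that xy by (intro cSup_least) auto
    have "(LINT x|M. indicator (A - S) x * u x) \<le> (LINT x|M. indicator (A - S) x * c)"
      by (intro integral_mono int intc) (auto simp: indicator_def c1)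
    also have "\<dots> = measure M (A - S) * c" using A by (simp add: Int_absorb1 Diff_subset[THEN subset_trans])
    also have "\<dots> = measure M (S - A) * c" using deq by simp
    also have "\<dots> = (LINT x|M. indicator (S - A) x * c)"
      using sets.sets_into_space[of S M] by (simp add: Int_absorb1 Diff_subset[THEN subset_trans])
    also have "\<dots> \<le> (LINT x|M. indicator (S - A) x * u x)"
      by (intro integral_mono int intc) (auto simp: indicator_def c2)
    finally show ?thesis .
  qed
  have dec: "(LINT x|M. indicator B x * u x) = (LINT x|M. indicator (B - D) x * u x)
      + (LINT x|M. indicator (B \<inter> D) x * u x)"
    if [measurable]: "B \<in> sets M" "D \<in> sets M" for B D
  proof -
    have "indicator B x * u x = indicator (B - D) x * u x + indicator (B \<inter> D) x * u x" for x
      by (auto simp: indicator_def)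
    then show ?thesis
      using Bochner_Integration.integral_add[OF int[of "B - D"] int[of "B \<inter> D"]] by simp
  qed
  show ?thesis using dec[of A S] dec[of S A] key by (simp add: Int_commute)
qed

text \<open>Almost everywhere \<open>g x\<close> is the length of the set of levels \<open>t\<close>
  in \<open>{0..C}\<close> below it, so the identity is an exchange of integrals. Fubini applies
  since the inner integral of the absolute value is \<open>g x * \<bar>u x\<bar>\<close>, at most
  \<open>C * \<bar>u x\<bar>\<close>.\<close>

lemma (in finite_measure) layer_cake:
  fixes g u :: "'a \<Rightarrow> real"
  assumes g[measurable]: "g \<in> borel_measurable M" and u: "integrable M u"
    and bd: "AE x in M. 0 \<le> g x \<and> g x \<le> C"
  shows "integrable lborel (\<lambda>t. LINT x|M. indicator {0..C} t * indicator {x\<in>space M. t < g x} x * u x)"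
    and "(LINT x|M. g x * u x) =
      (LINT t|lborel. LINT x|M. indicator {0..C} t * indicator {x\<in>space M. t < g x} x * u x)"
proof -
  interpret P: pair_sigma_finite M lborel ..
  have [measurable]: "u \<in> borel_measurable M" using u by auto
  define f where "f x t = indicator {0..C} t * indicator {x\<in>space M. t < g x} x * u x" for x t
  have f_alt: "f x t = (if 0 \<le> t \<and> t \<le> C \<and> t < g x then u x else 0)" if "x \<in> space M" for x t
    using that by (auto simp: f_def indicator_def)
  have [measurable]: "case_prod f \<in> borel_measurable (M \<Otimes>\<^sub>M lborel)"
  proof -
    have "(\<lambda>(x, t). if 0 \<le> t \<and> t \<le> C \<and> t < g x then u x else 0) \<in> borel_measurable (M \<Otimes>\<^sub>M lborel)"
      by measurable
    then show ?thesis
      by (subst measurable_cong[where g="\<lambda>(x, t). if 0 \<le> t \<and> t \<le> C \<and> t < g x then u x else 0"])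
         (auto simp: space_pair_measure f_alt)
  qed
  have inner: "integrable lborel (f x) \<and> (LINT t|lborel. f x t) = g x * u x
      \<and> (LINT t|lborel. norm (f x t)) = g x * \<bar>u x\<bar>"
    if "x \<in> space M" "0 \<le> g x \<and> g x \<le> C" for x
  proof -
    have eq: "f x = (\<lambda>t. indicator {0..<g x} t * u x)"
      using that by (auto simp: fun_eq_iff f_alt indicator_def)
    have eqn: "(\<lambda>t. norm (f x t)) = (\<lambda>t. indicator {0..<g x} t * \<bar>u x\<bar>)"
      unfolding eq by (auto simp: fun_eq_iff indicator_def)
    show ?thesis unfolding eqn using that by (simp add: eq)
  qed
  have fint: "integrable (M \<Otimes>\<^sub>M lborel) (case_prod f)"
  proof (rule P.Fubini_integrable)
    have "AE x in M. g x * \<bar>u x\<bar> = (LINT t|lborel. norm (case (x, t) of (x, t) \<Rightarrow> f x t))"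
      using bd AE_space by eventually_elim (use inner in simp)
    moreover have "integrable M (\<lambda>x. g x * \<bar>u x\<bar>)"
      by (rule Bochner_Integration.integrable_bound[where f="\<lambda>x. C * u x"])
         (use u bd in \<open>auto simp: abs_mult intro!: mult_right_mono elim!: eventually_rev_mp\<close>)
    ultimately show "integrable M (\<lambda>x. LINT t|lborel. norm (case (x, t) of (x, t) \<Rightarrow> f x t))"
      by (subst integrable_cong_AE[where g="\<lambda>x. g x * \<bar>u x\<bar>"]) auto
    show "AE x in M. integrable lborel (\<lambda>t. case (x, t) of (x, t) \<Rightarrow> f x t)"
      using bd AE_space by eventually_elim (use inner in simp)
  qed measurable
  show "integrable lborel (\<lambda>t. LINT x|M. indicator {0..C} t * indicator {x\<in>space M. t < g x} x * u x)"
    using P.integrable_snd[OF fint] unfolding f_def by simp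
  have "AE x in M. g x * u x = (LINT t|lborel. f x t)"
    using bd AE_space by eventually_elim (use inner in simp)
  then have "(LINT x|M. g x * u x) = (LINT x|M. LINT t|lborel. f x t)"
    by (intro integral_cong_AE) auto
  also have "\<dots> = (LINT t|lborel. LINT x|M. f x t)"
    by (rule P.Fubini_integral[symmetric]) (rule fint)
  finally show "(LINT x|M. g x * u x) =
      (LINT t|lborel. LINT x|M. indicator {0..C} t * indicator {x\<in>space M. t < g x} x * u x)"
    unfolding f_def .
qed

text \<open>Every superlevel set of \<open>g'\<close> is optimal for its measure, so the bathtub
  inequality can be integrated over the levels.\<close>

lemma (in finite_measure) comonotone_integral_le:
  fixes g g' u :: "'a \<Rightarrow> real"
  assumes [measurable]: "g \<in> borel_measurable M" "g' \<in> borel_measurable M" and u: "integrable M u"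
    and bd: "AE x in M. 0 \<le> g x \<and> g x \<le> C" "AE x in M. 0 \<le> g' x \<and> g' x \<le> C"
    and eq: "\<And>t. t \<ge> 0 \<Longrightarrow> measure M {x\<in>space M. t < g x} = measure M {x\<in>space M. t < g' x}"
    and up: "\<And>t. t \<ge> 0 \<Longrightarrow> lex_upper (space M) u w {x\<in>space M. t < g' x}"
  shows "(LINT x|M. g x * u x) \<le> (LINT x|M. g' x * u x)"
  unfolding layer_cake(2)[OF assms(1) u bd(1)] layer_cake(2)[OF assms(2) u bd(2)]
proof (rule integral_mono[OF layer_cake(1)[OF assms(1) u bd(1)] layer_cake(1)[OF assms(2) u bd(2)]])
  fix t :: real
  show "(LINT x|M. indicator {0..C} t * indicator {x\<in>space M. t < g x} x * u x)
      \<le> (LINT x|M. indicator {0..C} t * indicator {x\<in>space M. t < g' x} x * u x)"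
  proof (cases "0 \<le> t \<and> t \<le> C")
    case True
    then show ?thesis
      using bathtub[OF u _ _ eq up, of t] by simp
  qed auto
qed

lemma Union_lex_upper:
  "(\<And>i. lex_upper X u w (S i)) \<Longrightarrow> lex_upper X u w (\<Union>i. S i)"
  unfolding lex_upper_def by blast

text \<open>The superlevel sets are prescribed first, each an upper set with the measure of the
  corresponding superlevel set of \<open>g0\<close>. Upper sets form a chain, so the prescribed sets
  are nested and define \<open>g\<close>, whose own superlevel sets are countable unions of
  them.\<close>

lemma (in finite_measure) comonotone_rearrangement_exists:
  fixes g0 u w :: "'a \<Rightarrow> real"
  assumes [measurable]: "g0 \<in> borel_measurable M" "u \<in> borel_measurable M" "w \<in> borel_measurable M"
    and null: "\<And>\<tau>. measure M {x\<in>space M. w x = \<tau>} = 0"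
    and bd: "AE x in M. g0 x \<le> C" "0 \<le> C"
  shows "\<exists>g\<in>borel_measurable M. (\<forall>x. 0 \<le> g x \<and> g x \<le> C) \<and>
    (\<forall>t\<ge>0. measure M {x\<in>space M. t < g x} = measure M {x\<in>space M. t < g0 x} \<and>
           lex_upper (space M) u w {x\<in>space M. t < g x})"
proof -
  define \<mu> where "\<mu> t = measure M {x\<in>space M. t < g0 x}" for t
  have \<mu>_anti: "\<mu> t' \<le> \<mu> t" if "t \<le> t'" for t t'
    unfolding \<mu>_def using that by (intro finite_measure_mono) auto
  have \<mu>0: "\<mu> t = 0" if "C \<le> t" for t
  proof -
    have "AE x in M. x \<notin> {x\<in>space M. t < g0 x}" using bd(1) by eventually_elim (use that in auto)
    then have "{x\<in>space M. t < g0 x} \<in> null_sets M" by (subst AE_iff_null_sets) auto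
    then show ?thesis unfolding \<mu>_def by (simp add: measure_eq_0_null_sets)
  qed
  have "\<forall>m. \<exists>S. 0 \<le> m \<and> m \<le> measure M (space M) \<longrightarrow>
      S \<in> sets M \<and> lex_upper (space M) u w S \<and> measure M S = m"
    using lex_upper_of_measure[OF assms(2,3) null] by blast
  then obtain S where S: "\<And>m. 0 \<le> m \<Longrightarrow> m \<le> measure M (space M) \<Longrightarrow>
      S m \<in> sets M \<and> lex_upper (space M) u w (S m) \<and> measure M (S m) = m"
    by metis
  \<comment> \<open>The chosen set depends on \<open>t\<close> only through its measure. Equal
    measures give equal sets, so nesting holds everywhere and not just up to null sets.\<close>
  define T where "T t = S (\<mu> t)" for t
  have \<mu>_bd: "0 \<le> \<mu> t" "\<mu> t \<le> measure M (space M)" for t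
    unfolding \<mu>_def by (auto intro: bounded_measure)
  have T: "T t \<in> sets M" "lex_upper (space M) u w (T t)" "measure M (T t) = \<mu> t" for t
    unfolding T_def using S[OF \<mu>_bd] by auto
  note [measurable] = T(1)
  have T_anti: "T t' \<subseteq> T t" if "t \<le> t'" for t t'
  proof (cases "\<mu> t = \<mu> t'")
    case True then show ?thesis by (simp add: T_def)
  next
    case False
    then have "measure M (T t') < measure M (T t)" using \<mu>_anti[OF that] T(3) by simp
    then have "\<not> T t \<subseteq> T t'" using finite_measure_mono[OF _ T(1)] by (meson not_less)
    then show ?thesis using lex_upper_comparable[OF T(2) T(2)] by blast
  qed
  define g where "g x = Sup (insert 0 {t\<in>{0..C}. x \<in> T t})" for x
  have bddg: "bdd_above (insert 0 {t\<in>{0..C}. x \<in> T t})" for x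
    by (rule bdd_aboveI[of _ C]) (use bd in auto)
  have g0: "0 \<le> g x" for x unfolding g_def by (rule cSup_upper[OF _ bddg]) auto
  have gC: "g x \<le> C" for x unfolding g_def by (rule cSup_least) (use bd in auto)
  define \<tau> where "\<tau> t n = t + (C - t) * inverse (real (Suc n))" for t n
  have level: "{x\<in>space M. t < g x} = (\<Union>n. T (\<tau> t n))" if "0 \<le> t" "t < C" for t
  proof safe
    fix x assume "x \<in> space M" "t < g x"
    then obtain t' where t': "t' \<in> insert 0 {t\<in>{0..C}. x \<in> T t}" "t < t'"
      unfolding g_def by (subst (asm) less_cSup_iff[OF _ bddg]) auto
    then have "x \<in> T t'" "0 < (t' - t) / (C - t)" using that by auto
    then obtain n where "inverse (real (Suc n)) < (t' - t) / (C - t)"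
      using reals_Archimedean by blast
    then have "\<tau> t n \<le> t'" using that unfolding \<tau>_def by (simp add: field_simps)
    then show "x \<in> (\<Union>n. T (\<tau> t n))" using T_anti \<open>x \<in> T t'\<close> by blast
  next
    fix x n assume x: "x \<in> T (\<tau> t n)"
    then show "x \<in> space M" using T(1) sets.sets_into_space by blast
    have "inverse (real (Suc n)) \<le> 1" by (simp add: field_simps)
    then have "(C - t) * inverse (real (Suc n)) \<le> (C - t) * 1" using that by (intro mult_left_mono) auto
    moreover have "0 < (C - t) * inverse (real (Suc n))" using that by simp
    ultimately have "t < \<tau> t n" "\<tau> t n \<le> C" unfolding \<tau>_def by auto
    moreover have "\<tau> t n \<le> g x" unfolding g_def
      by (rule cSup_upper[OF _ bddg]) (use x calculation that in auto)
    ultimately show "t < g x" by simp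
  qed
  have big: "{x\<in>space M. t < g x} = {}" if "C \<le> t" for t using gC that by (auto simp: not_less intro: order_trans)
  have \<tau>_anti: "\<tau> t n \<le> \<tau> t k" if "k \<le> n" "t < C" for t n k
    unfolding \<tau>_def using that by (intro add_left_mono mult_left_mono le_imp_inverse_le) auto
  have meas: "measure M {x\<in>space M. t < g x} = \<mu> t" if t: "0 \<le> t" "t < C" for t
  proof -
    have "(\<lambda>n. measure M (T (\<tau> t n))) \<longlonglongrightarrow> measure M (\<Union>n. T (\<tau> t n))"
      by (rule finite_Lim_measure_incseq) (use T_anti \<tau>_anti t in \<open>auto simp: incseq_def\<close>)
    then have 1: "(\<lambda>n. \<mu> (\<tau> t n)) \<longlonglongrightarrow> measure M {x\<in>space M. t < g x}"
      using level[OF t] T(3) by simp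
    have "(\<lambda>n. measure M {x\<in>space M. \<tau> t n < g0 x}) \<longlonglongrightarrow> measure M (\<Union>n. {x\<in>space M. \<tau> t n < g0 x})"
    proof (rule finite_Lim_measure_incseq)
      show "incseq (\<lambda>n. {x \<in> space M. \<tau> t n < g0 x})"
        unfolding incseq_def using \<tau>_anti[OF _ t(2)] by (auto intro: le_less_trans)
    qed auto
    moreover have "(\<Union>n. {x\<in>space M. \<tau> t n < g0 x}) = {x\<in>space M. t < g0 x}"
    proof safe
      fix x n assume "\<tau> t n < g0 x"
      moreover have "0 < (C - t) * inverse (real (Suc n))" using t by simp
      ultimately show "t < g0 x" unfolding \<tau>_def by linarith
    next
      fix x assume "x \<in> space M" "t < g0 x"
      then obtain n where "inverse (real (Suc n)) < (g0 x - t) / (C - t)"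
        using reals_Archimedean[of "(g0 x - t) / (C - t)"] t by auto
      then have "\<tau> t n < g0 x" using t unfolding \<tau>_def by (simp add: field_simps)
      then show "x \<in> (\<Union>n. {x\<in>space M. \<tau> t n < g0 x})" using \<open>x \<in> space M\<close> by blast
    qed
    ultimately have "(\<lambda>n. \<mu> (\<tau> t n)) \<longlonglongrightarrow> \<mu> t" unfolding \<mu>_def by simp
    then show ?thesis using LIMSEQ_unique[OF 1] by simp
  qed
  have gm: "g \<in> borel_measurable M"
  proof (subst borel_measurable_iff_greater, rule)
    fix t
    consider "t < 0" | "0 \<le> t" "t < C" | "C \<le> t" by linarith
    then show "{x\<in>space M. t < g x} \<in> sets M"
    proof cases
      case 1
      then have "{x\<in>space M. t < g x} = space M" using g0 by (auto intro: less_le_trans)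
      then show ?thesis by simp
    qed (auto simp: level big)
  qed
  show ?thesis
  proof (intro bexI[OF _ gm] conjI allI impI g0 gC)
    fix t :: real assume t: "0 \<le> t"
    show "measure M {x\<in>space M. t < g x} = measure M {x\<in>space M. t < g0 x}"
    proof (cases "t < C")
      case True
      then show ?thesis using meas[OF t] by (simp add: \<mu>_def)
    next
      case False
      then have "{x\<in>space M. t < g x} = {}" "\<mu> t = 0" by (simp_all only: big \<mu>0 not_less)
      then show ?thesis unfolding \<mu>_def by (simp only: measure_empty)
    qed
    show "lex_upper (space M) u w {x\<in>space M. t < g x}"
    proof (cases "t < C")
      case True
      then show ?thesis unfolding level[OF t True] by (intro Union_lex_upper T)
    next
      case False
      then show ?thesis by (simp add: big lex_upper_def)
    qed
  qed
qed

subsection \<open>Gagliardo seminorm and compactness\<close>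

text \<open>Lebesgue measure on a product is the completion of the product of the Borel measures,
  not the product of the completions. A null set is therefore first enlarged to a Borel null set
  \<open>N\<close>, whose cylinders are null by the product formula.\<close>

lemma
  fixes P :: "'a::euclidean_space \<Rightarrow> bool"
  assumes "AE x in lebesgue. P x"
  shows AE_lebesgue_fst: "AE z in (lebesgue :: ('a \<times> 'b::euclidean_space) measure). P (fst z)"
    and AE_lebesgue_snd: "AE z in (lebesgue :: ('b \<times> 'a) measure). P (snd z)"
proof -
  obtain N where N: "N \<in> null_sets lborel" "{x. \<not> P x} \<subseteq> N"
    using assms unfolding AE_completion_iff by (auto elim!: AE_E simp: null_sets_def)
  have "N \<times> (UNIV::'b set) \<in> null_sets (lborel \<Otimes>\<^sub>M lborel)" "(UNIV::'b set) \<times> N \<in> null_sets (lborel \<Otimes>\<^sub>M lborel)"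
    using N(1) by (auto simp: null_sets_def lborel.emeasure_pair_measure_Times)
  then have "AE z in (lborel :: ('a \<times> 'b) measure). z \<notin> N \<times> UNIV" "AE z in (lborel :: ('b \<times> 'a) measure). z \<notin> UNIV \<times> N"
    by (simp_all add: lborel_prod AE_not_in)
  then show "AE z in (lebesgue :: ('a \<times> 'b) measure). P (fst z)" "AE z in (lebesgue :: ('b \<times> 'a) measure). P (snd z)"
    unfolding AE_completion_iff using N(2) by (auto elim!: eventually_mono)
qed

lemma lebesgue_measurable_ex_borel:
  fixes u :: "'a::euclidean_space \<Rightarrow> real"
  assumes "u \<in> borel_measurable lebesgue"
  obtains v where "v \<in> borel_measurable borel" "AE x in lebesgue. u x = v x"
  using completion_ex_borel_measurable_real[OF assms] by (auto simp: AE_completion_iff)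

lemma lebesgue_measurable_cong_AE:
  fixes u v :: "'a::euclidean_space \<Rightarrow> real"
  assumes "v \<in> borel_measurable lebesgue" "AE x in lebesgue. u x = v x"
  shows "u \<in> borel_measurable lebesgue"
  using assms(2) by (intro borel_measurable_AE[OF assms(1)]) (auto elim!: eventually_mono)

lemma
  fixes u :: "'a::euclidean_space \<Rightarrow> real"
  assumes "u \<in> borel_measurable lebesgue"
  shows borel_measurable_lebesgue_fst: "(\<lambda>z::'a \<times> 'b::euclidean_space. u (fst z)) \<in> borel_measurable lebesgue"
    and borel_measurable_lebesgue_snd: "(\<lambda>z::'b \<times> 'a. u (snd z)) \<in> borel_measurable lebesgue"
proof -
  obtain v where v: "v \<in> borel_measurable borel" "AE x in lebesgue. u x = v x"
    using lebesgue_measurable_ex_borel[OF assms] .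
  have "(\<lambda>z::'a \<times> 'b. v (fst z)) \<in> borel_measurable lborel" "(\<lambda>z::'b \<times> 'a. v (snd z)) \<in> borel_measurable lborel"
    using v(1) by (simp_all add: lborel_prod[symmetric])
  note vm = this[THEN measurable_completion]
  show "(\<lambda>z::'a \<times> 'b. u (fst z)) \<in> borel_measurable lebesgue" "(\<lambda>z::'b \<times> 'a. u (snd z)) \<in> borel_measurable lebesgue"
    by (rule lebesgue_measurable_cong_AE[OF vm(1) AE_lebesgue_fst[OF v(2)]],
        rule lebesgue_measurable_cong_AE[OF vm(2) AE_lebesgue_snd[OF v(2)]])
qed

lemma nn_integral_lebesgue_pair:
  fixes f :: "'a::euclidean_space \<times> 'b::euclidean_space \<Rightarrow> ennreal"
  assumes "f \<in> borel_measurable borel"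
  shows "(\<integral>\<^sup>+z. f z \<partial>lebesgue) = (\<integral>\<^sup>+x. \<integral>\<^sup>+y. f (x, y) \<partial>lborel \<partial>lborel)"
proof -
  have "f \<in> borel_measurable (lborel \<Otimes>\<^sub>M lborel)" using assms by (simp add: lborel_prod)
  from lborel.nn_integral_fst[OF this] show ?thesis
    by (simp add: nn_integral_completion lborel_prod)
qed

lemma young_powr:
  fixes t e p :: real
  assumes "0 \<le> t" "0 < e" "1 < p"
  shows "t \<le> e + e powr (1 - p) * t powr p"
proof (cases "t \<le> e")
  case False
  then have t: "0 < t" using assms by linarith
  have "t = t powr (1 - p) * t powr p" using t by (simp add: powr_add[symmetric])
  also have "\<dots> \<le> e powr (1 - p) * t powr p"
    using False assms t by (intro mult_right_mono) (auto intro!: powr_mono2')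
  finally show ?thesis using assms by linarith
qed (use assms in \<open>auto intro: add_increasing2\<close>)

text \<open>The exponent \<gamma> is kept free because compactness only needs it to exceed the
  dimension. On the diagonal the quotient is 0 / 0, which is 0 here.\<close>

definition gagliardo :: "real \<Rightarrow> real \<Rightarrow> ('a::euclidean_space \<Rightarrow> real) \<Rightarrow> ennreal" where
  "gagliardo \<gamma> p u = (\<integral>\<^sup>+(x, y). ennreal (\<bar>u x - u y\<bar> powr p / norm (x - y) powr \<gamma>) \<partial>lebesgue)"

lemma gagliardo_cong_AE:
  assumes "AE x in lebesgue. u x = v x"
  shows "gagliardo \<gamma> p u = gagliardo \<gamma> p v"
  unfolding gagliardo_def
proof (intro nn_integral_cong_AE)
  show "AE z in lebesgue. (case z of (x, y) \<Rightarrow> ennreal (\<bar>u x - u y\<bar> powr p / norm (x - y) powr \<gamma>))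
      = (case z of (x, y) \<Rightarrow> ennreal (\<bar>v x - v y\<bar> powr p / norm (x - y) powr \<gamma>))"
    using AE_lebesgue_fst[OF assms] AE_lebesgue_snd[OF assms] by eventually_elim auto
qed

lemma gagliardo_borel:
  assumes [measurable]: "u \<in> borel_measurable borel"
  shows "gagliardo \<gamma> p u =
    (\<integral>\<^sup>+x. \<integral>\<^sup>+y. ennreal (\<bar>u x - u y\<bar> powr p / norm (x - y) powr \<gamma>) \<partial>lborel \<partial>lborel)"
proof -
  have "(\<lambda>(x, y). ennreal (\<bar>u x - u y\<bar> powr p / norm (x - y) powr \<gamma>)) \<in> borel_measurable (borel \<Otimes>\<^sub>M borel)"
    by measurable
  then show ?thesis
    unfolding gagliardo_def by (subst nn_integral_lebesgue_pair) (auto simp: borel_prod)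
qed

text \<open>Points at distance at most \<open>D\<close> see a kernel of at least
  \<open>D powr - \<gamma>\<close>. On the diagonal the quotient is \<open>a / 0 = 0\<close>, whence
  the condition on \<open>a\<close> there.\<close>

lemma powr_diff_le_kernel:
  fixes x y :: "'a::euclidean_space"
  assumes "0 \<le> \<gamma>" "norm (x - y) \<le> D" "x = y \<Longrightarrow> a = 0" "0 \<le> a"
  shows "a \<le> D powr \<gamma> * (a / norm (x - y) powr \<gamma>)"
proof (cases "x = y")
  case False
  then have "norm (x - y) powr \<gamma> > 0" by simp
  moreover have "norm (x - y) powr \<gamma> \<le> D powr \<gamma>" using assms by (intro powr_mono2) auto
  ultimately show ?thesis using assms by (simp add: field_simps mult_left_mono)
qed (use assms in auto)

text \<open>For \<open>x\<close> with \<open>u x \<noteq> 0\<close> and \<open>y\<close> in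
  \<open>B\<close> the difference \<open>u x - u y\<close> is just \<open>u x\<close>, so the part
  of the double integral with \<open>y\<close> in \<open>B\<close> already controls the p-th power
  of \<open>u\<close>.\<close>

lemma poincare_gagliardo:
  fixes u :: "'a::euclidean_space \<Rightarrow> real"
  assumes [measurable]: "u \<in> borel_measurable borel" "B \<in> sets borel"
    and D: "\<And>x y. u x \<noteq> 0 \<Longrightarrow> y \<in> B \<Longrightarrow> u y = 0 \<and> norm (x - y) \<le> D" and "0 \<le> \<gamma>"
  shows "(\<integral>\<^sup>+x. ennreal (\<bar>u x\<bar> powr p) \<partial>lborel) * emeasure lborel B \<le> ennreal (D powr \<gamma>) * gagliardo \<gamma> p u"
proof -
  have "(\<integral>\<^sup>+x. ennreal (\<bar>u x\<bar> powr p) \<partial>lborel) * emeasure lborel B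
      = (\<integral>\<^sup>+x. \<integral>\<^sup>+y. ennreal (\<bar>u x\<bar> powr p) * indicator B y \<partial>lborel \<partial>lborel)"
    by (simp add: nn_integral_cmult nn_integral_multc)
  also have "\<dots> \<le> (\<integral>\<^sup>+x. \<integral>\<^sup>+y. ennreal (D powr \<gamma>) * ennreal (\<bar>u x - u y\<bar> powr p / norm (x
      - y) powr \<gamma>) \<partial>lborel \<partial>lborel)"
  proof (intro nn_integral_mono)
    fix x y
    have "\<bar>u x\<bar> powr p * indicator B y \<le> D powr \<gamma> * (\<bar>u x - u y\<bar> powr p / norm (x - y) powr \<gamma>)"
    proof (cases "u x \<noteq> 0 \<and> y \<in> B")
      case True
      then show ?thesis using D[of x y] powr_diff_le_kernel[OF \<open>0 \<le> \<gamma>\<close>, of x y D "\<bar>u x\<bar> powr p"] by auto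
    qed (auto simp: indicator_def)
    then show "ennreal (\<bar>u x\<bar> powr p) * indicator B y \<le> ennreal (D powr \<gamma>) * ennreal (\<bar>u x
        - u y\<bar> powr p / norm (x - y) powr \<gamma>)"
      by (simp add: ennreal_mult[symmetric] ennreal_indicator[symmetric] del: ennreal_indicator) 
  qed
  also have "\<dots> = ennreal (D powr \<gamma>) * gagliardo \<gamma> p u"
    by (simp add: nn_integral_cmult gagliardo_borel)
  finally show ?thesis .
qed

lemma indicator_ball_measurable:
  fixes c :: "'a::euclidean_space \<Rightarrow> 'a"
  assumes [measurable]: "c \<in> borel_measurable borel"
  shows "(\<lambda>(x, y). indicator (ball (c x) r) y :: 'b::{zero_neq_one, topological_space})
    \<in> borel_measurable (borel \<Otimes>\<^sub>M borel)"
proof -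
  have "(\<lambda>(x, y). if dist (c x) y < r then 1 else 0 :: 'b) \<in> borel_measurable (borel \<Otimes>\<^sub>M borel)"
    by measurable
  then show ?thesis by (simp add: indicator_def of_bool_def)
qed

text \<open>The truncation \<open>t \<le> e + e powr (1 - p) * t powr p\<close> replaces Hoelder's inequality.\<close>

lemma average_gagliardo:
  fixes u :: "'a::euclidean_space \<Rightarrow> real" and c :: "'a \<Rightarrow> 'a"
  assumes [measurable]: "c \<in> borel_measurable borel" "S \<in> sets borel" and u: "integrable lborel u"
    and r: "0 < r" "\<And>x. x \<in> S \<Longrightarrow> dist x (c x) \<le> r"
    and "0 \<le> \<gamma>" "0 < e" "1 < p"
    and b: "b = measure lborel (ball (0::'a) r)"
  shows "ennreal b * (\<integral>\<^sup>+x\<in>S. ennreal \<bar>u x - (LINT y|lborel. indicator (ball (c x) r) y * u y) / b\<bar> \<partial>lborel)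
    \<le> ennreal (e * b) * emeasure lborel S + ennreal (e powr (1 - p) * (2 * r) powr \<gamma>) * gagliardo \<gamma> p u"
proof -
  have [measurable]: "u \<in> borel_measurable borel" using u by auto
  have bpos: "0 < b" unfolding b using content_ball_gt_0_iff[of 0 r] r by simp
  have ball: "emeasure lborel (ball z r) = ennreal b" "measure lborel (ball z r) = b" for z :: 'a
    using r(1) unfolding b by (simp_all add: emeasure_ball content_ball)
  define G where "G x y = \<bar>u x - u y\<bar> powr p / norm (x - y) powr \<gamma>" for x y
  have G0: "0 \<le> G x y" for x y by (simp add: G_def)
  have [measurable]: "(\<lambda>(x, y). G x y) \<in> borel_measurable (borel \<Otimes>\<^sub>M borel)" unfolding G_def by measurable
  have [measurable]: "(\<lambda>(x, y). indicator (ball (c x) r) y :: ennreal) \<in> borel_measurable (borel \<Otimes>\<^sub>M borel)"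
    by (rule indicator_ball_measurable) fact
  have [measurable]: "(\<lambda>(x, y). indicator (ball (c x) r) y :: real) \<in> borel_measurable (borel \<Otimes>\<^sub>M borel)"
    by (rule indicator_ball_measurable) fact
  have [measurable]: "(\<lambda>x. LINT y|lborel. indicator (ball (c x) r) y * u y) \<in> borel_measurable borel"
    by measurable
  define T where "T x = (LINT y|lborel. indicator (ball (c x) r) y * u y)" for x
  have [measurable]: "T \<in> borel_measurable borel" unfolding T_def by fact
  have m: "(\<lambda>x. ennreal \<bar>u x - (LINT y|lborel. indicator (ball (c x) r) y * u y) / b\<bar> * indicator S x)
      \<in> borel_measurable borel"
    unfolding T_def[symmetric] by measurable
  have "ennreal b * (\<integral>\<^sup>+x\<in>S. ennreal \<bar>u x - (LINT y|lborel. indicator (ball (c x) r) y * u y) / b\<bar> \<partial>lborel)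
     \<le> (\<integral>\<^sup>+x. ennreal b * (ennreal \<bar>u x - (LINT y|lborel. indicator (ball (c x) r) y * u y) / b\<bar>
         * indicator S x) \<partial>lborel)"
    using m by (simp add: nn_integral_cmult)
  also have "\<dots> \<le> (\<integral>\<^sup>+x. \<integral>\<^sup>+y. ennreal e * (indicator S x * indicator (ball (c x) r) y)
        + ennreal (e powr (1 - p) * (2 * r) powr \<gamma>) * ennreal (G x y) \<partial>lborel \<partial>lborel)"
  proof (intro nn_integral_mono)
    fix x :: 'a
    have intu: "integrable lborel (\<lambda>y. indicator (ball (c x) r) y * u y)"
      using integrable_mult_indicator[OF _ u, of "ball (c x) r"] by simp
    have intx: "integrable lborel (\<lambda>y. indicator (ball (c x) r) y * u x)"
      by (intro integrable_mult_left integrable_real_indicator) (auto simp: ball)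
    have intb: "integrable lborel (\<lambda>y. indicator (ball (c x) r) y * (u x - u y))"
      unfolding right_diff_distrib using intx intu by (rule Bochner_Integration.integrable_diff)
    have "ennreal b * ennreal \<bar>u x - (LINT y|lborel. indicator (ball (c x) r) y * u y) / b\<bar>
        = ennreal \<bar>b * u x - (LINT y|lborel. indicator (ball (c x) r) y * u y)\<bar>"
    proof -
      have "b * \<bar>a - i / b\<bar> = \<bar>b * a - i\<bar>" for a i
      proof -
        have "b * \<bar>a - i / b\<bar> = \<bar>b * (a - i / b)\<bar>" using bpos by (simp add: abs_mult)
        then show ?thesis using bpos by (simp add: right_diff_distrib)
      qed
      then show ?thesis using bpos by (simp add: ennreal_mult[symmetric])
    qed
    also have "b * u x - (LINT y|lborel. indicator (ball (c x) r) y * u y)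
       = (LINT y|lborel. indicator (ball (c x) r) y * (u x - u y))"
      using intu intx by (simp add: right_diff_distrib ball)
    also have "ennreal \<bar>LINT y|lborel. indicator (ball (c x) r) y * (u x - u y)\<bar>
        \<le> (\<integral>\<^sup>+y. ennreal (norm (indicator (ball (c x) r) y * (u x - u y))) \<partial>lborel)"
      using integral_norm_bound_ennreal[OF intb] by simp
    finally have 1: "ennreal b * ennreal \<bar>u x - (LINT y|lborel. indicator (ball (c x) r) y * u y) / b\<bar>
        \<le> (\<integral>\<^sup>+y. ennreal (norm (indicator (ball (c x) r) y * (u x - u y))) \<partial>lborel)" .
    show "ennreal b * (ennreal \<bar>u x - (LINT y|lborel. indicator (ball (c x) r) y * u y) / b\<bar> * indicator S x)
      \<le> (\<integral>\<^sup>+y. ennreal e * (indicator S x * indicator (ball (c x) r) y)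
        + ennreal (e powr (1 - p) * (2 * r) powr \<gamma>) * ennreal (G x y) \<partial>lborel)"
    proof (cases "x \<in> S")
      case True
      have *: "norm (indicator (ball (c x) r) y * (u x - u y)) \<le>
          e * indicator (ball (c x) r) y + e powr (1 - p) * (2 * r) powr \<gamma> * G x y" for y
      proof (cases "y \<in> ball (c x) r")
        case y: True
        \<comment> \<open>Both \<open>x\<close> and \<open>y\<close> are within \<open>r\<close> of
          \<open>c x\<close>; this is the origin of the factor 2 in \<open>2 * r\<close>.\<close>
        have "norm (x - y) \<le> dist x (c x) + dist (c x) y" by (metis dist_norm dist_triangle)
        then have "norm (x - y) \<le> 2 * r" using y r(2)[OF True] by auto
        then have "\<bar>u x - u y\<bar> powr p \<le> (2 * r) powr \<gamma> * G x y"
          unfolding G_def using \<open>0 \<le> \<gamma>\<close> by (intro powr_diff_le_kernel) auto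
        then have "e powr (1 - p) * \<bar>u x - u y\<bar> powr p \<le> e powr (1 - p) * ((2 * r) powr \<gamma> * G x y)"
          by (intro mult_left_mono) auto
        moreover have "\<bar>u x - u y\<bar> \<le> e + e powr (1 - p) * \<bar>u x - u y\<bar> powr p"
          using young_powr[of "\<bar>u x - u y\<bar>" e p] assms by simp
        ultimately have "\<bar>u x - u y\<bar> \<le> e + e powr (1 - p) * ((2 * r) powr \<gamma> * G x y)" by linarith
        then show ?thesis using y by (simp add: mult.assoc)
      qed (use G0 in auto)
      then have 2: "ennreal (norm (indicator (ball (c x) r) y * (u x - u y))) \<le>
          ennreal e * (indicator S x * indicator (ball (c x) r) y)
          + ennreal (e powr (1 - p) * (2 * r) powr \<gamma>) * ennreal (G x y)" for y
      proof -
        have "ennreal (e * indicator (ball (c x) r) y + e powr (1 - p) * (2 * r) powr \<gamma> * G x y)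
          = ennreal e * (indicator S x * indicator (ball (c x) r) y)
            + ennreal (e powr (1 - p) * (2 * r) powr \<gamma>) * ennreal (G x y)"
          using True \<open>0 < e\<close> G0[of x y] by (auto simp: indicator_def ennreal_mult[symmetric])
        moreover note ennreal_leI[OF *[of y]]
        ultimately show ?thesis by simp
      qed
      show ?thesis using order_trans[OF 1 nn_integral_mono[of lborel, OF 2]] True by simp
    qed auto
  qed
  also have "\<dots> = ennreal (e * b) * emeasure lborel S + ennreal (e powr (1 - p) * (2 * r) powr \<gamma>) * gagliardo \<gamma> p u"
    using \<open>0 < e\<close> bpos unfolding G_def
    by (simp add: nn_integral_add nn_integral_cmult nn_integral_multc gagliardo_borel ball ennreal_mult ac_simps)
  finally show ?thesis .
qed

lemma finite_grid_image:
  fixes S :: "'a::euclidean_space set"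
  assumes "bounded S" "0 < d"
  shows "finite ((\<lambda>x. \<Sum>b\<in>Basis. (d * of_int \<lfloor>(x \<bullet> b) / d\<rfloor>) *\<^sub>R b) ` S)"
proof -
  obtain R where R: "\<And>x. x \<in> S \<Longrightarrow> norm x \<le> R" using assms(1) unfolding bounded_iff by blast
  have "(\<lambda>x. \<lambda>b\<in>Basis. \<lfloor>(x \<bullet> b) / d\<rfloor>) ` S \<subseteq> (\<Pi>\<^sub>E b\<in>Basis. {\<lfloor>- R / d\<rfloor>..\<lfloor>R / d\<rfloor>})"
  proof (clarsimp simp: PiE_iff)
    fix x b :: 'a assume "x \<in> S" "b \<in> Basis"
    then have "\<bar>x \<bullet> b\<bar> \<le> R" using R Basis_le_norm order_trans by blast
    then show "\<lfloor>- (R / d)\<rfloor> \<le> \<lfloor>x \<bullet> b / d\<rfloor> \<and> \<lfloor>x \<bullet> b / d\<rfloor> \<le> \<lfloor>R / d\<rfloor>"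
      using assms(2) by (intro conjI floor_mono) (auto simp: field_simps)
  qed
  then have "finite ((\<lambda>x. \<lambda>b\<in>Basis. \<lfloor>(x \<bullet> b) / d\<rfloor>) ` S)"
    by (rule finite_subset) (auto intro!: finite_PiE)
  then have "finite ((\<lambda>k. \<Sum>b\<in>Basis. (d * of_int (k b)) *\<^sub>R b) ` (\<lambda>x. \<lambda>b\<in>Basis. \<lfloor>(x \<bullet> b) / d\<rfloor>) ` S)"
    by (rule finite_imageI)
  then show ?thesis by (simp add: image_image)
qed

lemma grid_exists:
  fixes S :: "'a::euclidean_space set"
  assumes "bounded S" "0 < r"
  shows "\<exists>c\<in>borel_measurable borel. finite (c ` S) \<and> (\<forall>x. dist x (c x :: 'a) \<le> r)"
proof -
  \<comment> \<open>Rounding down to multiples of \<open>d\<close> costs at most \<open>d\<close>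
    per coordinate, hence at most \<open>r\<close> in the l1 norm, which dominates the Euclidean
    norm.\<close>
  define d where "d = r / DIM('a)"
  have d: "0 < d" unfolding d_def using assms by simp
  define c :: "'a \<Rightarrow> 'a" where "c x = (\<Sum>b\<in>Basis. (d * of_int \<lfloor>(x \<bullet> b) / d\<rfloor>) *\<^sub>R b)" for x
  have "c \<in> borel_measurable borel" unfolding c_def by measurable
  moreover have "finite (c ` S)" using finite_grid_image[OF assms(1) d] unfolding c_def by simp
  moreover have "dist x (c x) \<le> r" for x
  proof -
    have "norm (x - c x) \<le> (\<Sum>b\<in>Basis. \<bar>(x - c x) \<bullet> b\<bar>)" by (rule norm_le_l1)
    also have "\<dots> \<le> (\<Sum>b\<in>(Basis::'a set). d)"
    proof (rule sum_mono)
      fix b :: 'a assume b: "b \<in> Basis"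
      have "of_int \<lfloor>(x \<bullet> b) / d\<rfloor> \<le> (x \<bullet> b) / d" "(x \<bullet> b) / d \<le> of_int \<lfloor>(x \<bullet> b) / d\<rfloor> + 1"
        by linarith+
      then have "d * of_int \<lfloor>(x \<bullet> b) / d\<rfloor> \<le> d * ((x \<bullet> b) / d)" "d * ((x \<bullet> b) / d) \<le> d * (of_int \<lfloor>(x \<bullet> b) / d\<rfloor> + 1)"
        using d by (intro mult_left_mono; simp)+
      then have "d * of_int \<lfloor>(x \<bullet> b) / d\<rfloor> \<le> x \<bullet> b" "x \<bullet> b \<le> d * of_int \<lfloor>(x \<bullet> b) / d\<rfloor> + d"
        using d by (auto simp: distrib_left)
      then show "\<bar>(x - c x) \<bullet> b\<bar> \<le> d"
        using b unfolding c_def by (simp add: inner_diff_left inner_sum_left inner_Basis if_distrib cong: if_cong)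
    qed
    also have "\<dots> = r" unfolding d_def by simp
    finally show ?thesis by (simp add: dist_norm)
  qed
  ultimately show ?thesis by blast
qed

text \<open>The kernel bound scales like \<open>r powr \<gamma>\<close> and the ball volume like
  \<open>r\<close> to the dimension, so the quotient is a constant times a positive power of
  \<open>r\<close>.\<close>

lemma gagliardo_scale_small:
  fixes A e \<gamma> p :: real
  assumes "real DIM('a::euclidean_space) < \<gamma>" "0 < e"
  shows "\<exists>r>0. C * (2 * r) powr \<gamma> / measure lborel (ball (0::'a) r) < e"
proof -
  define D where "D = real DIM('a)"
  define B where "B = unit_ball_vol D"
  have B: "0 < B" unfolding B_def D_def by simp
  have "((\<lambda>r. C * 2 powr \<gamma> / B * r powr (\<gamma> - D)) \<longlongrightarrow> C * 2 powr \<gamma> / B * 0) (at_right 0)"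
    using assms(1) unfolding D_def by (intro tendsto_intros tendsto_zero_powrI) (auto intro!: tendsto_ident_at eventually_mono[OF eventually_at_right_less])
  then have "eventually (\<lambda>r. C * 2 powr \<gamma> / B * r powr (\<gamma> - D) < e) (at_right 0)"
    using assms(2) by (intro order_tendstoD(2)) auto
  moreover have "eventually (\<lambda>r::real. 0 < r) (at_right 0)" by (rule eventually_at_right_less)
  ultimately obtain r :: real where r: "0 < r" "C * 2 powr \<gamma> / B * r powr (\<gamma> - D) < e"
    using eventually_happens'[of "at_right (0::real)"]
        by (metis (mono_tags, lifting) eventually_conj trivial_limit_at_right_real)
  have "measure lborel (ball (0::'a) r) = B * r powr D"
    using r(1) unfolding B_def D_def by (simp add: content_ball powr_realpow)
  then have "C * (2 * r) powr \<gamma> / measure lborel (ball (0::'a) r) = C * 2 powr \<gamma> / B * r powr (\<gamma> - D)"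
    using r(1) B by (simp add: powr_mult powr_diff field_simps)
  then show ?thesis using r by auto
qed


text \<open>At scale \<open>r k\<close> each \<open>v n\<close> is L1-close, uniformly in
  \<open>n\<close>, to a function built from its averages over balls centred at finitely many grid
  points. All scales together give countably many bounded sequences of averages; a subsequence along
  which they all converge is Cauchy in L1, and a further one is Cauchy almost everywhere.\<close>

lemma gagliardo_compactness:
  fixes v :: "nat \<Rightarrow> 'a::euclidean_space \<Rightarrow> real"
  assumes [measurable]: "\<And>n. v n \<in> borel_measurable borel" "\<Omega> \<in> sets borel" and bdd: "bounded \<Omega>"
    and zero: "\<And>n x. x \<notin> \<Omega> \<Longrightarrow> v n x = 0"
    and I: "\<And>n. gagliardo \<gamma> p (v n) \<le> ennreal A"
    and L: "\<And>n. (\<integral>\<^sup>+x. ennreal (\<bar>v n x\<bar> powr p) \<partial>lborel) \<le> ennreal A"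
    and "0 \<le> A" "1 < p" "real DIM('a) < \<gamma>"
  shows "(\<forall>n. integrable lborel (v n)) \<and> (\<exists>r. strict_mono r \<and> (AE x in lborel. Cauchy (\<lambda>n. v (r n) x)) \<and>
     (\<forall>e>0. \<exists>N. \<forall>i\<ge>N. \<forall>j\<ge>N. (LINT x|lborel. \<bar>v (r i) x - v (r j) x\<bar>) < e))"
proof -
  define m where "m = measure lborel \<Omega>"
  have "emeasure lborel \<Omega> < \<infinity>" using bdd by (rule emeasure_bounded_finite)
  then have m: "emeasure lborel \<Omega> = ennreal m" "0 \<le> m"
    unfolding m_def by (auto intro: emeasure_eq_ennreal_measure)
  have nn: "(\<integral>\<^sup>+x. ennreal \<bar>v n x\<bar> \<partial>lborel) \<le> ennreal (m + A)" for n
  proof -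
    have "(\<integral>\<^sup>+x. ennreal \<bar>v n x\<bar> \<partial>lborel) \<le> (\<integral>\<^sup>+x. indicator \<Omega> x + ennreal (\<bar>v n x\<bar> powr p) \<partial>lborel)"
    proof (intro nn_integral_mono)
      fix x
      show "ennreal \<bar>v n x\<bar> \<le> indicator \<Omega> x + ennreal (\<bar>v n x\<bar> powr p)"
      proof (cases "x \<in> \<Omega>")
        case True
        have "ennreal \<bar>v n x\<bar> \<le> ennreal (1 + \<bar>v n x\<bar> powr p)"
          using young_powr[of "\<bar>v n x\<bar>" 1 p] \<open>1 < p\<close> by (intro ennreal_leI) simp
        then show ?thesis using True by simp
      qed (simp add: zero)
    qed
    also have "\<dots> = ennreal m + (\<integral>\<^sup>+x. ennreal (\<bar>v n x\<bar> powr p) \<partial>lborel)"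
      by (simp add: nn_integral_add m)
    also have "\<dots> \<le> ennreal m + ennreal A" by (intro add_left_mono L)
    finally show ?thesis using m \<open>0 \<le> A\<close> by simp
  qed
  have int: "integrable lborel (v n)" for n
    by (rule integrableI_bounded) (auto intro!: le_less_trans[OF nn])
  define e where "e k = inverse (real (Suc k))" for k
  have e: "0 < e k" for k unfolding e_def by simp
  \<comment> \<open>The radius is chosen after \<open>e k\<close>: truncating at height
    \<open>e k\<close> costs the factor \<open>e k powr (1 - p)\<close>, and a small enough ball
    compensates for it.\<close>
  have "\<forall>k. \<exists>r>0. e k powr (1 - p) * A * (2 * r) powr \<gamma> / measure lborel (ball (0::'a) r) < e k"
    using gagliardo_scale_small[OF assms(9) e] by blast
  then obtain r where r: "\<And>k. 0 < r k"
    "\<And>k. e k powr (1 - p) * A * (2 * r k) powr \<gamma> / measure lborel (ball (0::'a) (r k)) < e k" by metis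
  define b where "b k = measure lborel (ball (0::'a) (r k))" for k
  have b: "0 < b k" for k unfolding b_def using r(1)[of k] content_ball_gt_0_iff[of 0 "r k"] by simp
  have "\<forall>k. \<exists>c\<in>borel_measurable borel. finite (c ` \<Omega>) \<and> (\<forall>x. dist x (c x :: 'a) \<le> r k)"
    using grid_exists[OF bdd r(1)] by blast
  then obtain c where c[measurable]: "\<And>k. c k \<in> borel_measurable borel"
    and cfin: "\<And>k. finite (c k ` \<Omega>)" and cd: "\<And>k x. dist x (c k x :: 'a) \<le> r k" by metis
  define f where "f n q = (LINT y|lborel. indicator (ball (fst q) (snd q)) y * v n y)" for n q
  define Q where "Q = (\<Union>k. (\<lambda>z. (z, r k)) ` c k ` \<Omega>)"
  have "countable Q" unfolding Q_def
    by (rule countable_UN) (simp_all add: countable_finite[OF finite_imageI[OF cfin]])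
  moreover have fb: "norm (f n q) \<le> m + A" for n q
  proof -
    have "integrable lborel (\<lambda>y. indicator (ball (fst q) (snd q)) y * v n y)"
      using integrable_mult_indicator[OF _ int, of "ball (fst q) (snd q)"] by simp
    then have "ennreal (norm (f n q)) \<le> (\<integral>\<^sup>+y. norm (indicator (ball (fst q) (snd q)) y * v n y) \<partial>lborel)"
      unfolding f_def by (rule integral_norm_bound_ennreal)
    also have "\<dots> \<le> (\<integral>\<^sup>+y. ennreal \<bar>v n y\<bar> \<partial>lborel)"
      by (intro nn_integral_mono ennreal_leI) (auto simp: indicator_def)
    also have "\<dots> \<le> ennreal (m + A)" by (rule nn)
    finally show ?thesis using m \<open>0 \<le> A\<close> by (subst (asm) ennreal_le_iff) auto
  qed
  \<comment> \<open>A diagonal subsequence makes the averages converge at every grid point of every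
    scale.\<close>
  ultimately obtain s :: "nat \<Rightarrow> nat" where s: "strict_mono s" "\<And>q. q \<in> Q \<Longrightarrow> \<exists>l. (\<lambda>n. f (s n) q) \<longlonglongrightarrow> l"
    using function_convergent_subsequence[of Q f "m + A"] by blast
  have approx: "(\<integral>\<^sup>+x\<in>\<Omega>. ennreal \<bar>v n x - f n (c k x, r k) / b k\<bar> \<partial>lborel) \<le> ennreal (e k * m + e k)" for n k
  proof -
    have "ennreal (b k) * (\<integral>\<^sup>+x\<in>\<Omega>. ennreal \<bar>v n x - f n (c k x, r k) / b k\<bar> \<partial>lborel)
       \<le> ennreal (e k * b k) * emeasure lborel \<Omega> + ennreal (e k powr (1 - p) * (2 * r k) powr \<gamma>)
           * gagliardo \<gamma> p (v n)"
      unfolding f_def fst_conv snd_conv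
    proof (rule average_gagliardo[OF c assms(2) int r(1) cd _ e assms(8) b_def])
      show "0 \<le> \<gamma>" using assms(9) by linarith
    qed
    also have "\<dots> \<le> ennreal (e k * b k) * ennreal m + ennreal (e k powr (1 - p) * (2 * r k) powr \<gamma>) * ennreal A"
      unfolding m by (intro add_left_mono mult_left_mono I) auto
    also have "\<dots> = ennreal (e k * b k * m + e k powr (1 - p) * A * (2 * r k) powr \<gamma>)"
      using m e[of k] b[of k] \<open>0 \<le> A\<close> by (simp add: ennreal_mult[symmetric] ennreal_plus[symmetric] ac_simps del: ennreal_plus)
    also have "\<dots> \<le> ennreal (b k * (e k * m + e k))"
      using r(2)[of k] b[of k] unfolding b_def[symmetric]
      by (intro ennreal_leI) (simp add: field_simps)
    also have "\<dots> = ennreal (b k) * ennreal (e k * m + e k)"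
      using b[of k] e[of k] m by (intro ennreal_mult) auto
    finally show ?thesis using b[of k] by (subst (asm) ennreal_mult_le_mult_iff) auto
  qed
  have cauchy: "\<exists>N. \<forall>i\<ge>N. \<forall>j\<ge>N. (LINT x|lborel. \<bar>v (s i) x - v (s j) x\<bar>) < d" if "0 < d" for d
  proof -
    \<comment> \<open>Two approximation errors of \<open>e k * m + e k\<close> and one comparison of
      averages costing \<open>e k * m\<close> add up to \<open>e k * (3 * m + 2)\<close>.\<close>
    obtain k where k: "e k < d / (3 * m + 2)"
      unfolding e_def using reals_Archimedean[of "d / (3 * m + 2)"] \<open>0 < d\<close> m by auto
    \<comment> \<open>The tolerance carries the factor \<open>b k\<close> because \<open>f\<close>
      holds the integrals over the balls, which become averages only after division by
      \<open>b k\<close>.\<close>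
    have "\<forall>z\<in>c k ` \<Omega>. \<exists>N. \<forall>i\<ge>N. \<forall>j\<ge>N. \<bar>f (s i) (z, r k) - f (s j) (z, r k)\<bar> < e k * b k"
    proof
      fix z assume "z \<in> c k ` \<Omega>"
      then have "(z, r k) \<in> Q" unfolding Q_def by blast
      then have "Cauchy (\<lambda>n. f (s n) (z, r k))" using s(2) LIMSEQ_imp_Cauchy by blast
      then show "\<exists>N. \<forall>i\<ge>N. \<forall>j\<ge>N. \<bar>f (s i) (z, r k) - f (s j) (z, r k)\<bar> < e k * b k"
        using e[of k] b[of k] unfolding Cauchy_def dist_real_def by simp
    qed
    then obtain N0 where N0: "\<And>z i j. z \<in> c k ` \<Omega> \<Longrightarrow> i \<ge> N0 z \<Longrightarrow> j \<ge> N0 z \<Longrightarrow>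
        \<bar>f (s i) (z, r k) - f (s j) (z, r k)\<bar> < e k * b k" by metis
    define N where "N = Max (insert 0 (N0 ` c k ` \<Omega>))"
    have N: "\<bar>f (s i) (z, r k) - f (s j) (z, r k)\<bar> < e k * b k" if "z \<in> c k ` \<Omega>" "i \<ge> N" "j \<ge> N" for i j z
    proof -
      have "N0 z \<le> N" unfolding N_def using cfin that by (intro Max_ge) auto
      then show ?thesis using that by (intro N0) auto
    qed
    have "(LINT x|lborel. \<bar>v (s i) x - v (s j) x\<bar>) < d" if ij: "i \<ge> N" "j \<ge> N" for i j
    proof -
      define T where "T n x = f n (c k x, r k) / b k" for n x
      have [measurable]: "T n \<in> borel_measurable borel" for n
      proof -
        have [measurable]: "(\<lambda>(x, y). indicator (ball (c k x) (r k)) y :: real)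
            \<in> borel_measurable (borel \<Otimes>\<^sub>M borel)"
          by (rule indicator_ball_measurable) fact
        show ?thesis unfolding T_def f_def fst_conv snd_conv by measurable
      qed
      have Td: "\<bar>T (s i) x - T (s j) x\<bar> \<le> e k" if "x \<in> \<Omega>" for x
      proof -
        have "\<bar>T (s i) x - T (s j) x\<bar> = \<bar>f (s i) (c k x, r k) - f (s j) (c k x, r k)\<bar> / b k"
          unfolding T_def using b[of k] by (simp add: diff_divide_distrib[symmetric])
        moreover have "\<bar>f (s i) (c k x, r k) - f (s j) (c k x, r k)\<bar> \<le> e k * b k"
          using N[of "c k x" i j] that ij by (intro less_imp_le) auto
        ultimately show ?thesis using b[of k] by (simp add: pos_divide_le_eq)
      qed
      have "ennreal (LINT x|lborel. \<bar>v (s i) x - v (s j) x\<bar>) = (\<integral>\<^sup>+x. ennreal \<bar>v (s i) x - v (s j) x\<bar> \<partial>lborel)"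
        by (intro nn_integral_eq_integral[symmetric] integrable_abs Bochner_Integration.integrable_diff int) auto
      also have "\<dots> \<le> (\<integral>\<^sup>+x. ennreal \<bar>v (s i) x - T (s i) x\<bar> * indicator \<Omega> x
          + ennreal \<bar>v (s j) x - T (s j) x\<bar> * indicator \<Omega> x + ennreal (e k) * indicator \<Omega> x \<partial>lborel)"
      proof (intro nn_integral_mono)
        fix x
        show "ennreal \<bar>v (s i) x - v (s j) x\<bar> \<le> ennreal \<bar>v (s i) x - T (s i) x\<bar> * indicator \<Omega> x
          + ennreal \<bar>v (s j) x - T (s j) x\<bar> * indicator \<Omega> x + ennreal (e k) * indicator \<Omega> x"
        proof (cases "x \<in> \<Omega>")
          case True
          have "ennreal \<bar>v (s i) x - v (s j) x\<bar> \<le> ennreal (\<bar>v (s i) x - T (s i) x\<bar> + \<bar>v (s j) x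
              - T (s j) x\<bar> + e k)"
            using Td[OF True] by (intro ennreal_leI) linarith
          then show ?thesis using True e[of k] by simp
        qed (simp add: zero)
      qed
      also have "\<dots> = (\<integral>\<^sup>+x\<in>\<Omega>. ennreal \<bar>v (s i) x - T (s i) x\<bar> \<partial>lborel)
          + (\<integral>\<^sup>+x\<in>\<Omega>. ennreal \<bar>v (s j) x - T (s j) x\<bar> \<partial>lborel) + ennreal (e k) * ennreal m"
        by (simp add: nn_integral_add nn_integral_cmult m)
      also have "\<dots> \<le> ennreal (e k * m + e k) + ennreal (e k * m + e k) + ennreal (e k) * ennreal m"
        unfolding T_def by (intro add_mono approx order_refl)
      also have "\<dots> = ennreal (e k * (3 * m + 2))"
        using e[of k] m by (simp add: ennreal_mult[symmetric] ennreal_plus[symmetric] algebra_simps del: ennreal_plus)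
      finally have "(LINT x|lborel. \<bar>v (s i) x - v (s j) x\<bar>) \<le> e k * (3 * m + 2)"
        using e[of k] m by (subst (asm) ennreal_le_iff) auto
      also have "\<dots> < d" using k m by (simp add: field_simps)
      finally show ?thesis .
    qed
    then show ?thesis by blast
  qed
  obtain t where t: "strict_mono t" "AE x in lborel. Cauchy (\<lambda>i. v (s (t i)) x)"
    using cauchy_L1_AE_cauchy_subseq[of lborel "\<lambda>n. v (s n)"] int cauchy by (auto simp: real_norm_def)
  have t_ge: "i \<le> t i" for i using t(1) by (rule seq_suble)
  have "\<exists>N. \<forall>i\<ge>N. \<forall>j\<ge>N. (LINT x|lborel. \<bar>v (s (t i)) x - v (s (t j)) x\<bar>) < d" if "0 < d" for d
    using cauchy[OF that] t_ge by (meson order_trans)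
  then show ?thesis using s(1) t int
    by (intro conjI allI exI[of _ "\<lambda>i. s (t i)"]) (auto simp: strict_mono_def)
qed

subsection \<open>Convexity, primitives and Fatou\<close>

text \<open>The \<open>eventually\<close> clause is the liminf inequality in a form that adds up
  over several real integrals. The uniform bound \<open>A\<close> is what makes the limit
  integrable, so that the inequality can be read in the reals.\<close>

lemma Fatou_real:
  fixes f :: "nat \<Rightarrow> 'a \<Rightarrow> real"
  assumes int: "\<And>n. integrable M (f n)" and nonneg: "\<And>n. AE x in M. 0 \<le> f n x"
    and lim: "AE x in M. (\<lambda>n. f n x) \<longlonglongrightarrow> g x" and [measurable]: "g \<in> borel_measurable M"
    and bound: "\<And>n. (LINT x|M. f n x) \<le> A"
  shows "integrable M g" and "AE x in M. 0 \<le> g x"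
    and "0 < e \<Longrightarrow> eventually (\<lambda>n. (LINT x|M. g x) - e < (LINT x|M. f n x)) sequentially"
    and "(LINT x|M. g x) \<le> A"
proof -
  have [measurable]: "f n \<in> borel_measurable M" for n using int by auto
  have nn: "(\<integral>\<^sup>+x. ennreal (f n x) \<partial>M) = ennreal (LINT x|M. f n x)" for n
    by (rule nn_integral_eq_integral[OF int nonneg])
  have all: "AE x in M. \<forall>n. 0 \<le> f n x" using nonneg by (simp add: AE_all_countable)
  show g0: "AE x in M. 0 \<le> g x"
    using lim all by eventually_elim (auto intro: LIMSEQ_le_const)
  have "(\<integral>\<^sup>+x. ennreal (g x) \<partial>M) = (\<integral>\<^sup>+x. liminf (\<lambda>n. ennreal (f n x)) \<partial>M)"
  proof (intro nn_integral_cong_AE)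
    show "AE x in M. ennreal (g x) = liminf (\<lambda>n. ennreal (f n x))"
      using lim by eventually_elim (metis lim_imp_Liminf tendsto_ennrealI trivial_limit_sequentially)
  qed
  also have "\<dots> \<le> liminf (\<lambda>n. \<integral>\<^sup>+x. ennreal (f n x) \<partial>M)" by (rule nn_integral_liminf) auto
  finally have fat: "(\<integral>\<^sup>+x. ennreal (g x) \<partial>M) \<le> liminf (\<lambda>n. ennreal (LINT x|M. f n x))"
    unfolding nn .
  also have "\<dots> \<le> ennreal A"
    by (intro Liminf_le always_eventually allI ennreal_leI bound) auto
  finally have gA: "(\<integral>\<^sup>+x. ennreal (g x) \<partial>M) \<le> ennreal A" .
  show gint: "integrable M g"
    by (rule integrableI_nonneg) (use g0 gA in \<open>auto intro: le_less_trans\<close>)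
  have nng: "(\<integral>\<^sup>+x. ennreal (g x) \<partial>M) = ennreal (LINT x|M. g x)"
    by (rule nn_integral_eq_integral[OF gint g0])
  have f0: "0 \<le> (LINT x|M. f n x)" for n by (rule integral_nonneg_AE[OF nonneg])
  show ev: "eventually (\<lambda>n. (LINT x|M. g x) - e < (LINT x|M. f n x)) sequentially" if "0 < e" for e
  proof (cases "(LINT x|M. g x) - e < 0")
    case True
    show ?thesis
    proof (intro always_eventually allI)
      fix n show "(LINT x|M. g x) - e < (LINT x|M. f n x)" using True f0[of n] by linarith
    qed
  next
    case False
    then have "ennreal ((LINT x|M. g x) - e) < ennreal (LINT x|M. g x)"
      using \<open>0 < e\<close> by (intro ennreal_lessI) auto
    then have "eventually (\<lambda>n. ennreal ((LINT x|M. g x) - e) < ennreal (LINT x|M. f n x)) sequentially"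
      using fat unfolding nng le_Liminf_iff by blast
    then show ?thesis by eventually_elim (use False f0 in \<open>auto simp: ennreal_less_iff\<close>)
  qed
  show "(LINT x|M. g x) \<le> A"
  proof (rule field_le_epsilon)
    fix e :: real assume "0 < e"
    from ev[OF this] obtain n where "(LINT x|M. g x) - e < (LINT x|M. f n x)"
      by (auto simp: eventually_sequentially)
    then show "(LINT x|M. g x) \<le> A + e" using bound[of n] by linarith
  qed
qed

lemma DERIV_abs_powr:
  fixes p x :: real
  assumes "1 < p"
  shows "((\<lambda>x. \<bar>x\<bar> powr p) has_real_derivative p * sgn x * \<bar>x\<bar> powr (p - 1)) (at x)"
proof -
  consider "0 < x" | "x < 0" | "x = 0" by linarith
  then show ?thesis
  proof cases
    case 1
    have "((\<lambda>x. x powr p) has_real_derivative p * x powr (p - 1)) (at x)"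
      using 1 by (rule has_real_derivative_powr)
    then have "((\<lambda>x. \<bar>x\<bar> powr p) has_real_derivative p * x powr (p - 1)) (at x)"
      by (rule has_field_derivative_transform_within_open[where S="{0<..}"]) (use 1 in auto)
    then show ?thesis using 1 by simp
  next
    case 2
    have "((\<lambda>x. (- x) powr p) has_real_derivative p * (- x) powr (p - 1) * - 1) (at x)"
      by (rule DERIV_chain2[where g="\<lambda>x. - x", OF has_real_derivative_powr])
         (use 2 in \<open>auto intro!: derivative_eq_intros\<close>)
    then have "((\<lambda>x. \<bar>x\<bar> powr p) has_real_derivative p * (- x) powr (p - 1) * - 1) (at x)"
      by (rule has_field_derivative_transform_within_open[where S="{..<0}"]) (use 2 in auto)
    then show ?thesis using 2 by simp
  next
    case 3
    \<comment> \<open>At the origin the difference quotient has absolute value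
      \<open>\<bar>h\<bar> powr (p - 1)\<close>, which tends to 0 because
      \<open>1 < p\<close>.\<close>
    have "((\<lambda>h. \<bar>h\<bar> powr (p - 1)) \<longlongrightarrow> 0) (at (0::real))"
      by (rule tendsto_zero_powrI) (use assms in \<open>auto intro!: tendsto_eq_intros\<close>)
    moreover have "norm ((\<bar>0 + h\<bar> powr p - \<bar>0\<bar> powr p) / h) \<le> \<bar>h\<bar> powr (p - 1)" if "h \<noteq> 0" for h :: real
    proof -
      have "norm ((\<bar>0 + h\<bar> powr p - \<bar>0\<bar> powr p) / h) = \<bar>h\<bar> powr p / \<bar>h\<bar>" by simp
      also have "\<dots> = \<bar>h\<bar> powr (p - 1)" using that by (subst powr_diff) simp_all
      finally show ?thesis by simp
    qed
    then have "eventually (\<lambda>h::real. norm ((\<bar>0 + h\<bar> powr p - \<bar>0\<bar> powr p) / h) \<le> \<bar>h\<bar> powr (p - 1)) (at 0)"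
      unfolding eventually_at_filter by (intro always_eventually) simp
    ultimately have "((\<lambda>h. (\<bar>0 + h\<bar> powr p - \<bar>0\<bar> powr p) / h) \<longlongrightarrow> 0) (at (0::real))"
      by (rule Lim_null_comparison[rotated])
    then show ?thesis unfolding DERIV_def 3 by simp
  qed
qed

lemma mono_sgn_powr:
  fixes p x y :: real
  assumes "1 < p" "x \<le> y"
  shows "p * sgn x * \<bar>x\<bar> powr (p - 1) \<le> p * sgn y * \<bar>y\<bar> powr (p - 1)"
proof -
  consider "0 < x" | "x \<le> 0" "0 \<le> y" | "y < 0" by linarith
  then have "sgn x * \<bar>x\<bar> powr (p - 1) \<le> sgn y * \<bar>y\<bar> powr (p - 1)"
  proof cases
    case 1
    then show ?thesis using assms by (auto intro!: powr_mono2)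
  next
    case 2
    then have "sgn x * \<bar>x\<bar> powr (p - 1) \<le> 0" "0 \<le> sgn y * \<bar>y\<bar> powr (p - 1)"
      by (auto simp: sgn_if)
    then show ?thesis by linarith
  next
    case 3
    then show ?thesis using assms by (auto intro!: powr_mono2)
  qed
  then show ?thesis using assms by (simp add: mult.assoc)
qed

text \<open>The bound by the second difference with full increment supplies the dominating function
  for differentiating \<open>J\<close> under the integral sign.\<close>

lemma second_difference:
  fixes f f' :: "real \<Rightarrow> real"
  assumes der: "\<And>x. (f has_real_derivative f' x) (at x)" and mono: "\<And>x y. x \<le> y \<Longrightarrow> f' x \<le> f' y"
  shows "0 \<le> real (Suc n) * (f (a + b / Suc n) + f (a - b / Suc n) - 2 * f a)"
    and "real (Suc n) * (f (a + b / Suc n) + f (a - b / Suc n) - 2 * f a) \<le> f (a + b) + f (a - b) - 2 * f a"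
    and "(\<lambda>n. real (Suc n) * (f (a + b / Suc n) + f (a - b / Suc n) - 2 * f a)) \<longlonglongrightarrow> 0"
proof -
  have conv: "convex_on UNIV f"
    by (rule convex_on_realI[where f'=f']) (use der mono in auto)
  have c: "f ((1 - t) * x + t * y) \<le> (1 - t) * f x + t * f y" if "0 \<le> t" "t \<le> 1" for t x y
    using convex_onD[OF conv, of t x y] that by simp
  have mid: "(1 - 1 / 2) * (a + d) + 1 / 2 * (a - d) = a" for d :: real by (simp add: field_simps)
  have "f a \<le> (f (a + b / Suc n) + f (a - b / Suc n)) / 2"
    using c[of "1/2" "a + b / Suc n" "a - b / Suc n"] unfolding mid by simp
  then show "0 \<le> real (Suc n) * (f (a + b / Suc n) + f (a - b / Suc n) - 2 * f a)" by simp
  define t where "t = inverse (real (Suc n))"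
  have t: "0 \<le> t" "t \<le> 1" "real (Suc n) * t = 1" unfolding t_def by (auto simp: field_simps)
  have "f (a + b / Suc n) \<le> (1 - t) * f a + t * f (a + b)" "f (a - b / Suc n) \<le> (1 - t) * f a + t * f (a - b)"
    using c[OF t(1,2), of a "a + b"] c[OF t(1,2), of a "a - b"] unfolding t_def
    by (simp_all add: algebra_simps divide_inverse)
  then have "f (a + b / Suc n) + f (a - b / Suc n) - 2 * f a \<le> t * (f (a + b) + f (a - b) - 2 * f a)"
    by (simp add: algebra_simps)
  then have "real (Suc n) * (f (a + b / Suc n) + f (a - b / Suc n) - 2 * f a)
      \<le> real (Suc n) * (t * (f (a + b) + f (a - b) - 2 * f a))"
    by (intro mult_left_mono) auto
  also have "\<dots> = f (a + b) + f (a - b) - 2 * f a" using t(3) by (simp add: mult.assoc[symmetric])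
  finally show "real (Suc n) * (f (a + b / Suc n) + f (a - b / Suc n) - 2 * f a) \<le> f (a + b) + f (a - b)
      - 2 * f a" .
  \<comment> \<open>The first-order terms for the increments \<open>b\<close> and \<open>- b\<close>
    tend to \<open>b * f' a\<close> and \<open>- b * f' a\<close>, which cancel.\<close>
  have one: "(\<lambda>n. real (Suc n) * (f (a + c / Suc n) - f a)) \<longlonglongrightarrow> c * f' a" for c
  proof (cases "c = 0")
    case False
    have "((\<lambda>h. (f (a + h) - f a) / h) \<longlongrightarrow> f' a) (at 0)" using der[of a] by (simp add: DERIV_def)
    moreover have "filterlim (\<lambda>n. c / real (Suc n)) (at 0) sequentially"
    proof (rule filterlim_atI)
      show "(\<lambda>n. c / real (Suc n)) \<longlonglongrightarrow> 0" using LIMSEQ_Suc[OF lim_const_over_n[of c]] by simp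
      show "\<forall>\<^sub>F n in sequentially. c / real (Suc n) \<noteq> 0" using False by (simp del: of_nat_Suc)
    qed
    ultimately have "(\<lambda>n. (f (a + c / real (Suc n)) - f a) / (c / real (Suc n))) \<longlonglongrightarrow> f' a"
      by (rule filterlim_compose)
    from tendsto_mult[OF tendsto_const[of c] this] show ?thesis
      using False by (simp add: mult.commute del: of_nat_Suc)
  qed simp
  have "(\<lambda>n. real (Suc n) * (f (a + b / Suc n) - f a) + real (Suc n) * (f (a + (- b) / Suc n) - f a)) \<longlonglongrightarrow> b
      * f' a + (- b) * f' a"
    by (intro tendsto_add one)
  then show "(\<lambda>n. real (Suc n) * (f (a + b / Suc n) + f (a - b / Suc n) - 2 * f a)) \<longlonglongrightarrow> 0"
    by (simp add: algebra_simps del: of_nat_Suc)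
qed

text \<open>Moving the variable endpoint into an indicator turns the oriented integral into
  integrals against the fixed measure \<open>lborel\<close>, for which measurability in a parameter
  is available.\<close>

lemma primitive_alt:
  "primitive h x t = (if 0 \<le> t then LINT \<tau>|lborel. indicator {0..t} \<tau> * h x \<tau>
    else - (LINT \<tau>|lborel. indicator {t..0} \<tau> * h x \<tau>))"
proof (cases "0 \<le> t")
  case True
  then show ?thesis unfolding primitive_def
    by (subst interval_integral_Icc) (auto simp: set_lebesgue_integral_def)
next
  case False
  then show ?thesis unfolding primitive_def
    by (subst interval_integral_endpoints_reverse, subst interval_integral_Icc) (auto simp: set_lebesgue_integral_def)
qed

text \<open>Rounding the second argument down to a multiple of \<open>1 / Suc n\<close> leaves
  countably many values, so the rounded function is jointly measurable; continuity in the second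
  argument makes it converge to \<open>h\<close>.\<close>

lemma caratheodory_measurable_pair:
  fixes h :: "'a \<Rightarrow> real \<Rightarrow> real"
  assumes m[measurable]: "\<And>t. (\<lambda>x. h x t) \<in> borel_measurable M"
    and cont: "\<And>x. x \<in> space M \<Longrightarrow> continuous_on UNIV (h x)"
  shows "case_prod h \<in> borel_measurable (M \<Otimes>\<^sub>M borel)"
proof (rule borel_measurable_LIMSEQ_metric)
  fix n
  show "(\<lambda>z. h (fst z) (of_int \<lfloor>real (Suc n) * snd z\<rfloor> / real (Suc n))) \<in> borel_measurable (M \<Otimes>\<^sub>M borel)"
    by (rule measurable_compose_countable[where f="\<lambda>i z. h (fst z) (of_int i / real (Suc n))"
        and g="\<lambda>z. \<lfloor>real (Suc n) * snd z\<rfloor>"])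
       measurable
next
  fix z assume "z \<in> space (M \<Otimes>\<^sub>M (borel :: real measure))"
  then have x: "fst z \<in> space M" by (auto simp: space_pair_measure)
  have "(\<lambda>n. of_int \<lfloor>real (Suc n) * snd z\<rfloor> / real (Suc n)) \<longlonglongrightarrow> snd z"
  proof (rule Lim_null[THEN iffD2], rule Lim_null_comparison)
    show "(\<lambda>n. 1 / real (Suc n)) \<longlonglongrightarrow> 0" using LIMSEQ_Suc[OF lim_const_over_n[of 1]] by simp
    show "\<forall>\<^sub>F n in sequentially. norm (of_int \<lfloor>real (Suc n) * snd z\<rfloor> / real (Suc n) - snd z) \<le> 1 / real (Suc n)"
    proof (intro always_eventually allI)
      fix n
      have "of_int \<lfloor>real (Suc n) * snd z\<rfloor> / real (Suc n) - snd z = (of_int \<lfloor>real (Suc n) * snd z\<rfloor>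
          - real (Suc n) * snd z) / real (Suc n)"
        by (simp add: diff_divide_distrib del: of_nat_Suc)
      moreover have "\<bar>of_int \<lfloor>real (Suc n) * snd z\<rfloor> - real (Suc n) * snd z\<bar> \<le> 1" by linarith
      ultimately show "norm (of_int \<lfloor>real (Suc n) * snd z\<rfloor> / real (Suc n) - snd z) \<le> 1 / real (Suc n)"
        by (simp add: divide_right_mono del: of_nat_Suc)
    qed
  qed
  moreover have "isCont (h (fst z)) (snd z)" using cont[OF x] by (simp add: continuous_on_eq_continuous_at)
  ultimately have "(\<lambda>n. h (fst z) (of_int \<lfloor>real (Suc n) * snd z\<rfloor> / real (Suc n))) \<longlonglongrightarrow> h (fst z) (snd z)"
    by (rule isCont_tendsto_compose[rotated])
  then show "(\<lambda>n. h (fst z) (of_int \<lfloor>real (Suc n) * snd z\<rfloor> / real (Suc n))) \<longlonglongrightarrow> case_prod h z"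
    by (simp add: case_prod_beta)
qed

lemma primitive_measurable:
  fixes h :: "'a \<Rightarrow> real \<Rightarrow> real"
  assumes "\<And>t. (\<lambda>x. h x t) \<in> borel_measurable M"
    and "\<And>x. x \<in> space M \<Longrightarrow> continuous_on UNIV (h x)" and [measurable]: "u \<in> borel_measurable M"
  shows "(\<lambda>x. primitive h x (u x)) \<in> borel_measurable M"
proof -
  have [measurable]: "case_prod h \<in> borel_measurable (M \<Otimes>\<^sub>M borel)"
    by (rule caratheodory_measurable_pair[OF assms(1,2)])
  have "(\<lambda>(x, \<tau>). (if 0 \<le> \<tau> \<and> \<tau> \<le> u x then 1 else 0) * h x \<tau>) \<in> borel_measurable (M \<Otimes>\<^sub>M lborel)"
    "(\<lambda>(x, \<tau>). (if u x \<le> \<tau> \<and> \<tau> \<le> 0 then 1 else 0) * h x \<tau>) \<in> borel_measurable (M \<Otimes>\<^sub>M lborel)"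
    by measurable
  then have "(\<lambda>(x, \<tau>). indicator {0..u x} \<tau> * h x \<tau>) \<in> borel_measurable (M \<Otimes>\<^sub>M lborel)"
    "(\<lambda>(x, \<tau>). indicator {u x..0} \<tau> * h x \<tau>) \<in> borel_measurable (M \<Otimes>\<^sub>M lborel)"
    by (simp_all add: indicator_def of_bool_def)
  from this[THEN lborel.borel_measurable_lebesgue_integral]
  have [measurable]: "(\<lambda>x. LINT \<tau>|lborel. indicator {0..u x} \<tau> * h x \<tau>) \<in> borel_measurable M"
    "(\<lambda>x. LINT \<tau>|lborel. indicator {u x..0} \<tau> * h x \<tau>) \<in> borel_measurable M"
    by simp_all
  show ?thesis unfolding primitive_alt by measurable
qed

lemma DERIV_primitive:
  assumes "continuous_on UNIV (h x)"
  shows "((\<lambda>t. primitive h x t) has_real_derivative h x t) (at t)"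
proof -
  define R where "R = \<bar>t\<bar> + 1"
  have "((\<lambda>u. LBINT y=ereal 0..ereal u. h x y) has_vector_derivative h x t) (at t within {-R..R})"
    by (rule interval_integral_FTC2) (auto simp: R_def intro: continuous_on_subset[OF assms])
  moreover have "at t within {-R..R} = at t" by (rule at_within_Icc_at) (auto simp: R_def)
  ultimately show ?thesis unfolding primitive_def has_real_derivative_iff_has_vector_derivative by simp
qed

subsection \<open>Lipschitz functions have finite Gagliardo seminorm\<close>

lemma nn_integral_translation:
  fixes f :: "'a::euclidean_space \<Rightarrow> ennreal"
  assumes [measurable]: "f \<in> borel_measurable borel"
  shows "(\<integral>\<^sup>+y. f (c + y) \<partial>lborel) = (\<integral>\<^sup>+y. f y \<partial>lborel)"
  by (subst (2) lborel_distr_plus[of c, symmetric]) (simp add: nn_integral_distr)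

lemma nn_integral_reflect:
  fixes f :: "'a::euclidean_space \<Rightarrow> ennreal"
  assumes [measurable]: "f \<in> borel_measurable borel"
  shows "(\<integral>\<^sup>+y. f (c - y) \<partial>lborel) = (\<integral>\<^sup>+y. f y \<partial>lborel)"
proof -
  have "lborel = distr lborel borel (\<lambda>x::'a. c + (-1) *\<^sub>R x)"
    using lborel_affine[of "-1" c] by (simp add: density_1)
  then have "(\<integral>\<^sup>+y. f y \<partial>lborel) = (\<integral>\<^sup>+y. f y \<partial>distr lborel borel (\<lambda>x::'a. c + (-1) *\<^sub>R x))" by simp
  then show ?thesis by (simp add: nn_integral_distr)
qed

lemma ex_dyadic_shell:
  fixes t :: real
  assumes "0 < t" "t \<le> 1"
  shows "\<exists>n. (1/2) ^ Suc n < t \<and> t \<le> (1/2) ^ n"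
proof -
  obtain m where m: "(1/2::real) ^ m < t" using real_arch_pow_inv[of t "1/2"] assms by auto
  define k where "k = (LEAST m. (1/2::real) ^ m < t)"
  have k: "(1/2::real) ^ k < t" unfolding k_def using m by (rule LeastI)
  then have "k \<noteq> 0" using assms by (intro notI) simp
  then obtain n where n: "k = Suc n" using not0_implies_Suc by blast
  have "\<not> (1/2::real) ^ n < t" using not_less_Least[of n "\<lambda>m. (1/2::real) ^ m < t"] n unfolding k_def by simp
  then show ?thesis using k n by (intro exI[of _ n]) auto
qed

text \<open>Each point lies in some shell, and the shell is enlarged to a full ball so that
  \<open>f\<close> is dominated by a series of multiples of ball indicators. The origin belongs to
  no shell and is discarded as a null set.\<close>

lemma nn_integral_shells_finite:
  fixes f :: "'a::euclidean_space \<Rightarrow> ennreal"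
  assumes bd: "\<And>z. z \<noteq> 0 \<Longrightarrow> P z \<Longrightarrow> \<exists>n. f z \<le> ennreal (a n) \<and> norm z \<le> R n"
    and zero: "\<And>z. \<not> P z \<Longrightarrow> f z = 0"
    and nonneg: "\<And>n. 0 \<le> a n" "\<And>n. 0 \<le> R n"
    and sm: "summable (\<lambda>n. a n * R n ^ DIM('a))"
  shows "(\<integral>\<^sup>+z. f z \<partial>lborel) < \<infinity>"
proof -
  have "(\<integral>\<^sup>+z. f z \<partial>lborel) \<le> (\<integral>\<^sup>+z. (\<Sum>n. ennreal (a n) * indicator (cball (0::'a) (R n)) z) \<partial>lborel)"
  proof (rule nn_integral_mono_AE)
    have "AE z in lborel. z \<noteq> (0::'a)" by (simp add: AE_lborel_singleton)
    then show "AE z in lborel. f z \<le> (\<Sum>n. ennreal (a n) * indicator (cball (0::'a) (R n)) z)"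
    proof eventually_elim
      case (elim z)
      show ?case
      proof (cases "P z")
        case True
        then obtain n where n: "f z \<le> ennreal (a n)" "norm z \<le> R n" using bd elim by blast
        have "f z \<le> ennreal (a n) * indicator (cball (0::'a) (R n)) z" using n by simp
        also have "\<dots> \<le> (\<Sum>n. ennreal (a n) * indicator (cball (0::'a) (R n)) z)"
        proof -
          have "(\<Sum>i\<in>{n}. F i) \<le> suminf F" for F :: "nat \<Rightarrow> ennreal"
            by (rule sum_le_suminf) auto
          then have "F n \<le> suminf F" for F :: "nat \<Rightarrow> ennreal"
              by (simp only: sum.insert finite.emptyI empty_iff sum.empty add_0_right not_False_eq_True)
          then show ?thesis .
        qed
        finally show ?thesis .
      qed (simp add: zero)
    qed
  qed
  also have "\<dots> = (\<Sum>n. ennreal (a n) * ennreal (unit_ball_vol (DIM('a)) * R n ^ DIM('a)))"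
  proof (subst nn_integral_suminf)
    show "(\<lambda>z. ennreal (a n) * indicator (cball (0::'a) (R n)) z) \<in> borel_measurable lborel" for n
      by (intro borel_measurable_times_ennreal borel_measurable_indicator) auto
    show "(\<Sum>n. \<integral>\<^sup>+z. ennreal (a n) * indicator (cball (0::'a) (R n)) z \<partial>lborel)
        = (\<Sum>n. ennreal (a n) * ennreal (unit_ball_vol (DIM('a)) * R n ^ DIM('a)))"
    proof (rule arg_cong[where f=suminf], rule ext)
      fix n
      show "(\<integral>\<^sup>+z. ennreal (a n) * indicator (cball (0::'a) (R n)) z \<partial>lborel)
        = ennreal (a n) * ennreal (unit_ball_vol (DIM('a)) * R n ^ DIM('a))"
        using nonneg by (subst nn_integral_cmult_indicator) (auto simp: emeasure_cball)
    qed
  qed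
  also have "\<dots> = (\<Sum>n. ennreal (unit_ball_vol (DIM('a)) * (a n * R n ^ DIM('a))))"
    using nonneg by (simp add: ennreal_mult[symmetric] ac_simps)
  also have "\<dots> < \<infinity>"
    using nonneg by (subst suminf_ennreal2) (auto intro!: summable_mult sm mult_nonneg_nonneg)
  finally show ?thesis .
qed

text \<open>Near the origin the factor \<open>norm z powr p\<close> in the numerator beats the
  singularity, with dyadic ratio \<open>(1/2) powr (p * (1 - s))\<close>. Far out the numerator is
  at most 1 and the ratio is \<open>(1/2) powr (p * s)\<close>. Both are below 1 exactly because s
  lies strictly between 0 and 1.\<close>

lemma nn_integral_truncated_kernel_finite:
  fixes p s L :: real
  assumes "0 < p" "0 < s" "s < 1" "0 \<le> L"
  shows "(\<integral>\<^sup>+z. ennreal (min 1 (L * norm z) powr p / norm (z::'a::euclidean_space) powr (real DIM('a) + p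
      * s)) \<partial>lborel) < \<infinity>"
proof -
  define D where "D = real DIM('a)"
  define \<gamma> where "\<gamma> = D + p * s"
  have D: "0 < D" unfolding D_def by simp
  have g: "0 < \<gamma>" unfolding \<gamma>_def using D assms by (intro add_pos_pos) auto
  define q where "q z = min 1 (L * norm (z::'a)) powr p / norm z powr \<gamma>" for z
  have [measurable]: "q \<in> borel_measurable borel" unfolding q_def by measurable
  have small: "(\<integral>\<^sup>+z. ennreal (q z) * indicator {z. norm z \<le> 1} z \<partial>lborel) < \<infinity>"
  proof (rule nn_integral_shells_finite[where P="\<lambda>z. norm z \<le> 1"
        and a="\<lambda>n. (L * (1/2) ^ n) powr p / ((1/2) ^ Suc n) powr \<gamma>" and R="\<lambda>n. (1/2) ^ n"])
    fix z :: 'a assume z: "z \<noteq> 0" "norm z \<le> 1"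
    then obtain n where n: "(1/2) ^ Suc n < norm z" "norm z \<le> (1/2) ^ n"
      using ex_dyadic_shell[of "norm z"] by auto
    have "q z \<le> (L * (1/2) ^ n) powr p / ((1/2) ^ Suc n) powr \<gamma>"
      unfolding q_def
    proof (rule frac_le)
      show "min 1 (L * norm z) powr p \<le> (L * (1/2) ^ n) powr p"
        using assms n by (intro powr_mono2) (auto intro!: min.coboundedI2 mult_left_mono)
      show "((1/2) ^ Suc n) powr \<gamma> \<le> norm z powr \<gamma>" using n g by (intro powr_mono2) auto
    qed auto
    then show "\<exists>n. ennreal (q z) * indicator {z. norm z \<le> 1} z \<le> ennreal ((L
        * (1/2) ^ n) powr p / ((1/2) ^ Suc n) powr \<gamma>) \<and> norm z \<le> (1/2) ^ n"
      using z n by (intro exI[of _ n]) (auto intro: ennreal_leI)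
  next
    have "(L * (1/2) ^ n) powr p / ((1/2) ^ Suc n) powr \<gamma> * ((1/2) ^ n) ^ DIM('a)
        = L powr p * 2 powr \<gamma> * ((1/2) powr (p * (1 - s))) ^ n" for n
    proof -
      define x where "x = (1/2::real) ^ n"
      have x: "0 < x" unfolding x_def by simp
      have "(L * x) powr p = L powr p * x powr p" using x assms by (simp add: powr_mult)
      moreover have "(1/2 * x) powr \<gamma> = x powr \<gamma> / 2 powr \<gamma>" using x by (simp add: powr_divide)
      moreover have "x ^ DIM('a) = x powr D" using x by (simp add: D_def powr_realpow)
      moreover have "A * X / (G / T) * Y = A * T * (X / G * Y)" for A X G T Y :: real by simp
      ultimately have "(L * x) powr p / (1/2 * x) powr \<gamma> * x ^ DIM('a) = L powr p * 2 powr \<gamma>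
          * (x powr p / x powr \<gamma> * x powr D)"
        by simp
      also have "x powr p / x powr \<gamma> * x powr D = x powr (p - \<gamma> + D)"
        using x by (simp add: powr_add powr_diff)
      also have "p - \<gamma> + D = p * (1 - s)" unfolding \<gamma>_def by (simp add: algebra_simps)
      also have "x powr (p * (1 - s)) = ((1/2) powr (p * (1 - s))) ^ n"
        unfolding x_def by (simp add: powr_realpow[symmetric] powr_powr mult.commute)
      finally show ?thesis unfolding x_def by simp
    qed
    moreover have "summable (\<lambda>n. L powr p * 2 powr \<gamma> * ((1/2) powr (p * (1 - s))) ^ n)"
    proof (intro summable_mult summable_geometric)
      have "(1/2::real) powr (p * (1 - s)) < 1"
        using assms by (subst powr01_less_one) auto
      then show "norm ((1/2::real) powr (p * (1 - s))) < 1" by simp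
    qed
    ultimately show "summable (\<lambda>n. (L * (1/2) ^ n) powr p / ((1/2) ^ Suc n) powr \<gamma>
        * ((1/2) ^ n) ^ DIM('a))" by simp
  qed auto
  have large: "(\<integral>\<^sup>+z. ennreal (q z) * indicator {z. 1 < norm z} z \<partial>lborel) < \<infinity>"
  proof (rule nn_integral_shells_finite[where P="\<lambda>z. 1 < norm z"
        and a="\<lambda>n. 1 / (2 ^ n) powr \<gamma>" and R="\<lambda>n. 2 ^ Suc n"])
    fix z :: 'a assume z: "z \<noteq> 0" "1 < norm z"
    then obtain n where n: "(1/2) ^ Suc n < inverse (norm z)" "inverse (norm z) \<le> (1/2) ^ n"
      using ex_dyadic_shell[of "inverse (norm z)"] by (auto simp: inverse_le_1_iff)
    then have n: "norm z \<le> 2 ^ Suc n" "2 ^ n \<le> norm z"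
      using z by (auto simp: field_simps)
    have "q z \<le> 1 / (2 ^ n) powr \<gamma>"
      unfolding q_def
    proof (rule frac_le)
      show "min 1 (L * norm z) powr p \<le> 1" using assms by (intro powr_le1) auto
      show "(2 ^ n) powr \<gamma> \<le> norm z powr \<gamma>" using n g by (intro powr_mono2) auto
    qed auto
    then show "\<exists>n. ennreal (q z) * indicator {z. 1 < norm z} z \<le> ennreal (1 / (2 ^ n) powr \<gamma>) \<and> norm z \<le> 2 ^ Suc n"
      using z n by (intro exI[of _ n]) (auto intro: ennreal_leI)
  next
    have "1 / (2 ^ n) powr \<gamma> * (2 ^ Suc n) ^ DIM('a) = 2 powr D * ((1/2) powr (p * s)) ^ n" for n
    proof -
      define x where "x = (2::real) ^ n"
      have x: "0 < x" unfolding x_def by simp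
      have "(2 * x) ^ DIM('a) = 2 powr D * x powr D"
        using x by (simp add: power_mult_distrib D_def powr_realpow)
      then have "1 / x powr \<gamma> * (2 * x) ^ DIM('a) = 2 powr D * (x powr D / x powr \<gamma>)" by simp
      also have "x powr D / x powr \<gamma> = x powr (- (p * s))"
        using x by (simp add: powr_diff[symmetric] \<gamma>_def)
      also have "\<dots> = (1/2) powr (p * s * n)"
        unfolding x_def by (simp add: powr_realpow[symmetric] powr_powr powr_minus_divide powr_divide mult.commute)
      also have "\<dots> = ((1/2) powr (p * s)) ^ n" by (simp add: powr_realpow[symmetric] powr_powr)
      finally show ?thesis unfolding x_def by simp
    qed
    moreover have "summable (\<lambda>n. 2 powr D * ((1/2) powr (p * s)) ^ n)"
    proof (intro summable_mult summable_geometric)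
      have "(1/2::real) powr (p * s) < 1"
        using assms by (subst powr01_less_one) auto
      then show "norm ((1/2::real) powr (p * s)) < 1" by simp
    qed
    ultimately show "summable (\<lambda>n. 1 / (2 ^ n) powr \<gamma> * (2 ^ Suc n) ^ DIM('a))" by simp
  qed auto
  have "(\<integral>\<^sup>+z. ennreal (q z) \<partial>lborel) = (\<integral>\<^sup>+z. ennreal (q z) * indicator {z. norm z \<le> 1} z
      + ennreal (q z) * indicator {z. 1 < norm z} z \<partial>lborel)"
    by (intro nn_integral_cong) (auto simp: indicator_def)
  also have "\<dots> = (\<integral>\<^sup>+z. ennreal (q z) * indicator {z. norm z \<le> 1} z \<partial>lborel) + (\<integral>\<^sup>+z. ennreal (q z)
      * indicator {z. 1 < norm z} z \<partial>lborel)"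
    by (intro nn_integral_add) measurable
  also have "\<dots> < \<infinity>" using small large by simp
  finally show ?thesis unfolding q_def \<gamma>_def D_def .
qed

text \<open>The integrand vanishes unless \<open>x\<close> or \<open>y\<close> lies in
  \<open>U\<close>, and it is at most a function of \<open>x - y\<close> with finite integral. Each
  of the two cases thus contributes at most the measure of \<open>U\<close> times that integral, by
  reflection in one case and by exchange of integrals and translation in the other.\<close>

lemma gagliardo_lipschitz_finite:
  fixes \<phi> :: "'a::euclidean_space \<Rightarrow> real"
  assumes "0 < p" "0 < s" "s < 1" and [measurable]: "\<phi> \<in> borel_measurable borel" "U \<in> sets borel"
    and U: "bounded U" "\<And>x. x \<notin> U \<Longrightarrow> \<phi> x = 0"
    and lip: "\<And>x y. \<bar>\<phi> x - \<phi> y\<bar> \<le> min 1 (L * norm (x - y))" and "0 \<le> L"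
  shows "gagliardo (real DIM('a) + p * s) p \<phi> < \<infinity>"
proof -
  define \<gamma> where "\<gamma> = real DIM('a) + p * s"
  define q where "q z = ennreal (min 1 (L * norm (z::'a)) powr p / norm z powr \<gamma>)" for z
  have [measurable]: "q \<in> borel_measurable borel" unfolding q_def by measurable
  have qfin: "(\<integral>\<^sup>+z. q z \<partial>lborel) < \<infinity>"
    unfolding q_def \<gamma>_def by (rule nn_integral_truncated_kernel_finite) fact+
  have Ufin: "emeasure lborel U < \<infinity>" using U(1) by (rule emeasure_bounded_finite)
  have "gagliardo \<gamma> p \<phi> \<le> (\<integral>\<^sup>+x. \<integral>\<^sup>+y. indicator U x * q (x - y) + indicator U y * q (x - y) \<partial>lborel \<partial>lborel)"
    unfolding gagliardo_borel[OF assms(4)]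
  proof (intro nn_integral_mono)
    fix x y
    have le: "ennreal (\<bar>\<phi> x - \<phi> y\<bar> powr p / norm (x - y) powr \<gamma>) \<le> q (x - y)"
      unfolding q_def using lip[of x y] assms(1) by (intro ennreal_leI divide_right_mono powr_mono2) auto
    show "ennreal (\<bar>\<phi> x - \<phi> y\<bar> powr p / norm (x - y) powr \<gamma>) \<le> indicator U x * q (x - y) + indicator U y
        * q (x - y)"
    proof (cases "x \<in> U \<or> y \<in> U")
      case True
      then show ?thesis using le by (auto simp: indicator_def intro: add_increasing add_increasing2)
    next
      case False
      then show ?thesis using U(2) by simp
    qed
  qed
  also have "\<dots> = (\<integral>\<^sup>+x. \<integral>\<^sup>+y. indicator U x * q (x - y) \<partial>lborel \<partial>lborel) + (\<integral>\<^sup>+x. \<integral>\<^sup>+y. indicator U y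
      * q (x - y) \<partial>lborel \<partial>lborel)"
    by (subst nn_integral_add[symmetric]) (auto intro!: nn_integral_cong nn_integral_add lborel.borel_measurable_nn_integral)
  also have "(\<integral>\<^sup>+x. \<integral>\<^sup>+y. indicator U y * q (x - y) \<partial>lborel \<partial>lborel) = (\<integral>\<^sup>+y. \<integral>\<^sup>+x. indicator U y * q (x
      - y) \<partial>lborel \<partial>lborel)"
    by (rule lborel_pair.Fubini'[symmetric]) measurable
  also have "(\<integral>\<^sup>+y. \<integral>\<^sup>+x. indicator U y * q (x - y) \<partial>lborel \<partial>lborel) = emeasure lborel U * (\<integral>\<^sup>+z. q z \<partial>lborel)"
  proof -
    have "(\<integral>\<^sup>+x. q (x - y) \<partial>lborel) = (\<integral>\<^sup>+z. q z \<partial>lborel)" for y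
      using nn_integral_translation[of q "- y"] by simp
    then show ?thesis by (simp add: nn_integral_cmult nn_integral_multc)
  qed
  also have "(\<integral>\<^sup>+x. \<integral>\<^sup>+y. indicator U x * q (x - y) \<partial>lborel \<partial>lborel) = emeasure lborel U * (\<integral>\<^sup>+z. q z \<partial>lborel)"
    by (simp add: nn_integral_cmult nn_integral_multc nn_integral_reflect)
  also have "emeasure lborel U * (\<integral>\<^sup>+z. q z \<partial>lborel) + emeasure lborel U * (\<integral>\<^sup>+z. q z \<partial>lborel) < \<infinity>"
    using qfin Ufin by (simp add: ennreal_mult_less_top)
  finally show ?thesis unfolding \<gamma>_def .
qed

subsection \<open>The variational problem\<close>

lemma lebesgue_on_measurable_cong_AE:
  fixes f g :: "'a::euclidean_space \<Rightarrow> real"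
  assumes S: "S \<in> sets lebesgue" and g: "g \<in> borel_measurable (lebesgue_on S)"
    and ae: "AE x in lebesgue_on S. f x = g x"
  shows "f \<in> borel_measurable (lebesgue_on S)"
proof -
  have "(\<lambda>x. if x \<in> S then g x else 0) \<in> borel_measurable lebesgue"
    using borel_measurable_if[OF S] g by blast
  moreover have "AE x in lebesgue. (if x \<in> S then f x else 0) = (if x \<in> S then g x else 0)"
    using ae by (subst (asm) AE_restrict_space_iff) (use S in auto)
  ultimately have "(\<lambda>x. if x \<in> S then f x else 0) \<in> borel_measurable lebesgue"
    by (rule lebesgue_measurable_cong_AE)
  then show ?thesis using borel_measurable_if[OF S] by blast
qed

lemma abs_add_powr_le:
  fixes a b p :: real
  assumes "1 < p"
  shows "\<bar>a + b\<bar> powr p \<le> 2 powr p * (\<bar>a\<bar> powr p + \<bar>b\<bar> powr p)"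
proof -
  have "\<bar>a + b\<bar> powr p \<le> (2 * max \<bar>a\<bar> \<bar>b\<bar>) powr p" using assms by (intro powr_mono2) auto
  also have "\<dots> = 2 powr p * max \<bar>a\<bar> \<bar>b\<bar> powr p" by (simp add: powr_mult)
  also have "\<dots> \<le> 2 powr p * (\<bar>a\<bar> powr p + \<bar>b\<bar> powr p)"
    by (intro mult_left_mono) (auto simp: max_def)
  finally show ?thesis .
qed

text \<open>On the one plateau that \<open>S\<close> may split, \<open>S\<close> is upward closed in
  \<open>w\<close> and \<open>S'\<close> is downward closed. A common point \<open>z\<close> puts
  every point of the plateau into \<open>S\<close> or \<open>S'\<close>, hence almost every point
  into both; without a common point almost none belongs to either. So up to a null set
  \<open>S\<close> takes the whole plateau or nothing of it.\<close>

lemma lex_upper_both_tie_breaks: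
  assumes S: "lex_upper (space M) u w S" and S': "lex_upper (space M) u (\<lambda>x. - w x) S'"
    and ae: "AE x in M. x \<in> S \<longleftrightarrow> x \<in> S'"
  shows "\<exists>I :: real set. (\<forall>a\<in>I. \<forall>b\<ge>a. b \<in> I) \<and> (AE x in M. x \<in> S \<longleftrightarrow> u x \<in> I)"
proof (cases "\<forall>x\<in>S. \<forall>y\<in>space M. u x = u y \<longrightarrow> y \<in> S")
  case True
  have "x \<in> S \<longleftrightarrow> u x \<in> {r. \<exists>y\<in>S. u y \<le> r}" if "x \<in> space M" for x
  proof
    assume "u x \<in> {r. \<exists>y\<in>S. u y \<le> r}"
    then obtain y where y: "y \<in> S" "u y < u x \<or> u y = u x" by force
    then show "x \<in> S" using S True that unfolding lex_upper_def by blast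
  qed auto
  then have "AE x in M. x \<in> S \<longleftrightarrow> u x \<in> {r. \<exists>y\<in>S. u y \<le> r}" by (intro AE_I2)
  then show ?thesis by (intro exI[of _ "{r. \<exists>y\<in>S. u y \<le> r}"]) (auto intro: order_trans)
next
  case False
  then obtain x0 y0 where xy: "x0 \<in> S" "y0 \<in> space M" "u x0 = u y0" "y0 \<notin> S" by blast
  \<comment> \<open>\<open>x0\<close> in \<open>S\<close> and \<open>y0\<close> outside share the
    value \<open>c\<close>. Hence \<open>S\<close> contains every point with larger \<open>u\<close>
    and none with smaller \<open>u\<close>, and \<open>c\<close> is the only level that
    \<open>S\<close> can split.\<close>
  define c where "c = u x0"
  have above: "x \<in> S" if "x \<in> space M" "c < u x" for x
    using S xy that unfolding lex_upper_def c_def by blast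
  have below: "x \<notin> S" if "u x < c" for x
    using S xy that unfolding lex_upper_def c_def by metis
  show ?thesis
  proof (cases "\<exists>z\<in>S \<inter> S'. u z = c")
    case True
    then obtain z where z: "z \<in> S" "z \<in> S'" "u z = c" by blast
    have mid: "x \<in> S \<or> x \<in> S'" if "x \<in> space M" "u x = c" for x
    proof (cases "w z \<le> w x")
      case True
      then show ?thesis using S z that unfolding lex_upper_def by metis
    next
      case False
      then have "- w z \<le> - w x" by simp
      then show ?thesis using S' z that unfolding lex_upper_def by metis
    qed
    have "AE x in M. x \<in> S \<longleftrightarrow> u x \<in> {c..}"
      using ae AE_space
    proof eventually_elim
      case (elim x)
      then show ?case using above[of x] below[of x] mid[of x] by (cases "u x" c rule: linorder_cases) auto
    qed
    then show ?thesis by (intro exI[of _ "{c..}"]) auto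
  next
    case False
    have "AE x in M. x \<in> S \<longleftrightarrow> u x \<in> {c<..}"
      using ae AE_space
    proof eventually_elim
      case (elim x)
      then show ?case using above[of x] below[of x] False by (cases "u x" c rule: linorder_cases) auto
    qed
    then show ?thesis by (intro exI[of _ "{c<..}"]) auto
  qed
qed

text \<open>\<eta> r is the supremum of the levels \<open>t\<close> whose set \<open>I t\<close>
  contains \<open>r\<close>; it is nondecreasing because each \<open>I t\<close> is closed upwards.
  Only rational levels are used, so that the exceptional null sets stay countable in number, and
  their density recovers \<open>g x\<close>.\<close>

lemma ex_mono_of_level_sets:
  fixes g u :: "'a \<Rightarrow> real"
  assumes bd: "AE x in M. 0 \<le> g x \<and> g x \<le> C" and C: "0 \<le> C"
    and lev: "\<And>t. 0 \<le> t \<Longrightarrow> \<exists>I. (\<forall>a\<in>I. \<forall>b\<ge>a. b \<in> I) \<and> (AE x in M. t < g x \<longleftrightarrow> u x \<in> I)"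
  shows "\<exists>\<eta> :: real \<Rightarrow> real. mono \<eta> \<and> (AE x in M. g x = \<eta> (u x))"
proof -
  have "\<forall>t. \<exists>I. 0 \<le> t \<longrightarrow> (\<forall>a\<in>I. \<forall>b\<ge>a. b \<in> I) \<and> (AE x in M. t < g x \<longleftrightarrow> u x \<in> I)"
    using lev by blast
  then obtain I where I: "\<And>t a b. 0 \<le> t \<Longrightarrow> a \<in> I t \<Longrightarrow> a \<le> b \<Longrightarrow> b \<in> I t"
    and Iae: "\<And>t. 0 \<le> t \<Longrightarrow> AE x in M. t < g x \<longleftrightarrow> u x \<in> I t" by metis
  define R where "R r = insert 0 {t\<in>\<rat>. 0 \<le> t \<and> t \<le> C \<and> r \<in> I t}" for r
  have bdR: "bdd_above (R r)" for r unfolding R_def by (rule bdd_aboveI[of _ C]) (use C in auto)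
  have R0: "R r \<noteq> {}" for r unfolding R_def by simp
  define \<eta> where "\<eta> r = Sup (R r)" for r
  have "mono \<eta>"
  proof (rule monoI)
    fix a b :: real assume "a \<le> b"
    then have "R a \<subseteq> R b" unfolding R_def using I by blast
    then show "\<eta> a \<le> \<eta> b" unfolding \<eta>_def by (intro cSup_subset_mono R0 bdR)
  qed
  moreover have "AE x in M. \<forall>t\<in>\<rat>. 0 \<le> t \<longrightarrow> (t < g x \<longleftrightarrow> u x \<in> I t)"
  proof (subst AE_ball_countable[OF countable_rat], intro ballI)
    fix t :: real
    show "AE x in M. 0 \<le> t \<longrightarrow> (t < g x \<longleftrightarrow> u x \<in> I t)"
      using Iae[of t] by (cases "0 \<le> t") (auto elim: eventually_mono)
  qed
  then have "AE x in M. g x = \<eta> (u x)"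
    using bd
  proof eventually_elim
    case (elim x)
    have Rx: "R (u x) = insert 0 {t\<in>\<rat>. 0 \<le> t \<and> t \<le> C \<and> t < g x}" unfolding R_def using elim(1) by blast
    have "\<eta> (u x) \<le> g x" unfolding \<eta>_def by (rule cSup_least[OF R0]) (use elim(2) in \<open>auto simp: Rx\<close>)
    moreover have "\<not> \<eta> (u x) < g x"
    proof
      assume "\<eta> (u x) < g x"
      moreover have "0 \<le> \<eta> (u x)" unfolding \<eta>_def by (rule cSup_upper[OF _ bdR]) (simp add: R_def)
      moreover obtain t where t: "t \<in> \<rat>" "\<eta> (u x) < t" "t < g x"
          using Rats_dense_in_real[OF calculation(1)] by blast
      ultimately have "t \<in> R (u x)" unfolding Rx using elim(2) by auto
      then have "t \<le> \<eta> (u x)" unfolding \<eta>_def by (rule cSup_upper[OF _ bdR])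
      then show False using t by simp
    qed
    ultimately show ?case by linarith
  qed
  ultimately show ?thesis by blast
qed

text \<open>Pairing with \<open>u\<close> is one coordinate of the product whose topology is pulled
  back, hence continuous. The half-space it defines is closed and contains \<open>G\<close>, so it
  contains the closure.\<close>

lemma closure_weak_star_pairing_le:
  assumes G: "G \<subseteq> Linfty \<Omega>" and u: "u \<in> L1 \<Omega>"
    and le: "\<And>g. g \<in> G \<Longrightarrow> (LINT x|lebesgue_on \<Omega>. g x * u x) \<le> c"
    and g: "g \<in> weak_star_topology \<Omega> closure_of G"
  shows "g \<in> Linfty \<Omega>" "(LINT x|lebesgue_on \<Omega>. g x * u x) \<le> c"
proof -
  let ?X = "weak_star_topology \<Omega>"
  have top: "topspace ?X = Linfty \<Omega>"
    unfolding weak_star_topology_def topspace_pullback_topology by auto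
  have "continuous_map ?X euclideanreal ((\<lambda>y. y u) \<circ> (\<lambda>g. \<lambda>f\<in>L1 \<Omega>. LINT x|lebesgue_on \<Omega>. g x * f x))"
    unfolding weak_star_topology_def
    by (intro continuous_map_pullback continuous_map_product_projection u)
  then have "closedin ?X {g \<in> topspace ?X. ((\<lambda>y. y u) \<circ> (\<lambda>g. \<lambda>f\<in>L1 \<Omega>. LINT x|lebesgue_on \<Omega>. g x * f x)) g \<in> {..c}}"
    by (rule closedin_continuous_map_preimage) simp
  then have "closedin ?X {g \<in> Linfty \<Omega>. (LINT x|lebesgue_on \<Omega>. g x * u x) \<le> c}"
    using u by (simp add: top)
  then have "?X closure_of G \<subseteq> {g \<in> Linfty \<Omega>. (LINT x|lebesgue_on \<Omega>. g x * u x) \<le> c}"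
    by (rule closure_of_minimal[rotated]) (use G le in auto)
  then show "g \<in> Linfty \<Omega>" "(LINT x|lebesgue_on \<Omega>. g x * u x) \<le> c" using g by auto
qed

locale fractional_problem =
  fixes \<Omega> :: "'a::euclidean_space set"
    and K :: "'a \<Rightarrow> 'a \<Rightarrow> real"
    and h :: "'a \<Rightarrow> real \<Rightarrow> real"
    and p s q C0 C1 C2 :: real
  assumes open_\<Omega>: "open \<Omega>" and bounded_\<Omega>: "bounded \<Omega>"
    and p: "1 < p" and s: "0 < s" "s < 1"
    and K_measurable: "(\<lambda>(x, y). K x y) \<in> borel_measurable lebesgue"
    and C1: "0 < C1" and C12: "C1 \<le> C2"
    and K_bounds: "AE (x, y) in lebesgue.
           C1 \<le> K x y * norm (x - y) powr (real DIM('a) + p * s) \<and>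
           K x y * norm (x - y) powr (real DIM('a) + p * s) \<le> C2"
    and carath: "caratheodory \<Omega> h"
    and h_nonneg: "\<And>x t. x \<in> \<Omega> \<Longrightarrow> 0 \<le> h x t"
    and h_mono: "AE x in lebesgue_on \<Omega>. mono (h x)"
    and C0: "0 < C0" and q: "1 < q" "q < p"
    and h_growth: "AE x in lebesgue_on \<Omega>. \<forall>t. h x t \<le> C0 * (1 + \<bar>t\<bar> powr (q - 1))"
begin

section \<open>Kinetic energy and the fractional Sobolev space\<close>

abbreviation "W \<equiv> Wsp0 s p \<Omega>"
abbreviation "\<mu> \<equiv> lebesgue_on \<Omega>"
abbreviation "E \<equiv> energy K h p \<Omega>"
abbreviation quot :: "('a \<Rightarrow> real) \<Rightarrow> 'a \<times> 'a \<Rightarrow> real" where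
  "quot u z \<equiv> \<bar>u (fst z) - u (snd z)\<bar> powr p / norm (fst z - snd z) powr (real DIM('a) + p * s)"
abbreviation gag :: "('a \<Rightarrow> real) \<Rightarrow> ennreal" where
  "gag \<equiv> gagliardo (real DIM('a) + p * s) p"

lemma order_pos: "0 < real DIM('a) + p * s" "real DIM('a) < real DIM('a) + p * s"
proof -
  have "0 < p * s" using p s by simp
  moreover have "0 < real DIM('a)" by simp
  ultimately show "0 < (real DIM('a) + p * s)" "real DIM('a) < (real DIM('a) + p * s)" by linarith+
qed

lemma \<Omega>_sets [measurable, simp]: "\<Omega> \<in> sets borel" "\<Omega> \<in> sets lebesgue"
  using open_\<Omega> by auto

lemma \<Omega>_lmeasurable: "\<Omega> \<in> lmeasurable"
  using bounded_\<Omega> by (intro bounded_set_imp_lmeasurable) auto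

sublocale \<Omega>: finite_measure "\<mu>"
  by (rule finite_measure_lebesgue_on[OF \<Omega>_lmeasurable])

lemma AE_on_iff: "(AE x in \<mu>. P x) \<longleftrightarrow> (AE x in lebesgue. x \<in> \<Omega> \<longrightarrow> P x)"
  by (subst AE_restrict_space_iff) auto

lemma measurable_on: "f \<in> borel_measurable lebesgue \<Longrightarrow> f \<in> borel_measurable \<mu>"
  by (rule measurable_restrict_space1)

lemma integrable_on:
  fixes f :: "'a \<Rightarrow> real"
  assumes "integrable lebesgue f"
  shows "integrable \<mu> f"
  using integrable_mult_indicator[OF \<Omega>_sets(2) assms] by (subst integrable_restrict_space) auto

lemma K_AE: "AE z in lebesgue. C1 / norm (fst z - snd z) powr (real DIM('a) + p * s) \<le> K (fst z) (snd z) \<and>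
    K (fst z) (snd z) \<le> C2 / norm (fst z - snd z) powr (real DIM('a) + p * s)"
  using K_bounds
proof eventually_elim
  case (elim z)
  then have e: "C1 \<le> K (fst z) (snd z) * norm (fst z - snd z) powr (real DIM('a) + p * s)"
      "K (fst z) (snd z) * norm (fst z - snd z) powr (real DIM('a) + p * s) \<le> C2" by (auto simp: case_prod_beta)
  \<comment> \<open>The lower bound \<open>C1 > 0\<close> itself excludes the diagonal, where the
    product with the kernel power would be 0.\<close>
  have "norm (fst z - snd z) powr (real DIM('a) + p * s) \<noteq> 0" using e(1) C1 by auto
  then have "0 < norm (fst z - snd z) powr (real DIM('a) + p * s)" by (simp add: less_le)
  then show ?case using e by (simp add: field_simps)
qed

lemma C2: "0 \<le> C2"
  using C1 C12 by simp

definition kin_density :: "('a \<Rightarrow> real) \<Rightarrow> 'a \<times> 'a \<Rightarrow> real" where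
  "kin_density u z = \<bar>u (fst z) - u (snd z)\<bar> powr p * K (fst z) (snd z)"

definition kin :: "('a \<Rightarrow> real) \<Rightarrow> real" where
  "kin u = integral\<^sup>L lebesgue (kin_density u)"

definition pot :: "('a \<Rightarrow> real) \<Rightarrow> real" where
  "pot u = (LINT x|\<mu>. primitive h x (u x))"

definition J :: "('a \<Rightarrow> real) \<Rightarrow> real" where
  "J u = pot u + kin u / p"

lemma kin_density_measurable:
  assumes "u \<in> borel_measurable lebesgue"
  shows "kin_density u \<in> borel_measurable lebesgue"
proof -
  have "(\<lambda>z. K (fst z) (snd z)) \<in> borel_measurable lebesgue" using K_measurable by (simp add: case_prod_unfold)
  moreover have "(\<lambda>z. \<bar>u (fst z) - u (snd z)\<bar> powr p) \<in> borel_measurable lebesgue"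
    using borel_measurable_lebesgue_fst[OF assms] borel_measurable_lebesgue_snd[OF assms] by measurable
  ultimately show ?thesis unfolding kin_density_def[abs_def] by (rule borel_measurable_times[rotated])
qed

lemma kin_density_bounds:
  "AE z in lebesgue. C1 * (quot u z) \<le> kin_density u z \<and>
     kin_density u z \<le> C2 * (quot u z) \<and> 0 \<le> K (fst z) (snd z) \<and> 0 \<le> kin_density u z"
  using K_AE
proof eventually_elim
  case (elim z)
  have "0 \<le> C1 / norm (fst z - snd z) powr (real DIM('a) + p * s)" using C1 by simp
  then have K0: "0 \<le> K (fst z) (snd z)" using elim by linarith
  have "\<bar>u (fst z) - u (snd z)\<bar> powr p * (C1 / norm (fst z - snd z) powr (real DIM('a) + p * s)) \<le> kin_density u z"
    "kin_density u z \<le> \<bar>u (fst z) - u (snd z)\<bar> powr p * (C2 / norm (fst z - snd z) powr (real DIM('a) + p * s))"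
    unfolding kin_density_def using elim by (intro mult_left_mono; simp)+
  then show ?case using K0 unfolding kin_density_def by (simp add: ac_simps)
qed

lemma kin_density_cong_AE:
  assumes "AE x in lebesgue. u x = v x"
  shows "AE z in lebesgue. kin_density u z = kin_density v z"
  using AE_lebesgue_fst[OF assms] AE_lebesgue_snd[OF assms]
  by eventually_elim (simp add: kin_density_def)

lemma isCont_abs_powr: "isCont (\<lambda>x. \<bar>x\<bar> powr p) y" for y :: real
  using DERIV_abs_powr[OF p] by (rule DERIV_isCont)

lemma kin_density_tendsto:
  assumes "AE x in lebesgue. (\<lambda>n. v n x) \<longlonglongrightarrow> w x"
  shows "AE z in lebesgue. (\<lambda>n. kin_density (v n) z) \<longlonglongrightarrow> kin_density w z"
  using AE_lebesgue_fst[OF assms] AE_lebesgue_snd[OF assms]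
  by eventually_elim
     (auto simp: kin_density_def intro!: tendsto_mult tendsto_const isCont_tendsto_compose[OF isCont_abs_powr] tendsto_diff)

lemma gagliardo_alt:
  fixes u :: "'a \<Rightarrow> real"
  shows
  "gag u = (\<integral>\<^sup>+z. ennreal (quot u z) \<partial>lebesgue)"
  unfolding gagliardo_def by (simp add: case_prod_unfold)

lemma gagliardo_density_measurable:
  fixes u :: "'a \<Rightarrow> real"
  assumes "u \<in> borel_measurable lebesgue"
  shows "(\<lambda>z. quot u z) \<in> borel_measurable lebesgue"
proof -
  have "(\<lambda>z::'a \<times> 'a. norm (fst z - snd z) powr (real DIM('a) + p * s))
      \<in> borel_measurable (borel \<Otimes>\<^sub>M borel)" by measurable
  then have "(\<lambda>z::'a \<times> 'a. norm (fst z - snd z) powr (real DIM('a) + p * s)) \<in> borel_measurable lebesgue"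
    by (intro measurable_completion) (simp add: borel_prod)
  moreover have "(\<lambda>z. \<bar>u (fst z) - u (snd z)\<bar> powr p) \<in> borel_measurable lebesgue"
    using borel_measurable_lebesgue_fst[OF assms] borel_measurable_lebesgue_snd[OF assms] by measurable
  ultimately show ?thesis by (intro borel_measurable_divide)
qed

lemma kin_density_integrable:
  assumes u: "u \<in> borel_measurable lebesgue" and fin: "gag u < \<infinity>"
  shows "integrable lebesgue (kin_density u)"
proof (rule integrableI_nonneg[OF kin_density_measurable[OF u]])
  show "AE z in lebesgue. 0 \<le> kin_density u z" using kin_density_bounds[of u] by eventually_elim auto
  have [measurable]: "(\<lambda>z. quot u z) \<in> borel_measurable lebesgue"
    by (rule gagliardo_density_measurable[OF u])
  have "(\<integral>\<^sup>+z. ennreal (kin_density u z) \<partial>lebesgue)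
      \<le> (\<integral>\<^sup>+z. ennreal C2 * ennreal (quot u z) \<partial>lebesgue)"
    using kin_density_bounds[of u] C2
    by (intro nn_integral_mono_AE) (auto simp: ennreal_mult[symmetric] intro!: ennreal_leI elim!: eventually_mono)
  also have "\<dots> = ennreal C2 * gag u" by (simp add: nn_integral_cmult gagliardo_alt)
  also have "\<dots> < \<infinity>" using fin by (simp add: ennreal_mult_less_top)
  finally show "(\<integral>\<^sup>+z. ennreal (kin_density u z) \<partial>lebesgue) < \<infinity>" .
qed

lemma kin_nonneg: "0 \<le> kin u"
  unfolding kin_def using kin_density_bounds[of u] by (intro integral_nonneg_AE) (auto elim: eventually_mono)

lemma gagliardo_le_kin:
  assumes u: "u \<in> borel_measurable lebesgue" and int: "integrable lebesgue (kin_density u)"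
  shows "ennreal C1 * gag u \<le> ennreal (kin u)"
proof -
  have [measurable]: "(\<lambda>z. quot u z) \<in> borel_measurable lebesgue"
    by (rule gagliardo_density_measurable[OF u])
  have "ennreal C1 * gag u
     = (\<integral>\<^sup>+z. ennreal C1 * ennreal (quot u z) \<partial>lebesgue)"
    by (simp add: nn_integral_cmult gagliardo_alt)
  also have "\<dots> \<le> (\<integral>\<^sup>+z. ennreal (kin_density u z) \<partial>lebesgue)"
    using kin_density_bounds[of u] C1
    by (intro nn_integral_mono_AE) (auto simp: ennreal_mult[symmetric] intro!: ennreal_leI elim!: eventually_mono)
  also have "\<dots> = ennreal (kin u)"
    unfolding kin_def using kin_density_bounds[of u]
    by (intro nn_integral_eq_integral[OF int]) (auto elim: eventually_mono)
  finally show ?thesis .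
qed

text \<open>Converse of \<open>kin_density_integrable\<close>. Membership of sums, multiples and
  limits in \<open>W\<close> can then be checked on the real-valued density
  \<open>kin_density\<close>.\<close>

lemma gagliardo_finite:
  assumes u: "u \<in> borel_measurable lebesgue" and int: "integrable lebesgue (kin_density u)"
  shows "gag u < \<infinity>"
proof (rule ccontr)
  assume "\<not> ?thesis"
  then have "gag u = top"
    by (metis top.not_eq_extremum infinity_ennreal_def)
  then have "ennreal C1 * gag u = top"
    using C1 by (simp add: ennreal_mult_eq_top_iff)
  then show False using gagliardo_le_kin[OF assms] by (simp add: top_unique)
qed

lemma W_iff: "u \<in> W \<longleftrightarrow> u \<in> borel_measurable lebesgue \<and> integrable lebesgue (\<lambda>x. \<bar>u x\<bar> powr p) \<and>
    gag u < \<infinity> \<and> (AE x in lebesgue. x \<notin> \<Omega> \<longrightarrow> u x = 0)"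
  unfolding Wsp0_def gagliardo_def by simp

lemma W_D:
  assumes "u \<in> W"
  shows "u \<in> borel_measurable lebesgue" "integrable lebesgue (\<lambda>x. \<bar>u x\<bar> powr p)"
    "gag u < \<infinity>" "AE x in lebesgue. x \<notin> \<Omega> \<longrightarrow> u x = 0"
    "integrable lebesgue (kin_density u)" "u \<in> borel_measurable \<mu>"
    "integrable \<mu> (\<lambda>x. \<bar>u x\<bar> powr p)" "integrable \<mu> u"
proof -
  show u: "u \<in> borel_measurable lebesgue" "integrable lebesgue (\<lambda>x. \<bar>u x\<bar> powr p)"
    "gag u < \<infinity>" "AE x in lebesgue. x \<notin> \<Omega> \<longrightarrow> u x = 0"
    using assms unfolding W_iff by auto
  show "integrable lebesgue (kin_density u)" by (rule kin_density_integrable[OF u(1,3)])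
  show m: "u \<in> borel_measurable \<mu>" by (rule measurable_on[OF u(1)])
  show i: "integrable \<mu> (\<lambda>x. \<bar>u x\<bar> powr p)" by (rule integrable_on[OF u(2)])
  show "integrable \<mu> u"
  proof (rule Bochner_Integration.integrable_bound[OF _ m])
    show "integrable \<mu> (\<lambda>x. 1 + \<bar>u x\<bar> powr p)" using i by simp
    show "AE x in \<mu>. norm (u x) \<le> norm (1 + \<bar>u x\<bar> powr p)"
      using young_powr[of "\<bar>u _\<bar>" 1 p] p by (intro always_eventually) auto
  qed
qed

lemma W_cong_AE:
  assumes "u \<in> W" "AE x in lebesgue. u x = v x"
  shows "v \<in> W"
proof -
  have ae: "AE x in lebesgue. v x = u x" using assms(2) by eventually_elim simp
  have v: "v \<in> borel_measurable lebesgue" by (rule lebesgue_measurable_cong_AE[OF W_D(1)[OF assms(1)] ae])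
  have "integrable lebesgue (\<lambda>x. \<bar>v x\<bar> powr p)"
    using W_D(1,2)[OF assms(1)] v ae
    by (subst integrable_cong_AE[where g="\<lambda>x. \<bar>u x\<bar> powr p"]) (auto elim: eventually_mono)
  moreover have "gag v < \<infinity>" using W_D(3)[OF assms(1)] gagliardo_cong_AE[OF assms(2)] by metis
  moreover have "AE x in lebesgue. x \<notin> \<Omega> \<longrightarrow> v x = 0"
    using W_D(4)[OF assms(1)] assms(2) by eventually_elim auto
  ultimately show ?thesis using v unfolding W_iff by blast
qed

lemma kin_cong_AE:
  assumes "u \<in> W" "AE x in lebesgue. u x = v x"
  shows "kin u = kin v"
  unfolding kin_def
  using kin_density_measurable[OF W_D(1)[OF assms(1)]] kin_density_measurable[OF W_D(1)[OF W_cong_AE[OF assms]]]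
    kin_density_cong_AE[OF assms(2)] by (rule integral_cong_AE)

lemma W_add:
  assumes u: "u \<in> W" and v: "v \<in> W"
  shows "(\<lambda>x. u x + v x) \<in> W"
  unfolding W_iff
proof (intro conjI)
  note u' = W_D[OF u] and v' = W_D[OF v]
  note [measurable] = u'(1) v'(1)
  show m: "(\<lambda>x. u x + v x) \<in> borel_measurable lebesgue" by measurable
  show "AE x in lebesgue. x \<notin> \<Omega> \<longrightarrow> u x + v x = 0" using u'(4) v'(4) by eventually_elim auto
  show "integrable lebesgue (\<lambda>x. \<bar>u x + v x\<bar> powr p)"
  proof (rule Bochner_Integration.integrable_bound)
    show "integrable lebesgue (\<lambda>x. 2 powr p * (\<bar>u x\<bar> powr p + \<bar>v x\<bar> powr p))" using u'(2) v'(2) by simp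
    show "AE x in lebesgue. norm (\<bar>u x + v x\<bar> powr p) \<le> norm (2 powr p * (\<bar>u x\<bar> powr p + \<bar>v x\<bar> powr p))"
      using abs_add_powr_le[OF p] by (intro always_eventually) auto
  qed measurable
  have "integrable lebesgue (kin_density (\<lambda>x. u x + v x))"
  proof (rule Bochner_Integration.integrable_bound)
    show "integrable lebesgue (\<lambda>z. 2 powr p * (kin_density u z + kin_density v z))" using u'(5) v'(5) by simp
    show "AE z in lebesgue. norm (kin_density (\<lambda>x. u x + v x) z) \<le> norm (2 powr p * (kin_density u z
        + kin_density v z))"
      using kin_density_bounds[of u] kin_density_bounds[of v] kin_density_bounds[of "\<lambda>x. u x + v x"]
    proof eventually_elim
      case (elim z)
      have "\<bar>u (fst z) + v (fst z) - (u (snd z) + v (snd z))\<bar> powr p \<le> 2 powr p * (\<bar>u (fst z)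
          - u (snd z)\<bar> powr p + \<bar>v (fst z) - v (snd z)\<bar> powr p)"
        using abs_add_powr_le[OF p, of "u (fst z) - u (snd z)" "v (fst z) - v (snd z)"]
            by (simp add: algebra_simps)
      then have "kin_density (\<lambda>x. u x + v x) z \<le> 2 powr p * (\<bar>u (fst z) - u (snd z)\<bar> powr p + \<bar>v (fst z)
          - v (snd z)\<bar> powr p) * K (fst z) (snd z)"
        unfolding kin_density_def using elim by (intro mult_right_mono) auto
      also have "\<dots> = 2 powr p * (kin_density u z + kin_density v z)" unfolding kin_density_def
          by (simp add: algebra_simps)
      finally show ?case using elim by simp
    qed
  qed (rule kin_density_measurable[OF m])
  from gagliardo_finite[OF m this] show "gag (\<lambda>x. u x + v x) < \<infinity>" .
qed

lemma W_scale:
  assumes u: "u \<in> W"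
  shows "(\<lambda>x. c * u x) \<in> W"
  unfolding W_iff
proof (intro conjI)
  note u' = W_D[OF u]
  note [measurable] = u'(1)
  show m: "(\<lambda>x. c * u x) \<in> borel_measurable lebesgue" by measurable
  show "AE x in lebesgue. x \<notin> \<Omega> \<longrightarrow> c * u x = 0" using u'(4) by eventually_elim auto
  show "integrable lebesgue (\<lambda>x. \<bar>c * u x\<bar> powr p)" using u'(2) by (simp add: abs_mult powr_mult)
  have "kin_density (\<lambda>x. c * u x) = (\<lambda>z. \<bar>c\<bar> powr p * kin_density u z)"
    by (simp add: kin_density_def fun_eq_iff right_diff_distrib[symmetric] abs_mult powr_mult)
  then have "integrable lebesgue (kin_density (\<lambda>x. c * u x))" using u'(5) by simp
  from gagliardo_finite[OF m this] show "gag (\<lambda>x. c * u x) < \<infinity>" .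
qed

lemma zero_W: "(\<lambda>x. 0) \<in> W"
  unfolding W_iff gagliardo_def using p by (auto simp: case_prod_unfold)

text \<open>The estimates by iterated integrals over \<open>lborel\<close> need a Borel
  representative that vanishes at every point outside \<Omega>, not just almost everywhere.\<close>

lemma W_borel:
  assumes "u \<in> W"
  obtains v where "v \<in> borel_measurable borel" "\<And>x. x \<notin> \<Omega> \<Longrightarrow> v x = 0"
    "AE x in lebesgue. u x = v x" "v \<in> W"
proof -
  obtain v where v: "v \<in> borel_measurable borel" "AE x in lebesgue. u x = v x"
    using lebesgue_measurable_ex_borel[OF W_D(1)[OF assms]] .
  note [measurable] = v(1)
  let ?v = "\<lambda>x. indicator \<Omega> x * v x"
  have "AE x in lebesgue. u x = ?v x"
    using v(2) W_D(4)[OF assms] by eventually_elim (auto simp: indicator_def)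
  moreover have "?v \<in> borel_measurable borel" by measurable
  moreover note W_cong_AE[OF assms calculation(1)]
  ultimately show ?thesis by (intro that[of ?v]) auto
qed

lemma poincare: "\<exists>P>0. \<forall>u\<in>W. (LINT x|lebesgue. \<bar>u x\<bar> powr p) \<le> P * kin u"
proof -
  obtain R where R: "0 < R" "\<And>x. x \<in> \<Omega> \<Longrightarrow> norm x \<le> R" using bounded_\<Omega> unfolding bounded_pos by blast
  obtain e :: 'a where e: "e \<in> Basis" using nonempty_Basis by blast
  \<comment> \<open>A ball away from \<Omega> where functions of \<open>W\<close> vanish: \<Omega>
    has norms at most \<open>R\<close>, points of \<open>B\<close> have norms between
    \<open>2 * R\<close> and \<open>4 * R\<close>, so the mutual distances are at most
    \<open>5 * R\<close>. This gives the numerator of \<open>P\<close>; its denominator is the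
    volume of \<open>B\<close> times the constant \<open>C1\<close> that passes from the seminorm to
    \<open>kin\<close>.\<close>
  define B where "B = ball ((3 * R) *\<^sub>R e) R"
  define b where "b = measure lborel B"
  have b: "0 < b" unfolding b_def B_def using content_ball_gt_0_iff R by simp
  have eb: "emeasure lborel B = ennreal b" unfolding b_def B_def using R by (simp add: emeasure_ball content_ball)
  have B: "y \<notin> \<Omega> \<and> norm y \<le> 4 * R" if "y \<in> B" for y
  proof -
    have d: "norm ((3 * R) *\<^sub>R e - y) < R" using that unfolding B_def by (simp add: dist_norm)
    have n: "norm ((3 * R) *\<^sub>R e) = 3 * R" using e R by simp
    have "2 * R < norm y" using norm_triangle_ineq2[of "(3 * R) *\<^sub>R e" y] d n by linarith
    moreover have "norm y \<le> 4 * R" using norm_triangle_ineq2[of y "(3 * R) *\<^sub>R e"] d n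
        by (simp add: norm_minus_commute)
    ultimately show ?thesis using R by force
  qed
  have Bm: "B \<in> sets borel" unfolding B_def by simp
  define P where "P = (5 * R) powr (real DIM('a) + p * s) / (b * C1)"
  have P: "0 < P" unfolding P_def using R b C1 by simp
  have "(LINT x|lebesgue. \<bar>u x\<bar> powr p) \<le> P * kin u" if "u \<in> W" for u
  proof -
    obtain v where v: "v \<in> borel_measurable borel" "\<And>x. x \<notin> \<Omega> \<Longrightarrow> v x = 0"
      "AE x in lebesgue. u x = v x" "v \<in> W" using W_borel[OF \<open>u \<in> W\<close>] by blast
    have Dv: "v y = 0 \<and> norm (x - y) \<le> 5 * R" if "v x \<noteq> 0" "y \<in> B" for x y
    proof -
      have "x \<in> \<Omega>" using that v(2) by blast
      then have "norm x \<le> R" by (rule R(2))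
      then show ?thesis using B[OF that(2)] v(2)[of y] norm_triangle_ineq4[of x y] by auto
    qed
    have "ennreal C1 * ((\<integral>\<^sup>+x. ennreal (\<bar>v x\<bar> powr p) \<partial>lborel) * ennreal b) \<le> ennreal C1 * (ennreal ((5
        * R) powr (real DIM('a) + p * s)) * gag v)"
      using poincare_gagliardo[OF v(1) Bm Dv, where \<gamma>="real DIM('a) + p * s" and p=p] order_pos(1)
          unfolding eb[symmetric]
      by (intro mult_left_mono) auto
    also have "\<dots> = ennreal ((5 * R) powr (real DIM('a) + p * s)) * (ennreal C1 * gag v)" by (simp add: ac_simps)
    also have "\<dots> \<le> ennreal ((5 * R) powr (real DIM('a) + p * s)) * ennreal (kin v)"
      by (intro mult_left_mono gagliardo_le_kin W_D[OF v(4)]) auto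
    also have "(\<integral>\<^sup>+x. ennreal (\<bar>v x\<bar> powr p) \<partial>lborel) = ennreal (LINT x|lebesgue. \<bar>v x\<bar> powr p)"
      using W_D(2)[OF v(4)] by (subst nn_integral_completion[symmetric], intro nn_integral_eq_integral) auto
    finally have "ennreal (C1 * (LINT x|lebesgue. \<bar>v x\<bar> powr p) * b) \<le> ennreal ((5
        * R) powr (real DIM('a) + p * s) * kin v)"
      using C1 b kin_nonneg[of v] by (simp add: ennreal_mult[symmetric] integral_nonneg_AE mult.assoc)
    then have "C1 * (LINT x|lebesgue. \<bar>v x\<bar> powr p) * b \<le> (5 * R) powr (real DIM('a) + p * s) * kin v"
      using kin_nonneg[of v] by (subst (asm) ennreal_le_iff) auto
    then have "(LINT x|lebesgue. \<bar>v x\<bar> powr p) \<le> P * kin v" unfolding P_def using C1 b by (simp add: field_simps)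
    moreover have "(LINT x|lebesgue. \<bar>v x\<bar> powr p) = (LINT x|lebesgue. \<bar>u x\<bar> powr p)"
      using W_D(1)[OF v(4)] W_D(1)[OF \<open>u \<in> W\<close>] v(3)
      by (intro integral_cong_AE) (auto elim: eventually_mono)
    ultimately show ?thesis using kin_cong_AE[OF \<open>u \<in> W\<close> v(3)] by simp
  qed
  then show ?thesis using P by blast
qed


section \<open>Potential energy\<close>

lemma good_set:
  obtains G where "G \<in> sets \<mu>" "G \<subseteq> \<Omega>" "AE x in \<mu>. x \<in> G"
    "\<And>x. x \<in> G \<Longrightarrow> continuous_on UNIV (h x)" "\<And>x. x \<in> G \<Longrightarrow> mono (h x)"
    "\<And>x t. x \<in> G \<Longrightarrow> 0 \<le> h x t" "\<And>x t. x \<in> G \<Longrightarrow> h x t \<le> C0 * (1 + \<bar>t\<bar> powr (q - 1))"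
proof -
  have "AE x in \<mu>. continuous_on UNIV (h x)" using carath unfolding caratheodory_def by blast
  then have ae: "AE x in \<mu>. continuous_on UNIV (h x) \<and> mono (h x) \<and> (\<forall>t. h x t \<le> C0 * (1 + \<bar>t\<bar> powr (q - 1)))"
    using h_mono h_growth by eventually_elim blast
  obtain N where N: "{x \<in> space \<mu>. \<not> (continuous_on UNIV (h x) \<and> mono (h x) \<and> (\<forall>t. h x t \<le> C0 * (1
      + \<bar>t\<bar> powr (q - 1))))} \<subseteq> N"
     "emeasure \<mu> N = 0" "N \<in> sets \<mu>"
    by (rule AE_E[OF ae])
  then have N0: "N \<in> null_sets \<mu>" by (simp add: null_sets_def)
  define G where "G = space \<mu> - N"
  have "G \<in> sets \<mu>" unfolding G_def using N(3) by auto
  moreover have "G \<subseteq> \<Omega>" unfolding G_def by (auto simp: space_restrict_space)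
  moreover have "AE x in \<mu>. x \<in> G"
    using AE_not_in[OF N0] AE_space by eventually_elim (simp add: G_def)
  moreover have "continuous_on UNIV (h x) \<and> mono (h x) \<and> (\<forall>t. h x t \<le> C0 * (1 + \<bar>t\<bar> powr (q - 1)))" if "x
      \<in> G" for x
    using that N(1) unfolding G_def by blast
  moreover have "0 \<le> h x t" if "x \<in> G" for x t using h_nonneg calculation(2) that by blast
  ultimately show ?thesis using that by blast
qed

lemma primitive_0: "primitive h x 0 = 0"
  unfolding primitive_def zero_ereal_def[symmetric] by simp

text \<open>The lower bound is linear although the growth has power q: for \<open>t < 0\<close>
  monotonicity bounds \<open>h x\<close> on the interval by \<open>h x 0\<close>, which is at most
  \<open>C0\<close>, and for \<open>t > 0\<close> the primitive is nonnegative. Linear growth is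
  what lets the kinetic term absorb \<open>- pot\<close>. The cruder power p in the second bound is
  the one integrable on \<open>W\<close>.\<close>

lemma primitive_bounds:
  assumes cont: "continuous_on UNIV (h x)" and mono: "mono (h x)"
    and nonneg: "\<And>t. 0 \<le> h x t" and growth: "\<And>t. h x t \<le> C0 * (1 + \<bar>t\<bar> powr (q - 1))"
  shows "- (C0 * \<bar>t\<bar>) \<le> primitive h x t" "\<bar>primitive h x t\<bar> \<le> 2 * C0 * (1 + \<bar>t\<bar> powr p)"
proof -
  have pq: "\<bar>t\<bar> powr q \<le> 1 + \<bar>t\<bar> powr p"
  proof (cases "\<bar>t\<bar> \<le> 1")
    case True
    then have "\<bar>t\<bar> powr q \<le> 1" using q by (intro powr_le1) auto
    then show ?thesis by (simp add: add_increasing2)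
  next
    case False
    then have "\<bar>t\<bar> powr q \<le> \<bar>t\<bar> powr p" using q by (intro powr_mono) auto
    then show ?thesis by simp
  qed
  have t1: "\<bar>t\<bar> \<le> 1 + \<bar>t\<bar> powr p" using young_powr[of "\<bar>t\<bar>" 1 p] p by simp
  have C0t: "C0 * \<bar>t\<bar> \<le> C0 * (1 + \<bar>t\<bar> powr p)" using t1 C0 by (intro mult_left_mono) auto
  have C0t': "0 \<le> C0 * \<bar>t\<bar>" using C0 by simp
  have nn: "0 \<le> C0 * (1 + \<bar>t\<bar> powr p)" using C0 by simp
  consider "t = 0" | "0 < t" | "t < 0" by linarith
  then have "- (C0 * \<bar>t\<bar>) \<le> primitive h x t \<and> \<bar>primitive h x t\<bar> \<le> 2 * C0 * (1 + \<bar>t\<bar> powr p)"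
  proof cases
    case 1
    then show ?thesis using nn by (simp add: primitive_0)
  next
    case 2
    obtain z where z: "0 < z" "z < t" "primitive h x t - primitive h x 0 = (t - 0) * h x z"
      using MVT2[OF 2, of "primitive h x" "h x"] DERIV_primitive[of h x, OF cont] by blast
    have e: "primitive h x t = t * h x z" using z(3) by (simp add: primitive_0)
    have "z powr (q - 1) \<le> t powr (q - 1)" using z q by (intro powr_mono2) auto
    then have "C0 * (1 + \<bar>z\<bar> powr (q - 1)) \<le> C0 * (1 + t powr (q - 1))" using z C0 by (intro mult_left_mono) auto
    then have "t * h x z \<le> t * (C0 * (1 + t powr (q - 1)))"
      using growth[of z] 2 by (intro mult_left_mono) auto
    also have "\<dots> = C0 * (t + t * t powr (q - 1))" by (simp only: distrib_left mult_1_right mult.commute mult.left_commute)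
    also have "\<dots> = C0 * (t + t powr q)" using 2 by (simp add: powr_mult_base)
    also have "\<dots> \<le> C0 * (2 * (1 + \<bar>t\<bar> powr p))" using pq t1 C0 2 by (intro mult_left_mono) auto
    also have "\<dots> = 2 * C0 * (1 + \<bar>t\<bar> powr p)" by simp
    finally have "t * h x z \<le> 2 * C0 * (1 + \<bar>t\<bar> powr p)" .
    moreover have "0 \<le> t * h x z" using nonneg[of z] 2 by simp
    ultimately show ?thesis unfolding e using C0t' by linarith
  next
    case 3
    obtain z where z: "t < z" "z < 0" "primitive h x 0 - primitive h x t = (0 - t) * h x z"
      using MVT2[OF 3, of "primitive h x" "h x"] DERIV_primitive[of h x, OF cont] by blast
    have e: "primitive h x t = - (\<bar>t\<bar> * h x z)" using z(3) 3 by (simp add: primitive_0)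
    have "h x z \<le> h x 0" using monoD[OF mono, of z 0] z by simp
    also have "\<dots> \<le> C0" using growth[of 0] by simp
    finally have "\<bar>t\<bar> * h x z \<le> \<bar>t\<bar> * C0" by (intro mult_left_mono) auto
    moreover have "0 \<le> \<bar>t\<bar> * h x z" using nonneg by simp
    moreover have "\<bar>t\<bar> * C0 = C0 * \<bar>t\<bar>" by simp
    moreover have "2 * C0 * (1 + \<bar>t\<bar> powr p) = C0 * (1 + \<bar>t\<bar> powr p) + C0 * (1 + \<bar>t\<bar> powr p)" by simp
    ultimately show ?thesis unfolding e using C0t nn by linarith
  qed
  then show "- (C0 * \<bar>t\<bar>) \<le> primitive h x t" "\<bar>primitive h x t\<bar> \<le> 2 * C0 * (1 + \<bar>t\<bar> powr p)" by auto
qed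

lemma primitive_AE:
  "AE x in \<mu>. (\<forall>t. - (C0 * \<bar>t\<bar>) \<le> primitive h x t \<and> \<bar>primitive h x t\<bar> \<le> 2 * C0 * (1 + \<bar>t\<bar> powr p)) \<and>
     (\<forall>t. (primitive h x has_real_derivative h x t) (at t)) \<and> mono (h x)"
proof -
  obtain G where G: "AE x in \<mu>. x \<in> G"
    "\<And>x. x \<in> G \<Longrightarrow> continuous_on UNIV (h x)" "\<And>x. x \<in> G \<Longrightarrow> mono (h x)"
    "\<And>x t. x \<in> G \<Longrightarrow> 0 \<le> h x t" "\<And>x t. x \<in> G \<Longrightarrow> h x t \<le> C0 * (1 + \<bar>t\<bar> powr (q - 1))"
    using good_set by metis
  from G(1) show ?thesis
  proof eventually_elim
    case (elim x)
    show ?case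
      using primitive_bounds[OF G(2)[OF elim] G(3)[OF elim] G(4)[OF elim] G(5)[OF elim]]
        G(3)[OF elim] DERIV_primitive[of h x, OF G(2)[OF elim]] by blast
  qed
qed

lemma primitive_comp_measurable:
  assumes u: "u \<in> borel_measurable \<mu>"
  shows "(\<lambda>x. primitive h x (u x)) \<in> borel_measurable \<mu>"
proof -
  obtain G where G: "G \<in> sets \<mu>" "AE x in \<mu>. x \<in> G"
    "\<And>x. x \<in> G \<Longrightarrow> continuous_on UNIV (h x)"
    using good_set by metis
  note [measurable] = G(1)
  \<comment> \<open>\<open>primitive_measurable\<close> asks for continuity at every point of the
    space. Setting \<open>h\<close> to 0 off the set \<open>G\<close> of full measure achieves this
    and changes the primitive only on a null set.\<close>
  define h' where "h' x t = (if x \<in> G then h x t else 0)" for x t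
  have hm: "(\<lambda>x. h x t) \<in> borel_measurable \<mu>" for t
    using carath unfolding caratheodory_def by blast
  have h'm: "(\<lambda>x. h' x t) \<in> borel_measurable \<mu>" for t
    unfolding h'_def using hm[of t] by measurable
  have h'c: "continuous_on UNIV (h' x)" for x
  proof (cases "x \<in> G")
    case True
    then have "h' x = h x" by (auto simp: h'_def)
    then show ?thesis using G(3)[OF True] by simp
  next
    case False
    then have "h' x = (\<lambda>t. 0)" by (auto simp: h'_def)
    then show ?thesis by simp
  qed
  have "(\<lambda>x. primitive h' x (u x)) \<in> borel_measurable \<mu>"
    by (rule primitive_measurable[OF h'm h'c u])
  moreover have "AE x in \<mu>. primitive h x (u x) = primitive h' x (u x)"
    using G(2) by eventually_elim (simp add: primitive_def h'_def)
  ultimately show ?thesis by (rule lebesgue_on_measurable_cong_AE[OF \<Omega>_sets(2)])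
qed

lemma primitive_integrable:
  assumes "u \<in> W"
  shows "integrable \<mu> (\<lambda>x. primitive h x (u x))"
proof (rule Bochner_Integration.integrable_bound)
  show "integrable \<mu> (\<lambda>x. 2 * C0 * (1 + \<bar>u x\<bar> powr p))" using W_D(7)[OF assms] by simp
  show "AE x in \<mu>. norm (primitive h x (u x)) \<le> norm (2 * C0 * (1 + \<bar>u x\<bar> powr p))"
    using primitive_AE
  proof eventually_elim
    case (elim x)
    then have "norm (primitive h x (u x)) \<le> 2 * C0 * (1 + \<bar>u x\<bar> powr p)" by simp
    then show ?case using abs_ge_self order_trans unfolding real_norm_def by blast
  qed
qed (rule primitive_comp_measurable[OF W_D(6)[OF assms]])

text \<open>The p-th power in the energy undoes the root in \<open>K_norm\<close>, by nonnegativity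
  of \<open>kin\<close>. This isolates the part linear in \<open>g\<close> from the functional
  \<open>J\<close>, which is independent of \<open>g\<close>.\<close>

lemma energy_eq:
  assumes u: "u \<in> W" and g: "g \<in> Linfty \<Omega>"
  shows "integrable \<mu> (\<lambda>x. g x * u x)"
    and "E g u = (LINT x|\<mu>. g x * u x) - J u"
proof -
  obtain C where gm: "g \<in> borel_measurable \<mu>" and C: "AE x in \<mu>. \<bar>g x\<bar> \<le> C"
    using g unfolding Linfty_def by blast
  show int: "integrable \<mu> (\<lambda>x. g x * u x)"
  proof (rule Bochner_Integration.integrable_bound)
    show "integrable \<mu> (\<lambda>x. C * u x)" using W_D(8)[OF u] by simp
    show "AE x in \<mu>. norm (g x * u x) \<le> norm (C * u x)"
      using C by eventually_elim (auto simp: abs_mult intro!: mult_right_mono)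
  qed (use gm W_D(6)[OF u] in measurable)
  have "(\<lambda>(x, y). \<bar>u x - u y\<bar> powr p * K x y) = kin_density u"
    by (auto simp: kin_density_def fun_eq_iff)
  then have "K_norm K p u = kin u powr (1 / p)" unfolding K_norm_def kin_def by simp
  then have "K_norm K p u powr p = kin u" using kin_nonneg[of u] p by (simp add: powr_powr)
  then show "E g u = (LINT x|\<mu>. g x * u x) - J u"
    unfolding energy_def J_def pot_def using int primitive_integrable[OF u] by simp
qed

section \<open>Coercivity, compactness and existence of maximizers\<close>

lemma integral_on_le:
  fixes f :: "'a \<Rightarrow> real"
  assumes "integrable lebesgue f" "\<And>x. 0 \<le> f x"
  shows "(LINT x|\<mu>. f x) \<le> (LINT x|lebesgue. f x)"
proof -
  have "(LINT x|\<mu>. f x) = (LINT x|lebesgue. indicator \<Omega> x * f x)"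
    by (subst integral_restrict_space) auto
  also have "\<dots> \<le> (LINT x|lebesgue. f x)"
    using integrable_mult_indicator[OF \<Omega>_sets(2) assms(1)] assms
    by (intro integral_mono) (auto simp: indicator_def)
  finally show ?thesis .
qed

lemma integral_abs_le_kin:
  assumes "0 < b"
  shows "\<exists>A. \<forall>u\<in>W. b * (LINT x|\<mu>. \<bar>u x\<bar>) \<le> A + kin u / (2 * p)"
proof -
  obtain P where P: "0 < P" "\<And>u. u \<in> W \<Longrightarrow> (LINT x|lebesgue. \<bar>u x\<bar> powr p) \<le> P * kin u" using poincare by blast
  \<comment> \<open>\<open>e\<close> solves \<open>e powr (1 - p) = 1 / X\<close>, and
    \<open>X\<close> is tuned so that Young's bound followed by the Poincare inequality yields
    \<open>kin u / (2 * p)\<close>: half of the kinetic part of \<open>J\<close>, the other half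
    remaining for coercivity.\<close>
  define X where "X = 2 * p * b * P"
  have X: "0 < X" unfolding X_def using p assms P by simp
  define e where "e = X powr (1 / (p - 1))"
  have e: "0 < e" unfolding e_def using X by simp
  have "1 / (p - 1) * (1 - p) = - 1" using p by (simp add: field_simps)
  then have ep: "e powr (1 - p) = 1 / X" unfolding e_def powr_powr using X by (simp add: powr_minus_divide)
  define m where "m = measure \<mu> \<Omega>"
  have "b * (LINT x|\<mu>. \<bar>u x\<bar>) \<le> b * e * m + kin u / (2 * p)" if u: "u \<in> W" for u
  proof -
    note u' = W_D[OF u]
    have "(LINT x|\<mu>. \<bar>u x\<bar>) \<le> (LINT x|\<mu>. e + 1 / X * \<bar>u x\<bar> powr p)"
      using u' young_powr[OF _ e p] unfolding ep[symmetric] by (intro integral_mono) auto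
    also have "\<dots> = e * m + 1 / X * (LINT x|\<mu>. \<bar>u x\<bar> powr p)"
      using u'(7) by (simp add: m_def space_restrict_space)
    also have "\<dots> \<le> e * m + 1 / X * (P * kin u)"
      using integral_on_le[OF u'(2)] P(2)[OF u] X by (intro add_left_mono mult_left_mono) (auto intro: order_trans)
    finally have "b * (LINT x|\<mu>. \<bar>u x\<bar>) \<le> b * (e * m + 1 / X * (P * kin u))"
      using assms by (intro mult_left_mono) auto
    also have "\<dots> = b * e * m + kin u / (2 * p)" unfolding X_def using assms P(1) p by (simp add: field_simps)
    finally show ?thesis .
  qed
  then show ?thesis by blast
qed

text \<open>Bounded kinetic energy bounds the seminorm through \<open>C1\<close> and the p-th power
  integral through the Poincare inequality, so Borel representatives have a converging subsequence.
  Fatou puts the pointwise limit into \<open>W\<close>, and applied to differences it turns the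
  L1-Cauchy property into L1 convergence.\<close>

lemma W_compact:
  fixes v :: "nat \<Rightarrow> 'a \<Rightarrow> real"
  assumes vW: "\<And>n. v n \<in> W" and A: "\<And>n. kin (v n) \<le> A"
  shows "\<exists>r w. strict_mono r \<and> w \<in> W \<and> (AE x in lebesgue. (\<lambda>n. v (r n) x) \<longlonglongrightarrow> w x) \<and>
    (\<lambda>n. LINT x|\<mu>. \<bar>v (r n) x - w x\<bar>) \<longlonglongrightarrow> 0"
proof -
  have "\<forall>n. \<exists>v'. v' \<in> borel_measurable borel \<and> (\<forall>x. x \<notin> \<Omega> \<longrightarrow> v' x = 0) \<and>
    (AE x in lebesgue. v n x = v' x) \<and> v' \<in> W" using W_borel[OF vW] by metis
  then obtain v' where v'[measurable]: "\<And>n. v' n \<in> borel_measurable borel"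
    and v'0: "\<And>n x. x \<notin> \<Omega> \<Longrightarrow> v' n x = 0" and veq: "\<And>n. AE x in lebesgue. v n x = v' n x" and v'W: "\<And>n. v' n \<in> W"
    by metis
  have A': "kin (v' n) \<le> A" for n using A[of n] kin_cong_AE[OF vW veq] by simp
  have A0: "0 \<le> A" using A kin_nonneg order_trans by blast
  obtain P where P: "0 < P" "\<And>u. u \<in> W \<Longrightarrow> (LINT x|lebesgue. \<bar>u x\<bar> powr p) \<le> P * kin u" using poincare by blast
  have PA: "(LINT x|lebesgue. \<bar>v' n x\<bar> powr p) \<le> P * A" for n
    using P(2)[OF v'W] mult_left_mono[OF A', of P] P(1) by (meson less_imp_le order_trans)
  define B where "B = max (A / C1) (P * A)"
  have B0: "0 \<le> B" unfolding B_def using A0 C1 by (simp add: le_max_iff_disj)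
  have gB: "gag (v' n) \<le> ennreal B" for n
  proof -
    have "ennreal C1 * gag (v' n) \<le> ennreal (kin (v' n))"
      by (rule gagliardo_le_kin[OF W_D(1,5)[OF v'W]])
    also have "\<dots> \<le> ennreal (C1 * (A / C1))" using A' C1 by (intro ennreal_leI) simp
    also have "\<dots> = ennreal C1 * ennreal (A / C1)" using C1 A0 by (intro ennreal_mult) auto
    finally have "gag (v' n) \<le> ennreal (A / C1)"
      using C1 by (subst (asm) ennreal_mult_le_mult_iff) auto
    also have "\<dots> \<le> ennreal B" unfolding B_def by (intro ennreal_leI) simp
    finally show ?thesis .
  qed
  have pB: "(\<integral>\<^sup>+x. ennreal (\<bar>v' n x\<bar> powr p) \<partial>lborel) \<le> ennreal B" for n
  proof -
    have "(\<integral>\<^sup>+x. ennreal (\<bar>v' n x\<bar> powr p) \<partial>lborel) = ennreal (LINT x|lebesgue. \<bar>v' n x\<bar> powr p)"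
      using W_D(2)[OF v'W] by (subst nn_integral_completion[symmetric], intro nn_integral_eq_integral) auto
    also have "\<dots> \<le> ennreal B" unfolding B_def using PA[of n] by (intro ennreal_leI) simp
    finally show ?thesis .
  qed
  obtain r where int: "\<And>n. integrable lborel (v' n)" and r: "strict_mono r"
    and cau: "AE x in lborel. Cauchy (\<lambda>n. v' (r n) x)"
    and L1: "\<And>e. 0 < e \<Longrightarrow> \<exists>N. \<forall>i\<ge>N. \<forall>j\<ge>N. (LINT x|lborel. \<bar>v' (r i) x - v' (r j) x\<bar>) < e"
    using gagliardo_compactness[where v=v', OF v' \<Omega>_sets(1) bounded_\<Omega> v'0 gB pB B0 p order_pos(2)] by blast
  \<comment> \<open>Off the null set of non-Cauchy points this is the limit. Outside \<Omega> the
    sequence is constantly 0, so \<open>w\<close> vanishes there at every point.\<close>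
  define w where "w x = lim (\<lambda>n. v' (r n) x)" for x
  have wm[measurable]: "w \<in> borel_measurable borel" unfolding w_def by measurable
  have limb: "AE x in lborel. (\<lambda>n. v' (r n) x) \<longlonglongrightarrow> w x"
    using cau by eventually_elim (simp add: w_def real_Cauchy_convergent convergent_LIMSEQ_iff[symmetric])
  then have lim: "AE x in lebesgue. (\<lambda>n. v' (r n) x) \<longlonglongrightarrow> w x" by (simp add: AE_completion_iff)
  have w0: "w x = 0" if "x \<notin> \<Omega>" for x unfolding w_def using v'0[OF that] by simp
  have wleb: "w \<in> borel_measurable lebesgue" using measurable_completion[of w lborel borel] wm by simp
  have "integrable lebesgue (\<lambda>x. \<bar>w x\<bar> powr p)"
  proof (rule Fatou_real(1)[where f="\<lambda>n x. \<bar>v' (r n) x\<bar> powr p"])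
    show "integrable lebesgue (\<lambda>x. \<bar>v' (r n) x\<bar> powr p)" for n by (rule W_D(2)[OF v'W])
    show "AE x in lebesgue. (\<lambda>n. \<bar>v' (r n) x\<bar> powr p) \<longlonglongrightarrow> \<bar>w x\<bar> powr p"
      using lim by eventually_elim (rule isCont_tendsto_compose[OF isCont_abs_powr])
    show "(LINT x|lebesgue. \<bar>v' (r n) x\<bar> powr p) \<le> P * A" for n by (rule PA)
  qed (use wleb in auto)
  moreover have "integrable lebesgue (kin_density w)"
  proof (rule Fatou_real(1)[where f="\<lambda>n. kin_density (v' (r n))"])
    show "integrable lebesgue (kin_density (v' (r n)))" for n by (rule W_D(5)[OF v'W])
    show "AE z in lebesgue. 0 \<le> kin_density (v' (r n)) z" for n
      using kin_density_bounds[of "v' (r n)"] by eventually_elim auto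
    show "AE z in lebesgue. (\<lambda>n. kin_density (v' (r n)) z) \<longlonglongrightarrow> kin_density w z"
      by (rule kin_density_tendsto[OF lim])
    show "integral\<^sup>L lebesgue (kin_density (v' (r n))) \<le> A" for n using A' unfolding kin_def .
  qed (rule kin_density_measurable[OF wleb])
  ultimately have wW: "w \<in> W" unfolding W_iff using wleb gagliardo_finite w0 by auto
  have "AE x in lebesgue. \<forall>n. v n x = v' n x" using veq by (simp add: AE_all_countable)
  then have limv: "AE x in lebesgue. (\<lambda>n. v (r n) x) \<longlonglongrightarrow> w x" using lim by eventually_elim simp
  have "\<exists>N. \<forall>n\<ge>N. norm ((LINT x|\<mu>. \<bar>v (r n) x - w x\<bar>) - 0) < e" if "0 < e" for e
  proof -
    obtain N where N: "\<And>i j. i \<ge> N \<Longrightarrow> j \<ge> N \<Longrightarrow> (LINT x|lborel. \<bar>v' (r i) x - v' (r j) x\<bar>) < e / 2"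
      using L1[of "e / 2"] \<open>0 < e\<close> by auto
    have "(LINT x|\<mu>. \<bar>v (r i) x - w x\<bar>) < e" if "i \<ge> N" for i
    proof -
      \<comment> \<open>The shift by \<open>N\<close> makes the bound \<open>e / 2\<close> hold for
        every index, as Fatou requires.\<close>
      have lim_i: "AE x in lborel. (\<lambda>j. \<bar>v' (r i) x - v' (r (j + N)) x\<bar>) \<longlonglongrightarrow> \<bar>v' (r i) x - w x\<bar>"
        using limb by eventually_elim (intro tendsto_rabs tendsto_diff tendsto_const LIMSEQ_ignore_initial_segment)
      have fa: "integrable lborel (\<lambda>x. \<bar>v' (r i) x - w x\<bar>)" "(LINT x|lborel. \<bar>v' (r i) x - w x\<bar>) \<le> e / 2"
        using Fatou_real(1,4)[where f="\<lambda>j x. \<bar>v' (r i) x - v' (r (j + N)) x\<bar>" and M=lborel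
            and A="e / 2", OF _ _ lim_i]
          less_imp_le[OF N[OF that]] int by (simp_all del: le_divide_eq_numeral1)
      have "(LINT x|\<mu>. \<bar>v (r i) x - w x\<bar>) = (LINT x|\<mu>. \<bar>v' (r i) x - w x\<bar>)"
        using veq[of "r i"] W_D(6)[OF vW] W_D(6)[OF v'W] W_D(6)[OF wW]
        by (intro integral_cong_AE) (auto simp: AE_on_iff elim!: eventually_mono)
      also have "\<dots> \<le> (LINT x|lebesgue. \<bar>v' (r i) x - w x\<bar>)"
        using fa(1) by (intro integral_on_le) (auto simp: integrable_completion)
      also have "\<dots> = (LINT x|lborel. \<bar>v' (r i) x - w x\<bar>)" by (intro integral_completion) measurable
      finally show ?thesis using fa(2) \<open>0 < e\<close> by linarith
    qed
    then show ?thesis by (intro exI[of _ N]) (auto simp: integral_nonneg_AE)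
  qed
  then have "(\<lambda>n. LINT x|\<mu>. \<bar>v (r n) x - w x\<bar>) \<longlonglongrightarrow> 0" by (intro LIMSEQ_I) blast
  then show ?thesis using r wW limv by blast
qed


lemma neg_pot_le:
  assumes "u \<in> W"
  shows "- pot u \<le> C0 * (LINT x|\<mu>. \<bar>u x\<bar>)"
proof -
  have "(LINT x|\<mu>. - (C0 * \<bar>u x\<bar>)) \<le> pot u"
    unfolding pot_def using primitive_integrable[OF assms] W_D(8)[OF assms] primitive_AE
    by (intro integral_mono_AE) (auto elim!: eventually_mono)
  then show ?thesis by simp
qed

text \<open>The primitive may be negative, so Fatou is applied after adding
  \<open>C0 * \<bar>u x\<bar>\<close>; the integral of the added term converges by L1 convergence
  and can be subtracted again. The kinetic part gets the tolerance \<open>p * e / 3\<close> because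
  \<open>J\<close> divides it by p.\<close>

lemma J_lower_semicontinuous:
  assumes v: "\<And>n. v n \<in> W" and w: "w \<in> W" and A: "\<And>n. kin (v n) \<le> A"
    and lim: "AE x in lebesgue. (\<lambda>n. v n x) \<longlonglongrightarrow> w x"
    and L1: "(\<lambda>n. LINT x|\<mu>. \<bar>v n x - w x\<bar>) \<longlonglongrightarrow> 0" and e: "0 < e"
  shows "eventually (\<lambda>n. J w - e < J (v n)) sequentially"
proof -
  have L1': "(\<lambda>n. LINT x|\<mu>. \<bar>v n x\<bar>) \<longlonglongrightarrow> (LINT x|\<mu>. \<bar>w x\<bar>)"
  proof (rule Lim_null[THEN iffD2], rule Lim_null_comparison[OF _ L1], intro always_eventually allI)
    fix n
    note i = W_D(8)[OF v[of n]] W_D(8)[OF w]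
    have "norm ((LINT x|\<mu>. \<bar>v n x\<bar>) - (LINT x|\<mu>. \<bar>w x\<bar>)) = norm (LINT x|\<mu>. \<bar>v n x\<bar> - \<bar>w x\<bar>)"
      using i by simp
    also have "\<dots> \<le> (LINT x|\<mu>. norm (\<bar>v n x\<bar> - \<bar>w x\<bar>))" by (rule integral_norm_bound)
    also have "\<dots> \<le> (LINT x|\<mu>. \<bar>v n x - w x\<bar>)" using i by (intro integral_mono) auto
    finally show "norm ((LINT x|\<mu>. \<bar>v n x\<bar>) - (LINT x|\<mu>. \<bar>w x\<bar>)) \<le> (LINT x|\<mu>. \<bar>v n x - w x\<bar>)" .
  qed
  obtain A1 where A1: "\<And>u. u \<in> W \<Longrightarrow> C0 * (LINT x|\<mu>. \<bar>u x\<bar>) \<le> A1 + kin u / (2 * p)"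
    using integral_abs_le_kin[OF C0] by blast
  obtain P where P: "0 < P" "\<And>u. u \<in> W \<Longrightarrow> (LINT x|lebesgue. \<bar>u x\<bar> powr p) \<le> P * kin u" using poincare by blast
  define m where "m = measure \<mu> \<Omega>"
  define f where "f u x = primitive h x (u x) + C0 * \<bar>u x\<bar>" for u :: "'a \<Rightarrow> real" and x
  have fi: "integrable \<mu> (f u)" "(LINT x|\<mu>. f u x) = pot u + C0 * (LINT x|\<mu>. \<bar>u x\<bar>)" if "u \<in> W" for u
    unfolding f_def pot_def using primitive_integrable[OF that] W_D(8)[OF that] by auto
  have fb: "(LINT x|\<mu>. f (v n) x) \<le> 2 * C0 * (m + P * A) + (A1 + A / (2 * p))" for n
  proof -
    have "pot (v n) \<le> (LINT x|\<mu>. 2 * C0 * (1 + \<bar>v n x\<bar> powr p))"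
      unfolding pot_def using primitive_integrable[OF v] W_D(7)[OF v] primitive_AE
      by (intro integral_mono_AE) (auto elim!: eventually_mono dest: abs_le_D1)
    also have "\<dots> = 2 * C0 * (m + (LINT x|\<mu>. \<bar>v n x\<bar> powr p))"
      using W_D(7)[OF v] by (simp add: m_def space_restrict_space)
    also have "\<dots> \<le> 2 * C0 * (m + P * A)"
    proof -
      have "(LINT x|\<mu>. \<bar>v n x\<bar> powr p) \<le> P * kin (v n)"
        using integral_on_le[OF W_D(2)[OF v]] P(2)[OF v] by (auto intro: order_trans)
      also have "\<dots> \<le> P * A" using P(1) A by (intro mult_left_mono) auto
      finally show ?thesis using C0 by (intro mult_left_mono) auto
    qed
    finally have 1: "pot (v n) \<le> 2 * C0 * (m + P * A)" .
    have "kin (v n) / (2 * p) \<le> A / (2 * p)" using A p by (intro divide_right_mono) auto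
    then show ?thesis using 1 A1[OF v[of n]] unfolding fi(2)[OF v] by linarith
  qed
  have limO: "AE x in \<mu>. (\<lambda>n. v n x) \<longlonglongrightarrow> w x"
    using lim unfolding AE_on_iff by eventually_elim simp
  have f_lim: "AE x in \<mu>. (\<lambda>n. f (v n) x) \<longlonglongrightarrow> f w x"
    using limO primitive_AE
  proof eventually_elim
    case (elim x)
    then have "isCont (primitive h x) (w x)" using DERIV_isCont by blast
    then show ?case unfolding f_def using elim(1)
      by (intro tendsto_add tendsto_mult tendsto_const tendsto_rabs isCont_tendsto_compose[of "w x"
          "primitive h x"])
  qed
  have ev1: "eventually (\<lambda>n. (LINT x|\<mu>. f w x) - e / 3 < (LINT x|\<mu>. f (v n) x)) sequentially"
  proof (rule Fatou_real(3)[OF fi(1)[OF v] _ f_lim _ fb])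
    show "AE x in \<mu>. 0 \<le> f (v n) x" for n
      using primitive_AE
    proof eventually_elim
      case (elim x)
      then have "- (C0 * \<bar>v n x\<bar>) \<le> primitive h x (v n x)" by blast
      then show ?case unfolding f_def by linarith
    qed
    show "f w \<in> borel_measurable \<mu>" using fi(1)[OF w] by auto
  qed (use e in auto)
  have ev2: "eventually (\<lambda>n. kin w - p * e / 3 < kin (v n)) sequentially"
    unfolding kin_def
  proof (rule Fatou_real(3)[where f="\<lambda>n. kin_density (v n)"])
    show "AE z in lebesgue. (\<lambda>n. kin_density (v n) z) \<longlonglongrightarrow> kin_density w z"
      by (rule kin_density_tendsto[OF lim])
    show "AE z in lebesgue. 0 \<le> kin_density (v n) z" for n
      using kin_density_bounds[of "v n"] by eventually_elim auto
    show "integral\<^sup>L lebesgue (kin_density (v n)) \<le> A" for n using A unfolding kin_def .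
  qed (use W_D(5)[OF v] kin_density_measurable[OF W_D(1)[OF w]] p e in auto)
  have ev3: "eventually (\<lambda>n. C0 * (LINT x|\<mu>. \<bar>v n x\<bar>) < C0 * (LINT x|\<mu>. \<bar>w x\<bar>) + e / 3) sequentially"
    using tendsto_mult[OF tendsto_const L1', of C0] by (rule order_tendstoD(2)) (use e in simp)
  show ?thesis using ev1 ev2 ev3
  proof eventually_elim
    case (elim n)
    have "(kin w - p * e / 3) / p < kin (v n) / p" using elim(2) p by (intro divide_strict_right_mono) auto
    then have "kin w / p - e / 3 < kin (v n) / p" using p by (simp add: diff_divide_distrib)
    then show ?case using elim(1,3) unfolding J_def fi(2)[OF v] fi(2)[OF w] by linarith
  qed
qed

text \<open>Direct method: by the Lipschitz bound \<open>M\<close> grows at most linearly in the L1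
  norm, so half of the kinetic term absorbs both \<open>M\<close> and \<open>- pot\<close>, and a
  maximizing sequence has bounded kinetic energy. The lemma is stated for a general \<open>M\<close>
  to cover both the pairing with a fixed g and the supremum of the pairings over all
  rearrangements.\<close>

lemma attainment:
  fixes M :: "('a \<Rightarrow> real) \<Rightarrow> real"
  assumes lip: "\<And>u v. u \<in> W \<Longrightarrow> v \<in> W \<Longrightarrow> \<bar>M u - M v\<bar> \<le> B * (LINT x|\<mu>. \<bar>u x - v x\<bar>)"
    and B: "0 \<le> B"
  shows "\<exists>u\<in>W. \<forall>v\<in>W. M v - J v \<le> M u - J u"
proof -
  obtain A where A: "\<And>u. u \<in> W \<Longrightarrow> (B + C0) * (LINT x|\<mu>. \<bar>u x\<bar>) \<le> A + kin u / (2 * p)"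
    using integral_abs_le_kin[of "B + C0"] B C0 by auto
  define T where "T = M (\<lambda>x. 0) + A"
  have coercive: "M u - J u \<le> T - kin u / (2 * p)" if "u \<in> W" for u
  proof -
    have "M u \<le> M (\<lambda>x. 0) + B * (LINT x|\<mu>. \<bar>u x\<bar>)" using lip[OF that zero_W] by simp
    then have "M u - J u \<le> M (\<lambda>x. 0) + (B + C0) * (LINT x|\<mu>. \<bar>u x\<bar>) - kin u / p"
      using neg_pot_le[OF that] unfolding J_def by (simp add: algebra_simps)
    moreover have "kin u / p = kin u / (2 * p) + kin u / (2 * p)" using p by (simp add: field_simps)
    ultimately show ?thesis using A[OF that] unfolding T_def by linarith
  qed
  have upper: "M u - J u \<le> T" if "u \<in> W" for u
  proof -
    have "0 \<le> kin u / (2 * p)" using kin_nonneg p by simp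
    then show ?thesis using coercive[OF that] by linarith
  qed
  define S where "S = (SUP u\<in>W. M u - J u)"
  have bdd: "bdd_above ((\<lambda>u. M u - J u) ` W)" by (rule bdd_aboveI2) (rule upper)
  have leS: "M u - J u \<le> S" if "u \<in> W" for u unfolding S_def using bdd that by (rule cSUP_upper2) simp
  have "\<exists>u\<in>W. S - inverse (real (Suc n)) < M u - J u" for n
  proof -
    have "S - inverse (real (Suc n)) < S" by simp
    then show ?thesis unfolding S_def by (subst (asm) less_cSUP_iff[OF _ bdd]) (use zero_W in auto)
  qed
  then obtain v where v: "\<And>n. v n \<in> W" "\<And>n. S - inverse (real (Suc n)) < M (v n) - J (v n)" by metis
  \<comment> \<open>Obtained from \<open>S - 1 < T - kin (v n) / (2 * p)\<close>, the coercivity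
    bound along the maximizing sequence.\<close>
  define A2 where "A2 = (T - S + 1) * (2 * p)"
  have kinA: "kin (v n) \<le> A2" for n
  proof -
    have "inverse (real (Suc n)) \<le> 1" by (simp add: field_simps)
    then have "kin (v n) / (2 * p) \<le> T - S + 1" using v(2)[of n] coercive[OF v(1)[of n]] by linarith
    then show ?thesis unfolding A2_def using p by (simp add: field_simps)
  qed
  obtain r w where r: "strict_mono r" and w: "w \<in> W" and lim: "AE x in lebesgue. (\<lambda>n. v (r n) x) \<longlonglongrightarrow> w x"
    and L1: "(\<lambda>n. LINT x|\<mu>. \<bar>v (r n) x - w x\<bar>) \<longlonglongrightarrow> 0"
    using W_compact[of v A2, OF v(1) kinA] by (elim exE conjE) (rule that)
  have "S \<le> M w - J w + e" if "0 < e" for e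
  proof -
    have ev1: "eventually (\<lambda>n. J w - e / 3 < J (v (r n))) sequentially"
      by (rule J_lower_semicontinuous[OF v(1) w kinA lim L1]) (use that in simp)
    have "(\<lambda>n. B * (LINT x|\<mu>. \<bar>v (r n) x - w x\<bar>)) \<longlonglongrightarrow> B * 0"
      by (rule tendsto_mult[OF tendsto_const L1])
    then have ev2: "eventually (\<lambda>n. B * (LINT x|\<mu>. \<bar>v (r n) x - w x\<bar>) < e / 3) sequentially"
      by (rule order_tendstoD(2)) (use that in simp)
    have "(\<lambda>n. inverse (real (Suc n))) \<longlonglongrightarrow> 0" by (rule LIMSEQ_inverse_real_of_nat)
    then have "(\<lambda>n. inverse (real (Suc (r n)))) \<longlonglongrightarrow> 0" by (rule LIMSEQ_subseq_LIMSEQ[unfolded comp_def, OF _ r])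
    then have ev3: "eventually (\<lambda>n. inverse (real (Suc (r n))) < e / 3) sequentially"
      by (rule order_tendstoD(2)) (use that in simp)
    have "eventually (\<lambda>n. S \<le> M w - J w + e) sequentially"
      using ev1 ev2 ev3
    proof eventually_elim
      case (elim n)
      then show ?case using v(2)[of "r n"] lip[OF v(1)[of "r n"] w] by linarith
    qed
    then show ?thesis by simp
  qed
  then have "S \<le> M w - J w" by (rule field_le_epsilon)
  then show ?thesis using w leS by (intro bexI[OF _ w]) (auto intro: order_trans)
qed


section \<open>Differentiability of \<open>J\<close> and uniqueness of the right-hand side\<close>

lemma W_perturb:
  assumes "u \<in> W" "\<phi> \<in> W"
  shows "(\<lambda>x. u x + \<phi> x / c) \<in> W" "(\<lambda>x. u x - \<phi> x / c) \<in> W"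
  using W_add[OF assms(1) W_scale[OF assms(2), of "1 / c"]] W_add[OF assms(1) W_scale[OF assms(2), of "- 1 / c"]]
  by simp_all

text \<open>The integrands are convex and differentiable along the perturbation, so their scaled
  second differences are nonnegative, tend to 0 pointwise and stay below the one with full
  increment. Dominated convergence applies to the potential and to the kinetic part
  separately.\<close>

lemma J_second_difference:
  assumes u: "u \<in> W" and \<phi>: "\<phi> \<in> W"
  shows "(\<lambda>n. real (Suc n) * (J (\<lambda>x. u x + \<phi> x / Suc n) + J (\<lambda>x. u x - \<phi> x / Suc n) - 2 * J u)) \<longlonglongrightarrow> 0"
proof -
  let ?up = "\<lambda>n x. u x + \<phi> x / Suc n" and ?um = "\<lambda>n x. u x - \<phi> x / Suc n"
  note wp = W_perturb[OF u \<phi>]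
  have wp1: "(\<lambda>x. u x + \<phi> x) \<in> W" "(\<lambda>x. u x - \<phi> x) \<in> W" using wp[of 1] by simp_all
  define F where "F n x = real (Suc n) * (primitive h x (?up n x) + primitive h x (?um n x) - 2
      * primitive h x (u x))" for n x
  define Q where "Q n z = real (Suc n) * (kin_density (?up n) z + kin_density (?um n) z - 2
      * kin_density u z)" for n z
  have Fi: "integrable \<mu> (F n)" for n
    unfolding F_def using primitive_integrable[OF wp(1)] primitive_integrable[OF wp(2)] primitive_integrable[OF u] by simp
  have Qi: "integrable lebesgue (Q n)" for n
    unfolding Q_def using W_D(5)[OF wp(1)] W_D(5)[OF wp(2)] W_D(5)[OF u] by simp
  have "(\<lambda>n. LINT x|\<mu>. F n x) \<longlonglongrightarrow> (LINT x|\<mu>. 0)"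
  proof (rule integral_dominated_convergence[where w="\<lambda>x. primitive h x (u x + \<phi> x) + primitive h x (u x
      - \<phi> x) - 2 * primitive h x (u x)"])
    show "AE x in \<mu>. (\<lambda>n. F n x) \<longlonglongrightarrow> 0"
      using primitive_AE
    proof eventually_elim
      case (elim x)
      have d: "(primitive h x has_real_derivative h x t) (at t)" for t using elim by blast
      have m: "a \<le> b \<Longrightarrow> h x a \<le> h x b" for a b using elim by (auto dest: monoD)
      show ?case unfolding F_def by (rule second_difference(3)[OF d m])
    qed
    show "AE x in \<mu>. norm (F n x) \<le> primitive h x (u x + \<phi> x) + primitive h x (u x - \<phi> x) - 2
        * primitive h x (u x)" for n
      using primitive_AE
    proof eventually_elim
      case (elim x)
      have d: "(primitive h x has_real_derivative h x t) (at t)" for t using elim by blast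
      have m: "a \<le> b \<Longrightarrow> h x a \<le> h x b" for a b using elim by (auto dest: monoD)
      show ?case using second_difference(1,2)[OF d m, where a="u x" and b="\<phi> x" and n=n] unfolding F_def by simp
    qed
    show "F n \<in> borel_measurable \<mu>" for n using Fi by auto
  qed (use primitive_integrable[OF wp1(1)] primitive_integrable[OF wp1(2)] primitive_integrable[OF u] in auto)
  moreover have "(LINT x|\<mu>. F n x) = real (Suc n) * (pot (?up n) + pot (?um n) - 2 * pot u)" for n
    unfolding F_def pot_def using primitive_integrable[OF wp(1)] primitive_integrable[OF wp(2)] primitive_integrable[OF u] by simp
  ultimately have 1: "(\<lambda>n. real (Suc n) * (pot (?up n) + pot (?um n) - 2 * pot u)) \<longlonglongrightarrow> 0"
    by simp
  \<comment> \<open>With \<open>a\<close> and \<open>b\<close> the differences of \<open>u\<close>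
    and \<phi> at the two points, the kernel factors out and a one-dimensional second difference of
    the p-th power remains.\<close>
  have Q_alt: "Q n z = real (Suc n) * (\<bar>a + b / Suc n\<bar> powr p + \<bar>a - b / Suc n\<bar> powr p - 2 * \<bar>a\<bar> powr p)
      * K (fst z) (snd z)"
    if "a = u (fst z) - u (snd z)" "b = \<phi> (fst z) - \<phi> (snd z)" for a b n z
  proof -
    have e: "u (fst z) + \<phi> (fst z) / Suc n - (u (snd z) + \<phi> (snd z) / Suc n) = a + b / Suc n"
      "u (fst z) - \<phi> (fst z) / Suc n - (u (snd z) - \<phi> (snd z) / Suc n) = a - b / Suc n"
      unfolding that by (simp_all add: diff_divide_distrib)
    have gen: "N * (X * k + Y * k - 2 * (Z * k)) = N * (X + Y - 2 * Z) * k" for N X Y Z k :: real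
      by (simp add: algebra_simps)
    show ?thesis unfolding Q_def kin_density_def e that(1)[symmetric] by (rule gen)
  qed
  note sd = second_difference[OF DERIV_abs_powr[OF p] mono_sgn_powr[OF p]]
  have "(\<lambda>n. integral\<^sup>L lebesgue (Q n)) \<longlonglongrightarrow> (LINT z|(lebesgue :: ('a \<times> 'a) measure). 0)"
  \<comment> \<open>\<open>Q 0\<close> is the second difference with full increment, since
    \<open>Suc 0 = 1\<close>.\<close>
  proof (rule integral_dominated_convergence[where w="Q 0"])
    show "AE z in lebesgue. (\<lambda>n. Q n z) \<longlonglongrightarrow> 0"
    proof (intro always_eventually allI)
      fix z
      show "(\<lambda>n. Q n z) \<longlonglongrightarrow> 0"
        unfolding Q_alt[OF refl refl] using tendsto_mult[OF sd(3) tendsto_const] by (simp only: mult_zero_left)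
    qed
    show "AE z in lebesgue. norm (Q n z) \<le> Q 0 z" for n
      using kin_density_bounds[of u]
    proof eventually_elim
      case (elim z)
      define a b where "a = u (fst z) - u (snd z)" and "b = \<phi> (fst z) - \<phi> (snd z)"
      have K0: "0 \<le> K (fst z) (snd z)" using elim by blast
      have "0 \<le> Q n z" unfolding Q_alt[OF a_def b_def] by (intro mult_nonneg_nonneg[OF sd(1)] K0)
      moreover have "Q n z \<le> Q 0 z"
        unfolding Q_alt[OF a_def b_def] using sd(2)[of n a b] by (intro mult_right_mono K0) simp
      ultimately show ?case by simp
    qed
  qed (use Qi in auto)
  moreover have "integral\<^sup>L lebesgue (Q n) = real (Suc n) * (kin (?up n) + kin (?um n) - 2 * kin u)" for n
    unfolding Q_def kin_def using W_D(5)[OF wp(1)] W_D(5)[OF wp(2)] W_D(5)[OF u] by simp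
  ultimately have 2: "(\<lambda>n. real (Suc n) * (kin (?up n) + kin (?um n) - 2 * kin u)) \<longlonglongrightarrow> 0"
    by simp
  have "(\<lambda>n. real (Suc n) * (pot (?up n) + pot (?um n) - 2 * pot u)
     + real (Suc n) * (kin (?up n) + kin (?um n) - 2 * kin u) / p) \<longlonglongrightarrow> 0 + 0 / p"
    by (intro tendsto_add 1 tendsto_divide 2 tendsto_const) (use p in simp)
  moreover have "N * (a + b - 2 * c) + N * (d + e - 2 * f) / p = N * ((a + d / p) + (b + e / p) - 2 * (c
      + f / p))" for N a b c d e f :: real
    using p by (simp add: field_simps)
  ultimately show ?thesis unfolding J_def by simp
qed

text \<open>Comparing \<open>g\<close> with \<open>u + \<phi> / n\<close> and \<open>g'\<close> with \<open>u - \<phi> / n\<close> only involves the second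
  difference of \<open>J\<close>, so its derivative is never computed.\<close>

lemma maximizers_same_pairing_le:
  assumes u: "u \<in> W" and g: "g \<in> Linfty \<Omega>" "g' \<in> Linfty \<Omega>" and \<phi>: "\<phi> \<in> W"
    and max: "\<And>v. v \<in> W \<Longrightarrow> E g v \<le> E g u"
      "\<And>v. v \<in> W \<Longrightarrow> E g' v \<le> E g' u"
  shows "(LINT x|\<mu>. g x * \<phi> x) \<le> (LINT x|\<mu>. g' x * \<phi> x)"
proof -
  let ?I = "LINT x|\<mu>. g x * \<phi> x" and ?I' = "LINT x|\<mu>. g' x * \<phi> x"
  note wp = W_perturb[OF u \<phi>]
  have "?I - ?I'
      \<le> real (Suc n) * (J (\<lambda>x. u x + \<phi> x / Suc n) + J (\<lambda>x. u x - \<phi> x / Suc n) - 2 * J u)" for n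
  proof -
    define N where "N = real (Suc n)"
    have N: "0 < N" unfolding N_def by simp
    have "(LINT x|\<mu>. g x * (u x + \<phi> x / N)) = (LINT x|\<mu>. g x * u x) + ?I / N"
      using energy_eq(1)[OF u g(1)] energy_eq(1)[OF \<phi> g(1)] by (simp add: distrib_left)
    then have 1: "?I / N \<le> J (\<lambda>x. u x + \<phi> x / N) - J u"
      using max(1)[OF wp(1)[of N]] unfolding energy_eq(2)[OF wp(1) g(1)] energy_eq(2)[OF u g(1)] by linarith
    have "(LINT x|\<mu>. g' x * (u x - \<phi> x / N)) = (LINT x|\<mu>. g' x * u x) - ?I' / N"
      using energy_eq(1)[OF u g(2)] energy_eq(1)[OF \<phi> g(2)] by (simp add: right_diff_distrib)
    then have 2: "- ?I' / N \<le> J (\<lambda>x. u x - \<phi> x / N) - J u"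
      using max(2)[OF wp(2)[of N]] unfolding energy_eq(2)[OF wp(2) g(2)] energy_eq(2)[OF u g(2)] by linarith
    have "(?I - ?I') / N \<le> J (\<lambda>x. u x + \<phi> x / N) + J (\<lambda>x. u x - \<phi> x / N) - 2 * J u"
      using 1 2 by (simp add: diff_divide_distrib)
    then show ?thesis unfolding N_def[symmetric] using N by (simp add: pos_divide_le_eq mult.commute)
  qed
  then have "?I - ?I' \<le> 0"
    by (intro LIMSEQ_le_const[OF J_second_difference[OF u \<phi>]]) blast
  then show ?thesis by simp
qed

lemma maximizers_same_pairing:
  assumes u: "u \<in> W" and g: "g \<in> Linfty \<Omega>" "g' \<in> Linfty \<Omega>" and \<phi>: "\<phi> \<in> W"
    and max: "\<And>v. v \<in> W \<Longrightarrow> E g v \<le> E g u"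
      "\<And>v. v \<in> W \<Longrightarrow> E g' v \<le> E g' u"
  shows "(LINT x|\<mu>. g x * \<phi> x) = (LINT x|\<mu>. g' x * \<phi> x)"
  using maximizers_same_pairing_le[OF u g \<phi> max] maximizers_same_pairing_le[OF u g(2,1) \<phi> max(2,1)]
  by simp

text \<open>These Lipschitz cutoffs tend to the indicator of a bounded open set as \<open>k\<close>
  grows. They provide enough test functions in \<open>W\<close> to identify a right-hand
  side.\<close>

lemma cutoff_W:
  assumes U: "open U" "U \<subseteq> \<Omega>"
  shows "(\<lambda>x. min 1 (real k * infdist x (- U))) \<in> W"
proof -
  define \<phi> where "\<phi> x = min 1 (real k * infdist x (- U))" for x
  have bU: "bounded U" using bounded_\<Omega> U(2) by (rule bounded_subset)
  have lip: "\<bar>\<phi> x - \<phi> y\<bar> \<le> min 1 (real k * norm (x - y))" for x y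
  proof -
    have "\<bar>infdist x (- U) - infdist y (- U)\<bar> \<le> norm (x - y)"
      using infdist_triangle[of x "- U" y] infdist_triangle[of y "- U" x]
          by (simp add: dist_norm norm_minus_commute)
    then have "real k * \<bar>infdist x (- U) - infdist y (- U)\<bar> \<le> real k * norm (x - y)" by (intro mult_left_mono) auto
    moreover have "real k * \<bar>infdist x (- U) - infdist y (- U)\<bar> = \<bar>real k * infdist x (- U) - real k
        * infdist y (- U)\<bar>"
      by (simp add: right_diff_distrib[symmetric] abs_mult)
    moreover have "0 \<le> real k * infdist x (- U)" "0 \<le> real k * infdist y (- U)" by (simp_all add: infdist_nonneg)
    ultimately show ?thesis unfolding \<phi>_def by (simp add: min_def abs_if split: if_splits)
  qed
  have "continuous_on UNIV \<phi>" unfolding \<phi>_def by (intro continuous_intros)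
  then have m[measurable]: "\<phi> \<in> borel_measurable borel" by (rule borel_measurable_continuous_onI)
  have z: "\<phi> x = 0" if "x \<notin> U" for x unfolding \<phi>_def using that by simp
  have b: "\<bar>\<phi> x\<bar> \<le> indicator U x" for x
    using z[of x] infdist_nonneg[of x "- U"] by (auto simp: \<phi>_def indicator_def)
  have [measurable]: "U \<in> sets borel" using U by auto
  have fin: "emeasure lborel U < \<infinity>" using bU by (rule emeasure_bounded_finite)
  have "integrable lborel (\<lambda>x. \<bar>\<phi> x\<bar> powr p)"
  proof (rule Bochner_Integration.integrable_bound)
    show "integrable lborel (indicator U :: 'a \<Rightarrow> real)" using fin by (intro integrable_real_indicator) auto
    have "\<bar>\<phi> x\<bar> powr p \<le> indicator U x" for x
    proof (cases "x \<in> U")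
      case True
      then have "\<bar>\<phi> x\<bar> powr p \<le> 1" using b[of x] p by (intro powr_le1) auto
      then show ?thesis using True by simp
    qed (simp add: z)
    then show "AE x in lborel. norm (\<bar>\<phi> x\<bar> powr p) \<le> norm (indicator U x :: real)" by simp
  qed measurable
  then have "integrable lebesgue (\<lambda>x. \<bar>\<phi> x\<bar> powr p)" by (subst integrable_completion) auto
  moreover have "\<phi> \<in> borel_measurable lebesgue" by (intro measurable_completion) simp
  moreover have "gag \<phi> < \<infinity>"
    by (rule gagliardo_lipschitz_finite[OF _ s m _ bU z lip]) (use p in auto)
  ultimately show ?thesis unfolding W_iff \<phi>_def[symmetric] using z U by auto
qed

text \<open>The difference \<open>f\<close> of the right-hand sides pairs to 0 with all of
  \<open>W\<close>. Cutoffs carry this to open subsets of \<Omega>, outer regularity and boundedness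
  of \<open>f\<close> to all measurable subsets, and a function whose integral vanishes on each of
  these is 0 almost everywhere.\<close>

lemma maximizer_determines_rhs:
  assumes u: "u \<in> W" and g: "g \<in> Linfty \<Omega>" "g' \<in> Linfty \<Omega>"
    and max: "\<And>v. v \<in> W \<Longrightarrow> E g v \<le> E g u"
      "\<And>v. v \<in> W \<Longrightarrow> E g' v \<le> E g' u"
  shows "AE x in \<mu>. g x = g' x"
proof -
  obtain C where gm: "g \<in> borel_measurable \<mu>" and C: "AE x in \<mu>. \<bar>g x\<bar> \<le> C"
    using g(1) unfolding Linfty_def by blast
  obtain C' where gm': "g' \<in> borel_measurable \<mu>" and C': "AE x in \<mu>. \<bar>g' x\<bar> \<le> C'"
    using g(2) unfolding Linfty_def by blast
  define f where "f x = g x - g' x" for x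
  define B where "B = max 1 (C + C')"
  have B: "0 < B" "AE x in \<mu>. \<bar>f x\<bar> \<le> B"
    unfolding B_def f_def using C C' by (auto elim!: eventually_elim2)
  have fm[measurable]: "f \<in> borel_measurable \<mu>" unfolding f_def using gm gm' by measurable
  have fint: "integrable \<mu> f"
    by (rule Bochner_Integration.integrable_bound[where f="\<lambda>x. B"]) (use B in auto)
  have openU: "(LINT x|\<mu>. indicator U x * f x) = 0" if U: "open U" "U \<subseteq> \<Omega>" for U
  proof -
    define \<phi> where "\<phi> k x = min 1 (real k * infdist x (- U))" for k x
    have \<phi>W: "\<phi> k \<in> W" for k unfolding \<phi>_def using cutoff_W[OF U] .
    have zero: "(LINT x|\<mu>. \<phi> k x * f x) = 0" for k
      using maximizers_same_pairing[OF u g \<phi>W max, of k] energy_eq(1)[OF \<phi>W[of k] g(1)] energy_eq(1)[OF \<phi>W[of k] g(2)]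
      unfolding f_def by (simp add: right_diff_distrib mult.commute)
    \<comment> \<open>The distance to the empty set is 0 by convention, so the cutoffs reach 1
      inside \<open>U\<close> only because boundedness of \<Omega> leaves a nonempty
      complement.\<close>
    have ne: "- U \<noteq> {}"
    proof
      assume "- U = {}"
      then have "U = UNIV" by auto
      then show False using bounded_subset[OF bounded_\<Omega> U(2)] not_bounded_UNIV by metis
    qed
    have "(\<lambda>k. LINT x|\<mu>. \<phi> k x * f x) \<longlonglongrightarrow> (LINT x|\<mu>. indicator U x * f x)"
    proof (rule integral_dominated_convergence[where w="\<lambda>x. \<bar>f x\<bar>"])
      show "AE x in \<mu>. (\<lambda>k. \<phi> k x * f x) \<longlonglongrightarrow> indicator U x * f x"
      proof (intro always_eventually allI tendsto_mult tendsto_const)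
        fix x
        show "(\<lambda>k. \<phi> k x) \<longlonglongrightarrow> indicator U x"
        proof (cases "x \<in> U")
          case True
          have "infdist x (- U) \<noteq> 0" using in_closed_iff_infdist_zero[of "- U" x] ne True U(1) by auto
          then have d: "0 < infdist x (- U)" using infdist_nonneg[of x "- U"] by linarith
          obtain k0 where k0: "1 / infdist x (- U) < real k0" using reals_Archimedean2 by blast
          have "\<phi> k x = 1" if "k \<ge> k0" for k
          proof -
            have "1 / infdist x (- U) < real k" using k0 that by linarith
            then have "1 < real k * infdist x (- U)" using d by (simp add: pos_divide_less_eq)
            then show ?thesis unfolding \<phi>_def by simp
          qed
          then have "eventually (\<lambda>k. \<phi> k x = indicator U x) sequentially"
            using True by (auto simp: eventually_sequentially)
          then show ?thesis by (rule tendsto_eventually)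
        next
          case False
          then show ?thesis by (simp add: \<phi>_def)
        qed
      qed
      show "AE x in \<mu>. norm (\<phi> k x * f x) \<le> \<bar>f x\<bar>" for k
        using infdist_nonneg[of _ "- U"] by (intro always_eventually allI) (auto simp: \<phi>_def abs_mult intro!: mult_left_le_one_le)
      have "U \<in> sets lebesgue" using U by auto
      then show "(\<lambda>x. indicator U x * f x) \<in> borel_measurable \<mu>"
        using measurable_on[OF borel_measurable_indicator[of U lebesgue]] fm by measurable
      show "(\<lambda>x. \<phi> k x * f x) \<in> borel_measurable \<mu>" for k
        using W_D(6)[OF \<phi>W[of k]] fm by measurable
    qed (use fint in auto)
    then show ?thesis using zero by (simp add: LIMSEQ_const_iff)
  qed
  have allA: "set_lebesgue_integral \<mu> A f = 0" if A: "A \<in> sets \<mu>" for A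
  proof -
    have A': "A \<in> sets lebesgue" "A \<subseteq> \<Omega>" using A by (auto simp: sets_restrict_space_iff)
    have int: "integrable \<mu> (\<lambda>x. indicator D x * f x)" if "D \<in> sets \<mu>" for D
      using integrable_mult_indicator[OF that fint] by simp
    have "\<bar>LINT x|\<mu>. indicator A x * f x\<bar> \<le> 0 + e" if e: "0 < e" for e
    proof -
      \<comment> \<open>The integral over the open set \<open>T \<inter> \<Omega>\<close> vanishes,
        so the integral over \<open>A\<close> is minus the one over the excess. As \<open>f\<close>
        is bounded by \<open>B\<close>, an excess of measure below \<open>e / B\<close> contributes
        at most \<open>e\<close>.\<close>
      obtain T where T: "open T" "A \<subseteq> T" "T - A \<in> lmeasurable" "emeasure lebesgue (T - A) < ennreal (e / B)"
        using sets_lebesgue_outer_open[OF A'(1), of "e / B"] e B(1) by auto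
      define V where "V = T \<inter> \<Omega>"
      have V: "open V" "V \<subseteq> \<Omega>" "A \<subseteq> V" unfolding V_def using T open_\<Omega> A' by auto
      have Vs: "V \<in> sets \<mu>" "V - A \<in> sets \<mu>"
        using V A by (auto simp: sets_restrict_space_iff)
      have split: "indicator V x * f x = indicator A x * f x + indicator (V - A) x * f x" for x
        using V(3) by (auto simp: indicator_def)
      have "0 = (LINT x|\<mu>. indicator A x * f x) + (LINT x|\<mu>. indicator (V - A) x * f x)"
        using openU[OF V(1,2)] int[OF A] int[OF Vs(2)] unfolding split by simp
      then have "\<bar>LINT x|\<mu>. indicator A x * f x\<bar> = norm (LINT x|\<mu>. indicator (V - A) x * f x)" by simp
      also have "\<dots> \<le> (LINT x|\<mu>. norm (indicator (V - A) x * f x))" by (rule integral_norm_bound)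
      also have "\<dots> \<le> (LINT x|\<mu>. indicator (V - A) x * B)"
      proof (rule integral_mono_AE)
        show "integrable \<mu> (\<lambda>x. indicator (V - A) x * B)"
          using Vs(2) by (intro integrable_mult_left integrable_real_indicator) (auto simp: less_top[symmetric])
        show "AE x in \<mu>. norm (indicator (V - A) x * f x) \<le> indicator (V - A) x * B"
          using B(2) by eventually_elim (auto simp: indicator_def)
      qed (intro integrable_norm int Vs)
      also have "\<dots> = measure \<mu> (V - A) * B"
        using Vs sets.sets_into_space[OF Vs(2)] by (simp add: Int_absorb2)
      also have "measure \<mu> (V - A) = measure lebesgue (V - A)"
        using V by (intro measure_restrict_space) auto
      also have "measure lebesgue (V - A) * B \<le> e / B * B"
      proof (intro mult_right_mono)
        have "measure lebesgue (V - A) \<le> measure lebesgue (T - A)"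
          using Vs(2) V T(3) by (intro measure_mono_fmeasurable) (auto simp: V_def sets_restrict_space_iff)
        also have "\<dots> \<le> e / B" using T(3,4) e B(1) by (simp add: emeasure_eq_measure2 ennreal_less_iff)
        finally show "measure lebesgue (V - A) \<le> e / B" .
      qed (use B in simp)
      finally show ?thesis using B(1) by simp
    qed
    then have "\<bar>LINT x|\<mu>. indicator A x * f x\<bar> \<le> 0" by (rule field_le_epsilon)
    then show ?thesis by (simp add: set_lebesgue_integral_def)
  qed
  have "AE x in \<mu>. f x = 0" by (rule \<Omega>.density_zero[OF fint allA])
  then show ?thesis by eventually_elim (simp add: f_def)
qed

section \<open>Maximal energy and the rearrangement class\<close>

lemma space_on [simp]: "space \<mu> = \<Omega>"
  by (simp add: space_restrict_space)

lemma pairing_lipschitz: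
  assumes g: "g \<in> Linfty \<Omega>" "AE x in \<mu>. \<bar>g x\<bar> \<le> C" and "u \<in> W" "v \<in> W"
  shows "\<bar>(LINT x|\<mu>. g x * u x) - (LINT x|\<mu>. g x * v x)\<bar> \<le> C * (LINT x|\<mu>. \<bar>u x - v x\<bar>)"
proof -
  let ?f = "\<lambda>x. g x * u x - g x * v x" and ?d = "(LINT x|\<mu>. g x * u x) - (LINT x|\<mu>. g x * v x)"
  note i = energy_eq(1)[OF assms(3) g(1)] energy_eq(1)[OF assms(4) g(1)]
  have "?d = (LINT x|\<mu>. ?f x)"
    using i by simp
  then have "\<bar>?d\<bar> \<le> (LINT x|\<mu>. norm (?f x))"
    using integral_norm_bound[of "\<mu>" ?f] by simp
  also have "\<dots> \<le> (LINT x|\<mu>. C * \<bar>u x - v x\<bar>)"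
  proof (rule integral_mono_AE)
    show "AE x in \<mu>. norm (?f x) \<le> C * \<bar>u x - v x\<bar>"
      using g(2) by eventually_elim (auto simp: right_diff_distrib[symmetric] abs_mult intro!: mult_right_mono)
  qed (use i W_D(8)[OF assms(3)] W_D(8)[OF assms(4)] in auto)
  finally show ?thesis by simp
qed

lemma max_energy_attained:
  assumes g: "g \<in> Linfty \<Omega>"
  shows "\<exists>u\<in>W. \<forall>v\<in>W. E g v \<le> E g u"
proof -
  obtain C where C: "AE x in \<mu>. \<bar>g x\<bar> \<le> C" using g unfolding Linfty_def by blast
  then have C': "AE x in \<mu>. \<bar>g x\<bar> \<le> max 0 C" by eventually_elim simp
  obtain u where "u \<in> W" "\<forall>v\<in>W. (LINT x|\<mu>. g x * v x) - J v \<le> (LINT x|\<mu>. g x * u x) - J u"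
  proof -
    have "\<exists>u\<in>W. \<forall>v\<in>W. (LINT x|\<mu>. g x * v x) - J v \<le> (LINT x|\<mu>. g x * u x) - J u"
      by (rule attainment[where B="max 0 C"]) (rule pairing_lipschitz[OF g C'], assumption+, simp)
    then show ?thesis using that by blast
  qed
  then show ?thesis by (intro bexI[of _ u] ballI) (simp_all add: energy_eq(2)[OF _ g])
qed

lemma max_energy_eq:
  assumes "u \<in> W" "\<And>v. v \<in> W \<Longrightarrow> E g v \<le> E g u"
  shows "max_energy K h s p \<Omega> g = E g u"
  unfolding max_energy_def using assms by (intro cSup_eq_maximum) auto

lemma energy_le_max_energy:
  assumes "g \<in> Linfty \<Omega>" "u \<in> W"
  shows "E g u \<le> max_energy K h s p \<Omega> g"
  using max_energy_attained[OF assms(1)] max_energy_eq assms(2) by metis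

text \<open>\<open>arg_max_on\<close> is a choice, which becomes meaningful once
  \<open>max_energy_attained\<close> provides a maximum.\<close>

lemma maximizer_maximal:
  assumes g: "g \<in> Linfty \<Omega>"
  shows "maximizer K h s p \<Omega> g \<in> W"
    and "v \<in> W \<Longrightarrow> E g v \<le> E g (maximizer K h s p \<Omega> g)"
proof -
  obtain u where "u \<in> W" "\<forall>v\<in>W. E g v \<le> E g u" using max_energy_attained[OF g] by blast
  then have "is_arg_max (E g) (\<lambda>u. u \<in> W) u" unfolding is_arg_max_def by (meson not_less)
  then have "is_arg_max (E g) (\<lambda>u. u \<in> W) (maximizer K h s p \<Omega> g)"
    unfolding maximizer_def arg_max_on_def arg_max_def
    using someI[of "is_arg_max (E g) (\<lambda>u. u \<in> W)" u] by simp
  then show "maximizer K h s p \<Omega> g \<in> W"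
    and "v \<in> W \<Longrightarrow> E g v \<le> E g (maximizer K h s p \<Omega> g)"
    unfolding is_arg_max_def by (auto simp: not_less)
qed

lemma level_set_sets:
  fixes g :: "'a \<Rightarrow> real"
  assumes "g \<in> borel_measurable \<mu>"
  shows "{x\<in>\<Omega>. t < g x} \<in> sets \<mu>" "{x\<in>\<Omega>. t < g x} \<in> sets lebesgue"
proof -
  have "{x\<in>space \<mu>. t < g x} \<in> sets \<mu>" using assms by measurable
  then show 1: "{x\<in>\<Omega>. t < g x} \<in> sets \<mu>" by simp
  then show "{x\<in>\<Omega>. t < g x} \<in> sets lebesgue" by (simp add: sets_restrict_space_iff)
qed

lemma emeasure_level_set:
  fixes g :: "'a \<Rightarrow> real"
  assumes "g \<in> borel_measurable \<mu>"
  shows "emeasure lebesgue {x\<in>\<Omega>. t < g x} = ennreal (measure \<mu> {x\<in>\<Omega>. t < g x})"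
proof -
  have "emeasure lebesgue {x\<in>\<Omega>. t < g x} = emeasure \<mu> {x\<in>\<Omega>. t < g x}"
    by (rule emeasure_restrict_space[symmetric]) auto
  then show ?thesis using \<Omega>.emeasure_eq_measure by simp
qed

lemma rearrangements_iff:
  assumes g0: "g0 \<in> borel_measurable \<mu>"
  shows "g \<in> rearrangements \<Omega> g0 \<longleftrightarrow> g \<in> Linfty \<Omega> \<and> (AE x in \<mu>. 0 \<le> g x) \<and>
    (\<forall>t\<ge>0. measure \<mu> {x\<in>\<Omega>. t < g x} = measure \<mu> {x\<in>\<Omega>. t < g0 x})"
proof -
  have "g \<in> Linfty \<Omega> \<Longrightarrow> g \<in> borel_measurable \<mu>" unfolding Linfty_def by blast
  then show ?thesis unfolding rearrangements_def using emeasure_level_set[OF g0] emeasure_level_set[of g] by auto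
qed

lemma rearrangements_cong_AE:
  assumes g0: "g0 \<in> borel_measurable \<mu>" and f: "f \<in> rearrangements \<Omega> g0"
    and g: "g \<in> Linfty \<Omega>" and ae: "AE x in \<mu>. g x = f x"
  shows "g \<in> rearrangements \<Omega> g0"
proof -
  have fm: "f \<in> borel_measurable \<mu>" using f unfolding rearrangements_def Linfty_def by blast
  have gm: "g \<in> borel_measurable \<mu>" using g unfolding Linfty_def by blast
  have "measure \<mu> {x\<in>\<Omega>. t < g x} = measure \<mu> {x\<in>\<Omega>. t < f x}" for t
    using ae level_set_sets(1)[OF fm, of t] level_set_sets(1)[OF gm, of t]
    by (intro \<Omega>.finite_measure_eq_AE) (auto elim: eventually_mono)
  moreover have "AE x in \<mu>. 0 \<le> f x" using f unfolding rearrangements_iff[OF g0] by blast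
  then have "AE x in \<mu>. 0 \<le> g x" using ae by eventually_elim simp
  ultimately show ?thesis using f g unfolding rearrangements_iff[OF g0] by simp
qed

text \<open>Equimeasurability at the single level \<open>C\<close> transfers the essential bound of
  \<open>g0\<close>. One constant thus serves the whole class.\<close>

lemma rearrangements_bound:
  assumes g0: "g0 \<in> borel_measurable \<mu>" and f: "f \<in> rearrangements \<Omega> g0"
    and C: "AE x in \<mu>. g0 x \<le> C" "0 \<le> C"
  shows "AE x in \<mu>. 0 \<le> f x \<and> f x \<le> C"
proof -
  have fm: "f \<in> borel_measurable \<mu>" using f unfolding rearrangements_def Linfty_def by blast
  have "AE x in \<mu>. x \<notin> {x\<in>\<Omega>. C < g0 x}" using C(1) by eventually_elim auto
  then have "measure \<mu> {x\<in>\<Omega>. C < g0 x} = 0"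
    using level_set_sets(1)[OF g0, of C] by (subst (asm) AE_iff_null_sets[symmetric]) (auto intro: measure_eq_0_null_sets)
  then have "measure \<mu> {x\<in>\<Omega>. C < f x} = 0" using f C(2) unfolding rearrangements_iff[OF g0] by simp
  then have "{x\<in>\<Omega>. C < f x} \<in> null_sets \<mu>"
    using level_set_sets(1)[OF fm, of C] by (auto simp: null_sets_def \<Omega>.emeasure_eq_measure)
  then have "AE x in \<mu>. x \<notin> {x\<in>\<Omega>. C < f x}" by (rule AE_not_in)
  moreover have "AE x in \<mu>. 0 \<le> f x" using f unfolding rearrangements_iff[OF g0] by blast
  ultimately show ?thesis using AE_space by eventually_elim auto
qed

text \<open>The tie-breaking function \<open>w\<close> is left free so that one \<open>u\<close> can
  be served with opposite tie breaks.\<close>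

lemma best_rearrangement_exists:
  assumes g0: "g0 \<in> borel_measurable \<mu>" and C: "AE x in \<mu>. g0 x \<le> C" "0 \<le> C"
    and u: "u \<in> W" and w: "w \<in> borel_measurable \<mu>"
      "\<And>\<tau>. measure \<mu> {x\<in>\<Omega>. w x = \<tau>} = 0"
  shows "\<exists>g\<in>rearrangements \<Omega> g0. (\<forall>f\<in>rearrangements \<Omega> g0. (LINT x|\<mu>. f x * u x) \<le> (LINT x|\<mu>. g x * u x)) \<and>
    (\<forall>t\<ge>0. lex_upper \<Omega> u w {x\<in>\<Omega>. t < g x})"
proof -
  obtain g where g: "g \<in> borel_measurable \<mu>" "\<And>x. 0 \<le> g x \<and> g x \<le> C"
    "\<And>t. 0 \<le> t \<Longrightarrow> measure \<mu> {x\<in>\<Omega>. t < g x} = measure \<mu> {x\<in>\<Omega>. t < g0 x}"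
    "\<And>t. 0 \<le> t \<Longrightarrow> lex_upper \<Omega> u w {x\<in>\<Omega>. t < g x}"
    using \<Omega>.comonotone_rearrangement_exists[OF g0 W_D(6)[OF u] w(1) _ C] w(2) by auto
  have "g \<in> Linfty \<Omega>" unfolding Linfty_def using g(1,2) by (auto intro!: exI[of _ C])
  then have gr: "g \<in> rearrangements \<Omega> g0" unfolding rearrangements_iff[OF g0] using g(2,3) by simp
  have "(LINT x|\<mu>. f x * u x) \<le> (LINT x|\<mu>. g x * u x)" if f: "f \<in> rearrangements \<Omega> g0" for f
  proof (rule \<Omega>.comonotone_integral_le[where C=C and w=w])
    show "f \<in> borel_measurable \<mu>" using f unfolding rearrangements_def Linfty_def by blast
    show "AE x in \<mu>. 0 \<le> f x \<and> f x \<le> C" by (rule rearrangements_bound[OF g0 f C])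
    show "measure \<mu> {x\<in>space \<mu>. t < f x} = measure \<mu> {x\<in>space \<mu>. t < g x}" if "0 \<le> t" for t
      using f g(3)[OF that] that unfolding rearrangements_iff[OF g0] by simp
  qed (use g W_D(8)[OF u] in auto)
  then show ?thesis using gr g(4) by blast
qed

lemma hyperplane_null:
  assumes "e \<in> Basis"
  shows "measure \<mu> {x\<in>\<Omega>. x \<bullet> e = \<tau>} = 0"
proof -
  have "negligible {x. e \<bullet> x = \<tau>}" using assms by (intro negligible_hyperplane) auto
  then have "negligible {x\<in>\<Omega>. x \<bullet> e = \<tau>}" by (rule negligible_subset) (auto simp: inner_commute)
  then have "{x\<in>\<Omega>. x \<bullet> e = \<tau>} \<in> null_sets lebesgue" by (simp only: negligible_iff_null_sets)
  then have "measure lebesgue {x\<in>\<Omega>. x \<bullet> e = \<tau>} = 0" by (rule measure_eq_0_null_sets)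
  then show ?thesis by (subst measure_restrict_space) auto
qed

subsection \<open>Maximization over the rearrangement class\<close>

theorem rearrangement_maximization:
  assumes g0: "g0 \<in> Linfty \<Omega>"
  defines "\<G> \<equiv> rearrangements \<Omega> g0" and "\<Phi> \<equiv> max_energy K h s p \<Omega>"
  shows "\<exists>g'\<in>\<G>. \<forall>g\<in>\<G>. \<Phi> g \<le> \<Phi> g'"
    and "g' \<in> \<G> \<Longrightarrow> (\<And>g. g \<in> \<G> \<Longrightarrow> \<Phi> g \<le> \<Phi> g') \<Longrightarrow>
      g \<in> rearrangements_closure \<Omega> g0 - \<G> \<Longrightarrow> \<Phi> g < \<Phi> g'"
    and "g' \<in> \<G> \<Longrightarrow> (\<And>g. g \<in> \<G> \<Longrightarrow> \<Phi> g \<le> \<Phi> g') \<Longrightarrow>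
      \<exists>\<eta> :: real \<Rightarrow> real. mono \<eta> \<and> (AE x in \<mu>. g' x = \<eta> (maximizer K h s p \<Omega> g' x))"
proof -
  have g0m: "g0 \<in> borel_measurable \<mu>" using g0 unfolding Linfty_def by blast
  obtain C' where "AE x in \<mu>. \<bar>g0 x\<bar> \<le> C'" using g0 unfolding Linfty_def by blast
  then have C: "AE x in \<mu>. g0 x \<le> max 0 C'" by eventually_elim auto
  define C where "C = max 0 C'"
  note C = C[folded C_def]
  have C0: "0 \<le> C" unfolding C_def by simp
  have GL: "g \<in> \<G> \<Longrightarrow> g \<in> Linfty \<Omega>" for g unfolding \<G>_def rearrangements_def by blast
  have Gb: "AE x in \<mu>. 0 \<le> g x \<and> g x \<le> C" if "g \<in> \<G>" for g
    using rearrangements_bound[OF g0m _ C C0] that unfolding \<G>_def .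
  obtain e :: 'a where e: "e \<in> Basis" using nonempty_Basis by blast
  \<comment> \<open>The level sets of a coordinate and of its negative are pieces of hyperplanes,
    hence null.\<close>
  define w where "w x = x \<bullet> e" for x
  have wm: "w \<in> borel_measurable \<mu>" "(\<lambda>x. - w x) \<in> borel_measurable \<mu>"
    unfolding w_def by (intro measurable_on measurable_completion; simp)+
  have wn: "measure \<mu> {x\<in>\<Omega>. w x = \<tau>} = 0" "measure \<mu> {x\<in>\<Omega>. - w x = \<tau>} = 0" for \<tau>
  proof -
    have "{x\<in>\<Omega>. - w x = \<tau>} = {x\<in>\<Omega>. x \<bullet> e = - \<tau>}" unfolding w_def by auto
    then show "measure \<mu> {x\<in>\<Omega>. w x = \<tau>} = 0" "measure \<mu> {x\<in>\<Omega>. - w x = \<tau>} = 0"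
      using hyperplane_null[OF e] by (simp_all add: w_def)
  qed
  define I where "I g u = (LINT x|\<mu>. g x * u x)" for g u :: "'a \<Rightarrow> real"
  have "\<forall>u. \<exists>g. u \<in> W \<longrightarrow> g \<in> \<G> \<and> (\<forall>f\<in>\<G>. I f u \<le> I g u)"
    using best_rearrangement_exists[OF g0m C C0 _ wm(1) wn(1)] unfolding \<G>_def I_def by blast
  then obtain best where best: "\<And>u. u \<in> W \<Longrightarrow> best u \<in> \<G>" "\<And>u f. u \<in> W \<Longrightarrow> f \<in> \<G> \<Longrightarrow> I f u \<le> I (best u) u" by metis
  define M where "M u = I (best u) u" for u
  \<comment> \<open>\<open>best u\<close> is a competitor for \<open>v\<close>, so
    \<open>M u - M v\<close> is at most the change of one fixed pairing; all rearrangements share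
    the bound \<open>C\<close>, which becomes the Lipschitz constant.\<close>
  have M1: "M u - M v \<le> C * (LINT x|\<mu>. \<bar>u x - v x\<bar>)" if uv: "u \<in> W" "v \<in> W" for u v
  proof -
    have "AE x in \<mu>. \<bar>best u x\<bar> \<le> C" using Gb[OF best(1)[OF uv(1)]] by eventually_elim simp
    then have "\<bar>I (best u) u - I (best u) v\<bar> \<le> C * (LINT x|\<mu>. \<bar>u x - v x\<bar>)"
      unfolding I_def by (rule pairing_lipschitz[OF GL[OF best(1)[OF uv(1)]] _ uv])
    moreover have "I (best u) v \<le> M v" unfolding M_def by (rule best(2)[OF uv(2) best(1)[OF uv(1)]])
    ultimately show ?thesis unfolding M_def by linarith
  qed
  have "\<bar>M u - M v\<bar> \<le> C * (LINT x|\<mu>. \<bar>u x - v x\<bar>)" if "u \<in> W" "v \<in> W" for u v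
    using M1[OF that] M1[OF that(2,1)] by (simp add: abs_minus_commute abs_le_iff)
  then obtain \<uu> where \<uu>: "\<uu> \<in> W" "\<And>v. v \<in> W \<Longrightarrow> M v - J v \<le> M \<uu> - J \<uu>"
    using attainment[of M C] C0 by blast
  define S where "S = M \<uu> - J \<uu>"
  have en: "E g u = I g u - J u" if "g \<in> Linfty \<Omega>" "u \<in> W" for g u
    unfolding I_def by (rule energy_eq(2)[OF that(2,1)])
  \<comment> \<open>Stated for every \<open>g\<close> whose pairings stay below \<open>M\<close>, so
    that it reaches beyond the class itself.\<close>
  have upper: "\<Phi> g \<le> S" if g: "g \<in> Linfty \<Omega>" "\<And>u. u \<in> W \<Longrightarrow> I g u \<le> M u" for g
  proof -
    obtain u where u: "u \<in> W" "\<And>v. v \<in> W \<Longrightarrow> E g v \<le> E g u"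
      using max_energy_attained[OF g(1)] by blast
    have "\<Phi> g = E g u" unfolding \<Phi>_def by (rule max_energy_eq[OF u])
    also have "\<dots> = I g u - J u" by (rule en[OF g(1) u(1)])
    also have "\<dots> \<le> S" unfolding S_def using g(2)[OF u(1)] \<uu>(2)[OF u(1)] by linarith
    finally show ?thesis .
  qed
  have upperG: "\<Phi> g \<le> S" if "g \<in> \<G>" for g
    using upper[OF GL[OF that]] best(2)[OF _ that] unfolding M_def by blast
  \<comment> \<open>Testing the energy of \<open>best \<uu>\<close> with \<open>\<uu>\<close> itself
    gives exactly \<open>S\<close>, so the upper bound is attained inside the class.\<close>
  have bestS: "S \<le> \<Phi> (best \<uu>)"
    using energy_le_max_energy[OF GL[OF best(1)[OF \<uu>(1)]] \<uu>(1)] en[OF GL[OF best(1)[OF \<uu>(1)]] \<uu>(1)]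
    unfolding S_def M_def \<Phi>_def by simp
  show "\<exists>g'\<in>\<G>. \<forall>g\<in>\<G>. \<Phi> g \<le> \<Phi> g'"
    using best(1)[OF \<uu>(1)] upperG bestS by (meson order_trans)
  \<comment> \<open>For every \<open>v\<close>, E f v \<le> \<Phi> f \<le> S \<le> \<Phi> g = I g u
    - J u \<le> I f u - J u = E f u. Thus \<open>u\<close> maximizes the energies of both
    \<open>f\<close> and \<open>g\<close>, which forces the two to agree.\<close>
  have key: "AE x in \<mu>. g x = f x"
    if g: "g \<in> Linfty \<Omega>" "I g u \<le> M u" "S \<le> \<Phi> g" and u: "u \<in> W"
      and max: "\<And>v. v \<in> W \<Longrightarrow> E g v \<le> E g u"
      and f: "f \<in> \<G>" "M u \<le> I f u" for f g u
  proof (rule maximizer_determines_rhs[OF u g(1) GL[OF f(1)] max])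
    fix v assume v: "v \<in> W"
    have "E f v \<le> \<Phi> f" unfolding \<Phi>_def by (rule energy_le_max_energy[OF GL[OF f(1)] v])
    also have "\<dots> \<le> \<Phi> g" using upperG[OF f(1)] g(3) by linarith
    also have "\<dots> = E g u" unfolding \<Phi>_def by (rule max_energy_eq[OF u max])
    also have "\<dots> = I g u - J u" by (rule en[OF g(1) u])
    also have "\<dots> \<le> I f u - J u" using g(2) f(2) by linarith
    finally show "E f v \<le> E f u" unfolding en[OF GL[OF f(1)] u] .
  qed
  show "\<Phi> g < \<Phi> g'" if g': "g' \<in> \<G>" "\<And>g. g \<in> \<G> \<Longrightarrow> \<Phi> g \<le> \<Phi> g'" and g: "g \<in> rearrangements_closure \<Omega> g0 - \<G>"
  proof (rule ccontr)
    assume "\<not> \<Phi> g < \<Phi> g'"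
    then have Sg: "S \<le> \<Phi> g" using bestS g'(2)[OF best(1)[OF \<uu>(1)]] by linarith
    have sub: "\<G> \<subseteq> Linfty \<Omega>" using GL by blast
    have cl: "g \<in> weak_star_topology \<Omega> closure_of \<G>" using g unfolding rearrangements_closure_def \<G>_def by blast
    \<comment> \<open>The weak* closure enters only here: each bound by \<open>M u\<close> is a
      closed half-space containing the class.\<close>
    have gI: "g \<in> Linfty \<Omega> \<and> I g u \<le> M u" if "u \<in> W" for u
      using closure_weak_star_pairing_le[OF sub _ _ cl, of u "M u"] W_D(8)[OF that] best(2)[OF that]
      unfolding L1_def I_def M_def by blast
    then have gL: "g \<in> Linfty \<Omega>" using \<uu>(1) by blast
    obtain u where u: "u \<in> W" "\<And>v. v \<in> W \<Longrightarrow> E g v \<le> E g u"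
      using max_energy_attained[OF gL] by blast
    \<comment> \<open>A point of the closure with maximal value agrees almost everywhere with a
      rearrangement; being equimeasurable with \<open>g0\<close> is insensitive to null sets, which
      contradicts the choice of \<open>g\<close>.\<close>
    have "AE x in \<mu>. g x = best u x"
      by (rule key[OF gL _ Sg u best(1)[OF u(1)]]) (use gI[OF u(1)] in \<open>auto simp: M_def\<close>)
    then have "g \<in> \<G>" using rearrangements_cong_AE[OF g0m _ gL] best(1)[OF u(1)] unfolding \<G>_def by blast
    then show False using g by blast
  qed
  show "\<exists>\<eta> :: real \<Rightarrow> real. mono \<eta> \<and> (AE x in \<mu>. g' x = \<eta> (maximizer K h s p \<Omega> g' x))"
    if g': "g' \<in> \<G>" "\<And>g. g \<in> \<G> \<Longrightarrow> \<Phi> g \<le> \<Phi> g'"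
  proof -
    define u where "u = maximizer K h s p \<Omega> g'"
    have u: "u \<in> W" "\<And>v. v \<in> W \<Longrightarrow> E g' v \<le> E g' u"
      unfolding u_def using maximizer_maximal[OF GL[OF g'(1)]] by auto
    have Sg: "S \<le> \<Phi> g'" using bestS g'(2)[OF best(1)[OF \<uu>(1)]] by linarith
    have gM: "I g' u \<le> M u" unfolding M_def by (rule best(2)[OF u(1) g'(1)])
    \<comment> \<open>\<open>f1\<close> and \<open>f2\<close> are both optimal for \<open>u\<close>
      but fill its plateaus in opposite directions. Both must equal \<open>g'\<close>, so their
      superlevel sets agree up to null sets at every level.\<close>
    obtain f1 where f1: "f1 \<in> \<G>" "\<And>f. f \<in> \<G> \<Longrightarrow> I f u \<le> I f1 u" "\<And>t. 0 \<le> t \<Longrightarrow> lex_upper \<Omega> u w {x\<in>\<Omega>. t < f1 x}"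
      using best_rearrangement_exists[OF g0m C C0 u(1) wm(1) wn(1)] unfolding \<G>_def I_def by blast
    obtain f2 where f2: "f2 \<in> \<G>" "\<And>f. f \<in> \<G> \<Longrightarrow> I f u \<le> I f2 u" "\<And>t. 0 \<le> t \<Longrightarrow> lex_upper \<Omega> u (\<lambda>x.
        - w x) {x\<in>\<Omega>. t < f2 x}"
      using best_rearrangement_exists[OF g0m C C0 u(1) wm(2) wn(2)] unfolding \<G>_def I_def by blast
    have ae1: "AE x in \<mu>. g' x = f1 x"
      by (rule key[OF GL[OF g'(1)] gM Sg u f1(1)]) (use f1(2)[OF best(1)[OF u(1)]] in \<open>auto simp: M_def\<close>)
    have ae2: "AE x in \<mu>. g' x = f2 x"
      by (rule key[OF GL[OF g'(1)] gM Sg u f2(1)]) (use f2(2)[OF best(1)[OF u(1)]] in \<open>auto simp: M_def\<close>)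
    show ?thesis unfolding u_def[symmetric]
    proof (rule ex_mono_of_level_sets[OF Gb[OF g'(1)] C0])
      fix t :: real assume t: "0 \<le> t"
      have "AE x in \<mu>. x \<in> {x\<in>\<Omega>. t < f1 x} \<longleftrightarrow> x \<in> {x\<in>\<Omega>. t < f2 x}"
        using ae1 ae2 by eventually_elim simp
      then obtain A where A: "\<forall>a\<in>A. \<forall>b\<ge>a. b \<in> A" "AE x in \<mu>. x \<in> {x\<in>\<Omega>. t < f1 x} \<longleftrightarrow> u x \<in> A"
        using lex_upper_both_tie_breaks[of "\<mu>" u w, unfolded space_on, OF f1(3)[OF t] f2(3)[OF t]] by blast
      have "AE x in \<mu>. t < g' x \<longleftrightarrow> u x \<in> A"
        using A(2) ae1 AE_space by eventually_elim simp
      then show "\<exists>I. (\<forall>a\<in>I. \<forall>b\<ge>a. b \<in> I) \<and> (AE x in \<mu>. t < g' x \<longleftrightarrow> u x \<in> I)"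
        using A(1) by blast
    qed
  qed
qed

end

theorem theorem4p1:
  fixes \<Omega> :: "(real ^ 'n) set"
    and K :: "real ^ 'n \<Rightarrow> real ^ 'n \<Rightarrow> real"
    and h :: "real ^ 'n \<Rightarrow> real \<Rightarrow> real"
    and g0 :: "real ^ 'n \<Rightarrow> real"
    and p s q C0 C1 C2 :: real
  assumes "CARD('n) \<ge> 2"
    and "open \<Omega>" "connected \<Omega>" "\<Omega> \<noteq> {}" "bounded \<Omega>" "C11_boundary \<Omega>"
    and "p > 1" "0 < s" "s < 1"
    and "(\<lambda>(x, y). K x y) \<in> borel_measurable lebesgue"
    and "0 < C1" "C1 \<le> C2"
    and "AE (x, y) in lebesgue. K x y = K y x"
    and "AE (x, y) in lebesgue.
           C1 \<le> K x y * norm (x - y) powr (real CARD('n) + p * s) \<and>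
           K x y * norm (x - y) powr (real CARD('n) + p * s) \<le> C2"
    and "caratheodory \<Omega> h"
    and "\<And>x t. x \<in> \<Omega> \<Longrightarrow> 0 \<le> h x t"
    and "AE x in lebesgue_on \<Omega>. mono (h x)"
    and "C0 > 0" "1 < q" "q < p"
    and "AE x in lebesgue_on \<Omega>. \<forall>t. h x t \<le> C0 * (1 + \<bar>t\<bar> powr (q - 1))"
    and "g0 \<in> Linfty \<Omega>" "AE x in lebesgue_on \<Omega>. 0 \<le> g0 x"
    and "\<not> (AE x in lebesgue_on \<Omega>. g0 x = 0)"
  shows
    "(\<exists>g'\<in>rearrangements \<Omega> g0. \<forall>g\<in>rearrangements \<Omega> g0.
        max_energy K h s p \<Omega> g \<le> max_energy K h s p \<Omega> g') \<and>
     (\<forall>g'\<in>rearrangements \<Omega> g0.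
        (\<forall>g\<in>rearrangements \<Omega> g0. max_energy K h s p \<Omega> g \<le> max_energy K h s p \<Omega> g') \<longrightarrow>
        (\<forall>g\<in>rearrangements_closure \<Omega> g0 - rearrangements \<Omega> g0.
           max_energy K h s p \<Omega> g < max_energy K h s p \<Omega> g')) \<and>
     (\<forall>g'\<in>rearrangements \<Omega> g0.
        (\<forall>g\<in>rearrangements \<Omega> g0. max_energy K h s p \<Omega> g \<le> max_energy K h s p \<Omega> g') \<longrightarrow>
        (\<exists>\<eta> :: real \<Rightarrow> real. mono \<eta> \<and>
           (AE x in lebesgue_on \<Omega>. g' x = \<eta> (maximizer K h s p \<Omega> g' x))))"
proof -
  interpret fractional_problem \<Omega> K h p s q C0 C1 C2
    using assms by unfold_locales simp_all
  show ?thesis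
    using rearrangement_maximization[OF assms(22)] by blast
qed

end
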